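(* Let $d\ge1$, let $s,t>1/2$, and for each integer $n\ge 1$ let $\mathcal V_n$ denote one and the same choice (with the same $s,t$ for all $n$) among the spaces $$\mathcal S_{1/2}(\mathbf R^n),\ \mathcal S_t^{1/2}(\mathbf R^n),\ \mathcal S_{1/2}^s(\mathbf R^n),\ \Sigma_t^s(\mathbf R^n),\ \mathcal S_t^s(\mathbf R^n),\ \mathscr S(\mathbf R^n),\ \mathscr S'(\mathbf R^n),\ (\mathcal S_t^s)'(\mathbf R^n),\ (\Sigma_t^s)'(\mathbf R^n).$$ Let $f\in\mathcal V_d$ be radial symmetric, and let $F_0$ be the entire function on $\mathbf C$ such that $(\mathfrak V_d f)(z)=F_0(\langle z,z\rangle)$ for all $z\in\mathbf C^d$. Then there is a unique $f_0\in\mathcal V_1$ such that $$(\mathfrak V_1f_0)(z)=F_0(z^2),\qquad z\in\mathbf C.$$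
   Context: $\mathbf N=\{0,1,2,\dots\}$. $\mathscr S(\mathbf R^n)$ is the Schwartz space and $\mathscr S'(\mathbf R^n)$ the space of tempered distributions. Gelfand-Shilov spaces: for $h,s,t>0$, $\mathcal S_{t,h}^s(\mathbf R^n)$ is the Banach space of all $f\in C^\infty(\mathbf R^n)$ such that $$\|f\|_{\mathcal S_{t,h}^s}=\sup_{\alpha,\beta\in\mathbf N^n}\ \sup_{x\in\mathbf R^n}\frac{|x^\beta\partial^\alpha f(x)|}{h^{|\alpha|+|\beta|}(\alpha!)^{s}(\beta!)^{t}}<\infty.$$ $\mathcal S_t^s(\mathbf R^n)=\bigcup_{h>0}\mathcal S_{t,h}^s(\mathbf R^n)$ with the inductive limit topology, and $\Sigma_t^s(\mathbf R^n)=\bigcap_{h>0}\mathcal S_{t,h}^s(\mathbf R^n)$ with the projective limit topology; $\mathcal S_{1/2}=\mathcal S_{1/2}^{1/2}$. $(\mathcal S_t^s)'(\mathbf R^n)$ and $(\Sigma_t^s)'(\mathbf R^n)$ are the duals of $\mathcal S_t^s(\mathbf R^n)$ and $\Sigma_t^s(\mathbf R^n)$, and $\mathcal S_{1/2}'(\mathbf R^n)$ is the dual of $\mathcal S_{1/2}(\mathbf R^n)$. All spaces $\mathcal V_n$ in the list are contained in $\mathcal S_{1/2}'(\mathbf R^n)$. For $z,w\in\mathbf C^n$, $\langle z,w\rangle=\sum_{j=1}^n z_jw_j$ (bilinear, no complex conjugation); between distributions and test functions $\langle\cdot,\cdot\rangle$ is the bilinear dual pairing. Bargmann transform: for $f\in\mathcal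 S_{1/2}'(\mathbf R^n)$, $\mathfrak V_nf$ is the entire function on $\mathbf C^n$ given by $(\mathfrak V_nf)(z)=\langle f,\mathfrak A_n(z,\cdot)\rangle$, where $$\mathfrak A_n(z,y)=\pi^{-n/4}\exp\Big(-\tfrac12(\langle z,z\rangle+|y|^2)+2^{1/2}\langle z,y\rangle\Big),\qquad z\in\mathbf C^n,\ y\in\mathbf R^n.$$ An element $f\in\mathcal S_{1/2}'(\mathbf R^d)$ is called radial symmetric if $U^*f=f$ for every unitary transformation (real linear isometry) $U$ of $\mathbf R^d$, where the pullback is given by $\langle U^*f,\varphi\rangle=\langle f,\varphi\circ U^{-1}\rangle$ for $\varphi\in\mathcal S_{1/2}(\mathbf R^d)$ (so $U^*f=f\circ U$ for functions). It is known that $f$ is radial symmetric if and only if $(\mathfrak V_df)(z)=F_0(\langle z,z\rangle)$ for some (necessarily unique) entire function $F_0$ on $\mathbf C$; this is the $F_0$ in the claim. *)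

theory Defs
  imports "HOL-Analysis.Analysis"
begin

definition partial_deriv :: "'n::finite \<Rightarrow> (real^'n \<Rightarrow> complex) \<Rightarrow> (real^'n \<Rightarrow> complex)" where
  "partial_deriv i f = (\<lambda>x. frechet_derivative f (at x) (axis i 1))"

definition iter_partial :: "'n::finite list \<Rightarrow> (real^'n \<Rightarrow> complex) \<Rightarrow> (real^'n \<Rightarrow> complex)" where
  "iter_partial is f = foldr partial_deriv is f"

text \<open>Total differentiability of every iterated partial derivative, taken in any order of the
  variables, makes all of them continuous, so this is the class of \<open>C\<^sup>\<infinity>\<close> functions.\<close>

definition smooth_fun :: "(real^'n::finite \<Rightarrow> complex) \<Rightarrow> bool" where
  "smooth_fun f \<longleftrightarrow> (\<forall>is x. iter_partial is f differentiable (at x))"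

text \<open>Multi-indices are functions \<open>'n \<Rightarrow> nat\<close>. The index type carries no order, so
  \<open>\<partial>\<^sup>\<alpha>\<close> differentiates along some list in which each \<open>i\<close> occurs \<open>\<alpha> i\<close> times;
  for smooth functions the choice is irrelevant because partial derivatives commute.\<close>

definition multi_deriv :: "('n::finite \<Rightarrow> nat) \<Rightarrow> (real^'n \<Rightarrow> complex) \<Rightarrow> (real^'n \<Rightarrow> complex)" where
  "multi_deriv \<alpha> f = iter_partial (SOME is. \<forall>i. count_list is i = \<alpha> i) f"

definition multi_abs :: "('n::finite \<Rightarrow> nat) \<Rightarrow> nat" where
  "multi_abs \<alpha> = (\<Sum>i\<in>UNIV. \<alpha> i)"

definition multi_fact :: "('n::finite \<Rightarrow> nat) \<Rightarrow> real" where
  "multi_fact \<alpha> = (\<Prod>i\<in>UNIV. fact (\<alpha> i))"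

definition multi_power :: "real^'n::finite \<Rightarrow> ('n \<Rightarrow> nat) \<Rightarrow> real" where
  "multi_power x \<beta> = (\<Prod>i\<in>UNIV. (x $ i) ^ \<beta> i)"

definition GS_quotient ::
  "real \<Rightarrow> real \<Rightarrow> real \<Rightarrow> (real^'n::finite \<Rightarrow> complex) \<Rightarrow> ('n \<Rightarrow> nat) \<times> ('n \<Rightarrow> nat) \<times> (real^'n) \<Rightarrow> real" where
  "GS_quotient s t h f = (\<lambda>(\<alpha>, \<beta>, x).
     norm (of_real (multi_power x \<beta>) * multi_deriv \<alpha> f x) /
       (h ^ (multi_abs \<alpha> + multi_abs \<beta>) * multi_fact \<alpha> powr s * multi_fact \<beta> powr t))"

definition GS_norm :: "real \<Rightarrow> real \<Rightarrow> real \<Rightarrow> (real^'n::finite \<Rightarrow> complex) \<Rightarrow> real" where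
  "GS_norm s t h f = (SUP p. GS_quotient s t h f p)"

text \<open>In all the names below the first parameter \<open>s\<close> is the upper index (regularity) and the
  second one \<open>t\<close> the lower index (decay) of \<open>S\<^sub>t\<^sup>s\<close> and \<open>\<Sigma>\<^sub>t\<^sup>s\<close>.\<close>

definition GS_step :: "real \<Rightarrow> real \<Rightarrow> real \<Rightarrow> (real^'n::finite \<Rightarrow> complex) set" where
  "GS_step s t h = {f. smooth_fun f \<and> bdd_above (range (GS_quotient s t h f))}"

definition GS :: "real \<Rightarrow> real \<Rightarrow> (real^'n::finite \<Rightarrow> complex) set" where
  "GS s t = (\<Union>h\<in>{0<..}. GS_step s t h)"

definition GS_Sigma :: "real \<Rightarrow> real \<Rightarrow> (real^'n::finite \<Rightarrow> complex) set" where
  "GS_Sigma s t = (\<Inter>h\<in>{0<..}. GS_step s t h)"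

abbreviation S_half :: "(real^'n::finite \<Rightarrow> complex) set" where
  "S_half \<equiv> GS (1/2) (1/2)"

definition schwartz_seminorm ::
  "('n::finite \<Rightarrow> nat) \<Rightarrow> ('n \<Rightarrow> nat) \<Rightarrow> (real^'n \<Rightarrow> complex) \<Rightarrow> real" where
  "schwartz_seminorm \<alpha> \<beta> f = (SUP x. norm (of_real (multi_power x \<beta>) * multi_deriv \<alpha> f x))"

definition schwartz :: "(real^'n::finite \<Rightarrow> complex) set" where
  "schwartz = {f. smooth_fun f \<and>
     (\<forall>\<alpha> \<beta>. bdd_above (range (\<lambda>x. norm (of_real (multi_power x \<beta>) * multi_deriv \<alpha> f x))))}"

text \<open>The locally convex topology on \<open>X\<close> defined by a family \<open>P\<close> of seminorms.\<close>

definition seminorm_topology :: "('a \<Rightarrow> complex) set \<Rightarrow> (('a \<Rightarrow> complex) \<Rightarrow> real) set \<Rightarrow> ('a \<Rightarrow> complex) topology" where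
  "seminorm_topology X P =
     topology_generated_by {{g \<in> X. p (\<lambda>x. g x - f x) < e} | f p e. f \<in> X \<and> p \<in> P \<and> e > 0}"

definition seminorm_on :: "('a \<Rightarrow> complex) set \<Rightarrow> (('a \<Rightarrow> complex) \<Rightarrow> real) \<Rightarrow> bool" where
  "seminorm_on X p \<longleftrightarrow>
     (\<forall>f\<in>X. p f \<ge> 0) \<and>
     (\<forall>f\<in>X. \<forall>c. p (\<lambda>x. c * f x) = norm c * p f) \<and>
     (\<forall>f\<in>X. \<forall>g\<in>X. p (\<lambda>x. f x + g x) \<le> p f + p g)"

definition GS_step_topology :: "real \<Rightarrow> real \<Rightarrow> real \<Rightarrow> (real^'n::finite \<Rightarrow> complex) topology" where
  "GS_step_topology s t h = seminorm_topology (GS_step s t h) {GS_norm s t h}"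

text \<open>Inductive limit in the category of locally convex spaces: the finest locally convex
  topology making all inclusions of the steps continuous is the one given by all seminorms
  whose restriction to each step is continuous.\<close>

definition GS_topology :: "real \<Rightarrow> real \<Rightarrow> (real^'n::finite \<Rightarrow> complex) topology" where
  "GS_topology s t = seminorm_topology (GS s t)
     {p. seminorm_on (GS s t) p \<and> (\<forall>h>0. continuous_map (GS_step_topology s t h) euclideanreal p)}"

definition GS_Sigma_topology :: "real \<Rightarrow> real \<Rightarrow> (real^'n::finite \<Rightarrow> complex) topology" where
  "GS_Sigma_topology s t = seminorm_topology (GS_Sigma s t) (GS_norm s t ` {0<..})"

definition schwartz_topology :: "(real^'n::finite \<Rightarrow> complex) topology" where
  "schwartz_topology = seminorm_topology schwartz {schwartz_seminorm \<alpha> \<beta> | \<alpha> \<beta>. True}"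

text \<open>Functionals on a space \<open>X\<close> of functions are total functions in HOL; they are normalised
  to be \<open>0\<close> outside \<open>X\<close>, so that equality of functionals is equality on \<open>X\<close>.\<close>

definition dual_space :: "('a \<Rightarrow> complex) set \<Rightarrow> ('a \<Rightarrow> complex) topology \<Rightarrow> (('a \<Rightarrow> complex) \<Rightarrow> complex) set" where
  "dual_space X T = {u.
     (\<forall>f\<in>X. \<forall>g\<in>X. u (\<lambda>x. f x + g x) = u f + u g) \<and>
     (\<forall>f\<in>X. \<forall>c. u (\<lambda>x. c * f x) = c * u f) \<and>
     continuous_map T euclidean u \<and>
     (\<forall>f. f \<notin> X \<longrightarrow> u f = 0)}"

text \<open>Members of the spaces in the list are either functions or functionals on some test
  function space containing \<open>S_half\<close>.\<close>

datatype ('n::finite) gen_fun =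
    Function "real^'n \<Rightarrow> complex"
  | Functional "(real^'n \<Rightarrow> complex) \<Rightarrow> complex"

text \<open>The inclusion of these spaces in the dual of \<open>S_half\<close>.\<close>

fun as_functional :: "('n::finite) gen_fun \<Rightarrow> ((real^'n \<Rightarrow> complex) \<Rightarrow> complex)" where
  "as_functional (Function f) =
     (\<lambda>\<phi>. if \<phi> \<in> S_half then integral\<^sup>L lborel (\<lambda>x. f x * \<phi> x) else 0)"
| "as_functional (Functional u) = (\<lambda>\<phi>. if \<phi> \<in> S_half then u \<phi> else 0)"

datatype space_choice =
    S_half_half | S_half_t | S_s_half | Sigma_s_t | S_s_t
  | Schwartz | Tempered | S_s_t_dual | Sigma_s_t_dual

fun V_space :: "space_choice \<Rightarrow> real \<Rightarrow> real \<Rightarrow> ('n::finite) gen_fun set" where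
  "V_space S_half_half s t = Function ` S_half"
| "V_space S_half_t s t = Function ` GS (1/2) t"
| "V_space S_s_half s t = Function ` GS s (1/2)"
| "V_space Sigma_s_t s t = Function ` GS_Sigma s t"
| "V_space S_s_t s t = Function ` GS s t"
| "V_space Schwartz s t = Function ` schwartz"
| "V_space Tempered s t = Functional ` dual_space schwartz schwartz_topology"
| "V_space S_s_t_dual s t = Functional ` dual_space (GS s t) (GS_topology s t)"
| "V_space Sigma_s_t_dual s t = Functional ` dual_space (GS_Sigma s t) (GS_Sigma_topology s t)"

definition bilin :: "complex^'n::finite \<Rightarrow> complex^'n \<Rightarrow> complex" where
  "bilin z w = (\<Sum>j\<in>UNIV. z $ j * w $ j)"

definition bargmann_kernel :: "complex^'n::finite \<Rightarrow> real^'n \<Rightarrow> complex" where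
  "bargmann_kernel z y =
     of_real (pi powr (- real CARD('n) / 4)) *
     exp (- (1/2) * (bilin z z + of_real ((norm y)\<^sup>2)) +
          of_real (sqrt 2) * bilin z (\<chi> j. of_real (y $ j)))"

definition bargmann :: "('n::finite) gen_fun \<Rightarrow> complex^'n \<Rightarrow> complex" where
  "bargmann f z = as_functional f (bargmann_kernel z)"

definition pullback ::
  "(real^'n::finite \<Rightarrow> real^'n) \<Rightarrow> ((real^'n \<Rightarrow> complex) \<Rightarrow> complex) \<Rightarrow> ((real^'n \<Rightarrow> complex) \<Rightarrow> complex)" where
  "pullback U T = (\<lambda>\<phi>. T (\<phi> \<circ> inv U))"

definition radial_symmetric :: "('n::finite) gen_fun \<Rightarrow> bool" where
  "radial_symmetric f \<longleftrightarrow>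
     (\<forall>U. orthogonal_transformation U \<longrightarrow> pullback U (as_functional f) = as_functional f)"

end

theory Submission
  imports Defs "HOL-Probability.Probability" "HOL-Real_Asymp.Real_Asymp"
begin

text \<open>
  On a coordinate axis the Bargmann kernel in \<open>d\<close> variables is, up to a factor, the kernel
  in one variable times a Gaussian in the remaining variables. Hence integrating \<open>f\<close>, or pairing it,
  against \<open>exp (- \<bar>y'\<bar>\<^sup>2/2)\<close> in the other variables \<open>y'\<close> gives a possible \<open>f\<^sub>0\<close>.
  This operation, or its transpose \<open>\<phi> \<mapsto> \<phi> \<otimes> exp (- \<bar>y'\<bar>\<^sup>2/2)\<close>, respects each of the defining seminorms.

  Uniqueness says that a functional \<open>u\<close> on a space of test functions on the line which annihilates
  all \<open>exp (- x\<^sup>2/2 + c x)\<close> is zero. If \<open>u\<close> annihilates all members of a family depending on a real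
  parameter, then Riemann sums show that it annihilates the integral of the family. Integrating in
  the imaginary direction of \<open>c\<close> yields all narrower Gaussians, integrating these against a test
  function yields its mollifications, and the latter converge to the test function.
\<close>

section \<open>Iterated derivatives in one variable\<close>

text \<open>Uniqueness meets the obstacle that varying \<open>c\<close> in
  \<open>exp (- x\<^sup>2/2 + c x)\<close> only translates or modulates a Gaussian of fixed width,
  so no approximate identity is at hand. Imaginary \<open>c\<close>, averaged with a normal weight,
  multiply by a further Gaussian through the Fourier transform, and arbitrarily small widths appear.
  A functional is known only through linearity and null sequences, so each integral must be reached
  as a limit inside one fixed weight, with derivatives, powers of \<open>x\<close> and the parameter
  estimated together. Every estimate loses a factor \<open>A ^ (n + m)\<close>; this is harmless,
  because in the unions and intersections over \<open>h\<close> it is absorbed by a change of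
  \<open>h\<close>. The Gaussian itself has size \<open>sqrt (fact n) * sqrt (fact m)\<close>. Each
  \<open>h > 0\<close> accommodates this when \<open>s, t > 1/2\<close>, which is the range of the
  dual spaces. In the function spaces, which reach the index 1/2, the difference of two solutions is
  instead regarded as a tempered functional and tested on its own conjugate.\<close>

definition nderiv :: "nat \<Rightarrow> (real \<Rightarrow> complex) \<Rightarrow> real \<Rightarrow> complex" where
  "nderiv n = (\<lambda>g x. vector_derivative g (at x)) ^^ n"

definition smooth1 :: "(real \<Rightarrow> complex) \<Rightarrow> bool" where
  "smooth1 g \<longleftrightarrow> (\<forall>n x. nderiv n g differentiable (at x))"

lemma nderiv_0 [simp]: "nderiv 0 g = g"
  by (simp add: nderiv_def)

lemma nderiv_Suc: "nderiv (Suc n) g x = vector_derivative (nderiv n g) (at x)"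
  by (simp add: nderiv_def)

lemma smooth1D:
  assumes "smooth1 g"
  shows "(nderiv n g has_vector_derivative nderiv (Suc n) g x) (at x)"
  using assms unfolding smooth1_def nderiv_Suc vector_derivative_works by blast

text \<open>Higher derivatives are not computed by iteration: a guessed chain, each member being the
  derivative of the previous one, identifies all of them at once. Sums, translates, dilations and
  parameter integrals are all handled in this way.\<close>

lemma nderiv_eqI:
  assumes "\<And>n x. (G n has_vector_derivative G (Suc n) x) (at x)"
  shows "nderiv n (G 0) = G n"
proof (induction n)
  case (Suc n)
  show ?case
  proof
    show "nderiv (Suc n) (G 0) x = G (Suc n) x" for x
      unfolding nderiv_Suc Suc by (rule vector_derivative_at[OF assms])
  qed
qed simp

lemma smooth1I:
  assumes "\<And>n x. (G n has_vector_derivative G (Suc n) x) (at x)"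
  shows "smooth1 (G 0)"
  unfolding smooth1_def nderiv_eqI[of G, OF assms]
  using assms by (auto intro: differentiableI_vector)

lemma smooth1_nderiv: "smooth1 g \<Longrightarrow> smooth1 (nderiv k g)"
  using smooth1I[of "\<lambda>n. nderiv (n + k) g"] smooth1D by simp

lemma smooth1_continuous: "smooth1 g \<Longrightarrow> continuous_on UNIV (nderiv n g)"
  by (meson continuous_at_imp_continuous_on smooth1D has_vector_derivative_continuous)

lemma smooth1_measurable: "smooth1 g \<Longrightarrow> nderiv n g \<in> borel_measurable borel"
  by (simp add: borel_measurable_continuous_onI smooth1_continuous)

lemma smooth1_lin:
  assumes "smooth1 f" "smooth1 g"
  shows "smooth1 (\<lambda>x. a * f x + b * g x)"
    and "nderiv n (\<lambda>x. a * f x + b * g x) = (\<lambda>x. a * nderiv n f x + b * nderiv n g x)"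
proof -
  let ?G = "\<lambda>n x. a * nderiv n f x + b * nderiv n g x"
  have *: "(?G n has_vector_derivative ?G (Suc n) x) (at x)" for n x
    by (intro derivative_intros has_vector_derivative_mult_right smooth1D assms)
  show "smooth1 (\<lambda>x. a * f x + b * g x)" using smooth1I[of ?G, OF *] by simp
  show "nderiv n (\<lambda>x. a * f x + b * g x) = ?G n" using nderiv_eqI[of ?G, OF *] by simp
qed

lemma smooth1_affine:
  assumes "smooth1 g"
  shows "smooth1 (\<lambda>x. g (x - y))" and "nderiv n (\<lambda>x. g (x - y)) = (\<lambda>x. nderiv n g (x - y))"
proof -
  let ?G = "\<lambda>n x. nderiv n g (x - y)"
  have *: "(?G n has_vector_derivative ?G (Suc n) x) (at x)" for n x
  proof -
    have "((\<lambda>x. x - y) has_vector_derivative 1) (at x)"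
      by (auto intro!: derivative_eq_intros)
    from vector_diff_chain_at[OF this smooth1D[OF assms]] show ?thesis
      by (simp add: o_def)
  qed
  show "smooth1 (\<lambda>x. g (x - y))" using smooth1I[of ?G, OF *] by simp
  show "nderiv n (\<lambda>x. g (x - y)) = ?G n" using nderiv_eqI[of ?G, OF *] by simp
qed

section \<open>Mean value inequality and differentiation under the integral sign\<close>

lemma norm_diff_le_vderiv:
  fixes g :: "real \<Rightarrow> complex"
  assumes "\<And>x. (g has_vector_derivative g' x) (at x)"
    and "\<And>x. x \<in> closed_segment a b \<Longrightarrow> norm (g' x) \<le> B"
  shows "norm (g b - g a) \<le> B * \<bar>b - a\<bar>"
proof -
  have "norm (g b - g a) \<le> B * norm (b - a)"
  proof (rule differentiable_bound[of "closed_segment a b" g "\<lambda>x h. h *\<^sub>R g' x"])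
    show "onorm (\<lambda>h. h *\<^sub>R g' x) \<le> B" if "x \<in> closed_segment a b" for x
    proof (rule onorm_bound)
      show "0 \<le> B" using assms(2)[OF that] norm_ge_zero order_trans by blast
    qed (use assms(2)[OF that] in \<open>auto simp: mult.commute[of B] intro: mult_left_mono\<close>)
  qed (use assms(1) in \<open>auto simp: has_vector_derivative_def intro: has_derivative_at_withinI\<close>)
  then show ?thesis by simp
qed

text \<open>The library version of this bound is stated for Euclidean domains only.\<close>

lemma norm_integral_le:
  fixes f :: "'a \<Rightarrow> complex"
  assumes "integrable M f" "integrable M g" "\<And>x. norm (f x) \<le> g x"
  shows "norm (\<integral>x. f x \<partial>M) \<le> (\<integral>x. g x \<partial>M)"
  by (rule order_trans[OF integral_norm_bound integral_mono]) (use assms in auto)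

text \<open>Taylor's formula bounds the remainder by a multiple of \<open>w\<close>, via the second derivative in the
  parameter, so no limit theorem is needed.\<close>

lemma has_vector_derivative_weighted_integral:
  fixes H :: "nat \<Rightarrow> real \<Rightarrow> 'a \<Rightarrow> complex"
  assumes der: "\<And>n x y. ((\<lambda>x. H n x y) has_vector_derivative H (Suc n) x y) (at x)"
    and meas: "\<And>n x. H n x \<in> borel_measurable M"
    and bnd: "\<And>n x y. norm (H n x y) \<le> B n * w y"
    and w: "integrable M (w :: 'a \<Rightarrow> real)"
  shows "integrable M (H n x)"
    and "((\<lambda>x. \<integral>y. H n x y \<partial>M) has_vector_derivative (\<integral>y. H (Suc n) x y \<partial>M)) (at x)"
proof -
  have int: "integrable M (H n x)" for n x
    by (rule Bochner_Integration.integrable_bound[OF integrable_mult_right[OF w, of "B n"]])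
      (use meas bnd in \<open>auto intro!: AE_I2 order_trans[OF bnd]\<close>)
  show "integrable M (H n x)" by (rule int)
  have rem: "norm (H n z y - H n x y - (z - x) *\<^sub>R H (Suc n) x y)
      \<le> (z - x)\<^sup>2 * (B (Suc (Suc n)) * w y)" for z y
  proof -
    have 1: "norm (H (Suc n) a y - H (Suc n) x y) \<le> B (Suc (Suc n)) * w y * \<bar>a - x\<bar>" for a
      by (rule norm_diff_le_vderiv[OF der bnd])
    \<comment> \<open>The derivative of \<open>?g\<close> is a difference of values of
      \<open>H (Suc n)\<close>, already bounded by a multiple of the distance; a second mean value
      inequality makes the remainder quadratic.\<close>
    let ?g = "\<lambda>a. H n a y - (a - x) *\<^sub>R H (Suc n) x y"
    have "norm (?g z - ?g x) \<le> B (Suc (Suc n)) * w y * \<bar>z - x\<bar> * \<bar>z - x\<bar>"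
    proof (rule norm_diff_le_vderiv)
      show "(?g has_vector_derivative (H (Suc n) a y - H (Suc n) x y)) (at a)" for a
        by (auto intro!: derivative_eq_intros der)
      have nn: "0 \<le> B (Suc (Suc n)) * w y" using bnd norm_ge_zero order_trans by blast
      show "norm (H (Suc n) a y - H (Suc n) x y) \<le> B (Suc (Suc n)) * w y * \<bar>z - x\<bar>"
        if "a \<in> closed_segment x z" for a
        by (rule order_trans[OF 1] mult_left_mono)+
          (use that nn in \<open>auto simp: closed_segment_eq_real_ivl split: if_splits\<close>)
    qed
    moreover have "?g z - ?g x = H n z y - H n x y - (z - x) *\<^sub>R H (Suc n) x y" by simp
    moreover have "B (Suc (Suc n)) * w y * \<bar>z - x\<bar> * \<bar>z - x\<bar> = (z - x)\<^sup>2 * (B (Suc (Suc n)) * w y)"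
      by (simp add: power2_eq_square ac_simps)
    ultimately show ?thesis by metis
  qed
  let ?F = "\<lambda>n x. \<integral>y. H n x y \<partial>M" and ?C = "B (Suc (Suc n)) * integral\<^sup>L M w"
  have "norm (?F n z - ?F n x - (z - x) *\<^sub>R ?F (Suc n) x) \<le> (z - x)\<^sup>2 * ?C" for z
  proof -
    have "?F n z - ?F n x - (z - x) *\<^sub>R ?F (Suc n) x
        = (\<integral>y. H n z y - H n x y - (z - x) *\<^sub>R H (Suc n) x y \<partial>M)"
      using int by simp
    also have "norm \<dots> \<le> (\<integral>y. (z - x)\<^sup>2 * (B (Suc (Suc n)) * w y) \<partial>M)"
      using int w rem by (intro norm_integral_le) auto
    finally show ?thesis by simp
  qed
  then have "norm (?F n z - ?F n x - (z - x) *\<^sub>R ?F (Suc n) x) \<le> \<bar>?C\<bar> * \<bar>z - x\<bar> * norm (z - x)" for z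
    by (rule order_trans) (simp add: power2_eq_square mult.commute mult_right_mono mult_left_mono
        abs_mult[symmetric] mult.left_commute)
  note 2 = this
  show "(?F n has_vector_derivative ?F (Suc n) x) (at x)"
    unfolding has_vector_derivative_def has_derivative_at_alt
  proof (intro conjI allI impI)
    fix e :: real assume e: "e > 0"
    \<comment> \<open>The \<open>+ 1\<close> keeps the quotient meaningful when
      \<open>?C = 0\<close>.\<close>
    let ?d = "e / (\<bar>?C\<bar> + 1)"
    show "\<exists>d>0. \<forall>z. norm (z - x) < d \<longrightarrow> norm (?F n z - ?F n x - (z - x) *\<^sub>R ?F (Suc n) x)
        \<le> e * norm (z - x)"
    proof (intro exI[of _ ?d] conjI allI impI)
      show "0 < ?d" using e by simp
      fix z assume "norm (z - x) < ?d"
      then have "\<bar>z - x\<bar> * (\<bar>?C\<bar> + 1) < e"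
        by (simp add: pos_less_divide_eq add_nonneg_pos)
      then have "\<bar>?C\<bar> * \<bar>z - x\<bar> \<le> e" by (simp add: algebra_simps)
      then show "norm (?F n z - ?F n x - (z - x) *\<^sub>R ?F (Suc n) x) \<le> e * norm (z - x)"
        by (intro order_trans[OF 2] mult_right_mono) auto
    qed
  qed (rule bounded_linear_scaleR_left)
qed

section \<open>Gaussians\<close>

text \<open>With all seminorm bounds collected in one function \<open>N\<close>, the conditions
  defining the various test function spaces become growth conditions on \<open>N\<close>
  alone.\<close>

definition bnd :: "(real \<Rightarrow> complex) \<Rightarrow> (nat \<Rightarrow> nat \<Rightarrow> real) \<Rightarrow> bool" where
  "bnd g N \<longleftrightarrow> smooth1 g \<and> (\<forall>n m x. \<bar>x\<bar> ^ m * norm (nderiv n g x) \<le> N n m)"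

lemma bndD: "bnd g N \<Longrightarrow> \<bar>x\<bar> ^ m * norm (nderiv n g x) \<le> N n m"
  by (simp add: bnd_def)

lemma bnd_smooth: "bnd g N \<Longrightarrow> smooth1 g"
  by (simp add: bnd_def)

lemma bnd_nonneg: "bnd g N \<Longrightarrow> 0 \<le> N n m"
  by (rule order_trans[OF _ bndD[of g N 0 m n]]) simp_all

lemma bnd_mono: "bnd g N \<Longrightarrow> (\<And>n m. N n m \<le> N' n m) \<Longrightarrow> bnd g N'"
  unfolding bnd_def by (meson order_trans)

lemma bndI:
  assumes "\<And>n x. (G n has_vector_derivative G (Suc n) x) (at x)"
    and "\<And>n m x. \<bar>x\<bar> ^ m * norm (G n x) \<le> N n m"
  shows "bnd (G 0) N"
  unfolding bnd_def nderiv_eqI[of G, OF assms(1)] using smooth1I[of G, OF assms(1)] assms(2) by blast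

lemma bnd_lin:
  assumes "bnd f N" "bnd g N'"
  shows "bnd (\<lambda>x. a * f x + b * g x) (\<lambda>n m. norm a * N n m + norm b * N' n m)"
  unfolding bnd_def
proof (intro conjI allI)
  show "smooth1 (\<lambda>x. a * f x + b * g x)" by (intro smooth1_lin bnd_smooth[OF assms(1)]
      bnd_smooth[OF assms(2)])
  fix n m x
  have "\<bar>x\<bar> ^ m * norm (a * nderiv n f x + b * nderiv n g x)
      \<le> \<bar>x\<bar> ^ m * (norm a * norm (nderiv n f x) + norm b * norm (nderiv n g x))"
    by (intro mult_left_mono norm_triangle_le) (auto simp: norm_mult)
  also have "\<dots> = norm a * (\<bar>x\<bar> ^ m * norm (nderiv n f x)) + norm b * (\<bar>x\<bar> ^ m * norm (nderiv n g x))"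
    by (simp add: algebra_simps)
  also have "\<dots> \<le> norm a * N n m + norm b * N' n m"
    by (intro add_mono mult_left_mono bndD assms) auto
  finally show "\<bar>x\<bar> ^ m * norm (nderiv n (\<lambda>x. a * f x + b * g x) x) \<le> norm a * N n m + norm b * N' n m"
    by (simp add: smooth1_lin(2)[OF bnd_smooth[OF assms(1)] bnd_smooth[OF assms(2)]])
qed

lemma bnd_nderiv: "bnd g N \<Longrightarrow> bnd (nderiv 1 g) (\<lambda>n m. N (Suc n) m)"
  using bndI[of "\<lambda>n. nderiv (n + 1) g" "\<lambda>n m. N (Suc n) m"] bndD[of g N _ _ "Suc _"]
  by (auto simp: smooth1D bnd_smooth)

text \<open>\<open>gexp c n\<close> is the \<open>n\<close>-th derivative of \<open>exp (- x\<^sup>2/2 + c x)\<close>, given by the three-term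
  recurrence of the Hermite polynomials.\<close>

fun gexp :: "complex \<Rightarrow> nat \<Rightarrow> real \<Rightarrow> complex" where
  "gexp c 0 x = exp (- (of_real x)\<^sup>2 / 2 + c * of_real x)"
| "gexp c (Suc 0) x = (c - of_real x) * gexp c 0 x"
| "gexp c (Suc (Suc n)) x = (c - of_real x) * gexp c (Suc n) x - of_nat (Suc n) * gexp c n x"

text \<open>Differentiating the factor \<open>c - x\<close> in the recurrence contributes one more
  \<open>- gexp c (Suc k)\<close>, which raises the coefficient \<open>Suc k\<close> to the
  \<open>Suc (Suc k)\<close> that the next recurrence step demands.\<close>

lemma gexp_deriv: "(gexp c n has_vector_derivative gexp c (Suc n) x) (at x)"
proof (induction n rule: less_induct)
  case (less n)
  have id: "((\<lambda>x. complex_of_real x) has_vector_derivative 1) (at x)"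
    using has_vector_derivative_of_real[OF DERIV_ident[of "at x"]] by simp
  have lin: "((\<lambda>x. c - complex_of_real x) has_vector_derivative (-1)) (at x)"
    using has_vector_derivative_diff[OF has_vector_derivative_const id, of c] by simp
  have z: "(gexp c 0 has_vector_derivative gexp c (Suc 0) x) (at x)"
  proof -
    have 1: "((\<lambda>z. exp (- z\<^sup>2 / 2 + c * z)) has_field_derivative
        (c - of_real x) * exp (- (of_real x)\<^sup>2 / 2 + c * of_real x)) (at (of_real x))"
      by (auto intro!: derivative_eq_intros simp: field_simps)
    have "gexp c 0 = (\<lambda>z. exp (- z\<^sup>2 / 2 + c * z)) \<circ> complex_of_real" by (simp add: fun_eq_iff)
    then show ?thesis using field_vector_diff_chain_at[OF id 1] by simp
  qed
  consider "n = 0" | "n = Suc 0" | k where "n = Suc (Suc k)"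
    by (metis not0_implies_Suc)
  then show ?case
  proof cases
    case 1 show ?thesis using z by (simp only: 1)
  next
    case 2
    have "((\<lambda>x. (c - of_real x) * gexp c 0 x) has_vector_derivative
        ((c - of_real x) * gexp c (Suc 0) x + (- 1) * gexp c 0 x)) (at x)"
      by (rule has_vector_derivative_mult[OF lin z])
    then show ?thesis using 2 by (simp add: fun_eq_iff)
  next
    case 3
    have "((\<lambda>x. (c - of_real x) * gexp c (Suc k) x - of_nat (Suc k) * gexp c k x) has_vector_derivative
        ((c - of_real x) * gexp c (Suc (Suc k)) x
            + (- 1) * gexp c (Suc k) x - of_nat (Suc k) * gexp c (Suc k) x)) (at x)"
      using less.IH[of "Suc k"] less.IH[of k] 3
      by (intro has_vector_derivative_diff has_vector_derivative_mult
          has_vector_derivative_mult_right lin) auto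
    moreover have "(c - of_real x) * gexp c (Suc (Suc k)) x
        + (- 1) * gexp c (Suc k) x - of_nat (Suc k) * gexp c (Suc k) x
      = gexp c (Suc n) x" using 3 by (simp add: algebra_simps)
    moreover have "(\<lambda>x. (c - of_real x) * gexp c (Suc k) x - of_nat (Suc k) * gexp c k x) = gexp c n"
      using 3 by (simp add: fun_eq_iff)
    ultimately show ?thesis by simp
  qed
qed

text \<open>Differentiation in \<open>c\<close> multiplies the exponential by \<open>x\<close>, and
  Leibniz' rule for the \<open>n\<close>-th derivative of \<open>x\<close> times a function leaves
  two terms. For \<open>n = 0\<close> the truncated index \<open>n - 1\<close> is harmless because
  its coefficient is 0.\<close>

lemma gexp_param_deriv:
  "((\<lambda>c. gexp c n x) has_field_derivative (of_real x * gexp c n x + of_nat n * gexp c (n - 1) x)) (at c)"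
proof (induction n rule: less_induct)
  case (less n)
  have z: "((\<lambda>c. gexp c 0 x) has_field_derivative of_real x * gexp c 0 x) (at c)"
    by (auto intro!: derivative_eq_intros)
  consider "n = 0" | "n = Suc 0" | k where "n = Suc (Suc k)"
    by (metis not0_implies_Suc)
  then show ?case
  proof cases
    case 1 then show ?thesis using z by simp
  next
    case 2
    have "((\<lambda>c. (c - of_real x) * gexp c 0 x) has_field_derivative
        (1 * gexp c 0 x + of_real x * gexp c 0 x * (c - of_real x))) (at c)"
      by (rule DERIV_mult[OF _ z]) (auto intro!: derivative_eq_intros)
    then show ?thesis using 2 by (simp add: algebra_simps)
  next
    case 3
    have "((\<lambda>c. (c - of_real x) * gexp c (Suc k) x - of_nat (Suc k) * gexp c k x) has_field_derivative
        (1 * gexp c (Suc k) x + (of_real x * gexp c (Suc k) x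
            + of_nat (Suc k) * gexp c (Suc k - 1) x) * (c - of_real x)
         - of_nat (Suc k) * (of_real x * gexp c k x + of_nat k * gexp c (k - 1) x))) (at c)"
      using less.IH[of "Suc k"] less.IH[of k] 3
      by (intro DERIV_diff DERIV_cmult DERIV_mult) (auto intro!: derivative_eq_intros)
    moreover have "1 * gexp c (Suc k) x + (of_real x * gexp c (Suc k) x
        + of_nat (Suc k) * gexp c (Suc k - 1) x) * (c - of_real x)
         - of_nat (Suc k) * (of_real x * gexp c k x + of_nat k * gexp c (k - 1) x)
      = of_real x * gexp c n x + of_nat n * gexp c (n - 1) x"
      by (cases k) (simp_all add: 3 algebra_simps)
    ultimately show ?thesis using 3 by simp
  qed
qed

text \<open>The summand \<open>sqrt n\<close> is what makes the recurrence close: for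
  \<open>r = M + sqrt n\<close> one has \<open>M * r + n \<le> r\<^sup>2\<close>, so one step of the
  recurrence costs at most a factor \<open>r\<close>.\<close>

lemma norm_gexp_le: "norm (gexp c n x) \<le> (\<bar>x\<bar> + norm c + sqrt n) ^ n * norm (gexp c 0 x)"
proof (induction n rule: less_induct)
  case (less n)
  let ?M = "\<bar>x\<bar> + norm c"
  have M: "norm (c - of_real x) \<le> ?M"
    by (rule norm_triangle_le_diff) simp
  consider "n = 0" | "n = Suc 0" | k where "n = Suc (Suc k)"
    by (metis not0_implies_Suc)
  then show ?case
  proof cases
    case 1 then show ?thesis by simp
  next
    case 2 then show ?thesis using M by (simp add: norm_mult mult_right_mono)
  next
    case 3
    let ?r = "?M + sqrt n" and ?E = "norm (gexp c 0 x)"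
    have r: "0 \<le> ?r" by simp
    have a: "norm (gexp c (Suc k) x) \<le> ?r ^ Suc k * ?E"
      by (rule order_trans[OF less.IH]) (use 3 in \<open>auto intro!: mult_right_mono power_mono simp
          del: power_Suc\<close>)
    have b: "norm (gexp c k x) \<le> ?r ^ k * ?E"
      by (rule order_trans[OF less.IH]) (use 3 in \<open>auto intro!: mult_right_mono power_mono\<close>)
    have "norm (gexp c n x) \<le> norm (c - of_real x) * norm (gexp c (Suc k) x)
        + real (Suc k) * norm (gexp c k x)"
      unfolding 3 gexp.simps(3) by (rule order_trans[OF norm_triangle_ineq4]) (simp only: norm_mult
          norm_of_nat order_refl)
    also have "\<dots> \<le> ?M * (?r ^ Suc k * ?E) + real n * (?r ^ k * ?E)"
      by (intro add_mono mult_mono a b M) (use 3 in auto)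
    also have "\<dots> = (?M * ?r + real n) * (?r ^ k * ?E)" by (simp add: algebra_simps)
    also have "\<dots> \<le> ?r\<^sup>2 * (?r ^ k * ?E)"
    proof (rule mult_right_mono)
      have "?r\<^sup>2 = ?M * ?r + sqrt n * ?M + real n" by (simp add: power2_eq_square algebra_simps)
      then show "?M * ?r + real n \<le> ?r\<^sup>2" by simp
    qed (use r in simp)
    also have "\<dots> = ?r ^ n * ?E" by (simp add: 3 power2_eq_square)
    finally show ?thesis .
  qed
qed

section \<open>Trading powers for factorials, and the size of the Gaussians\<close>

lemma power_div_fact_le_exp:
  assumes "0 \<le> (x::real)"
  shows "x ^ n / fact n \<le> exp x"
proof -
  have "(\<lambda>n. x ^ n / fact n) sums exp x"
    using exp_converges[of x] by (simp add: divide_inverse mult.commute scaleR_conv_of_real)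
  from sum_le_suminf[OF sums_summable[OF this], of "{n}"] sums_unique[OF this] assms show ?thesis by simp
qed

text \<open>Square root of the bound of one term of the exponential series at
  \<open>k\<^sup>2 * a\<^sup>2\<close>. The parameter \<open>k\<close> trades the geometric factor
  against the growth of the exponential in \<open>a\<close>.\<close>

lemma power_le_sqrt_fact:
  assumes "a \<ge> 0" "k > 0"
  shows "a ^ n \<le> sqrt (fact n) * (1 / k) ^ n * exp (k\<^sup>2 * a\<^sup>2 / 2)"
proof -
  have "(k\<^sup>2 * a\<^sup>2) ^ n / fact n \<le> exp (k\<^sup>2 * a\<^sup>2)" by (rule power_div_fact_le_exp) simp
  then have "(k\<^sup>2 * a\<^sup>2) ^ n \<le> fact n * exp (k\<^sup>2 * a\<^sup>2)" by (simp add: field_simps)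
  then have "sqrt ((k\<^sup>2 * a\<^sup>2) ^ n) \<le> sqrt (fact n * exp (k\<^sup>2 * a\<^sup>2))" by simp
  moreover have "sqrt ((k\<^sup>2 * a\<^sup>2) ^ n) = (k * a) ^ n"
    using assms by (simp add: real_sqrt_power real_sqrt_mult)
  moreover have "sqrt (exp (k\<^sup>2 * a\<^sup>2)) = exp (k\<^sup>2 * a\<^sup>2 / 2)"
    by (rule real_sqrt_unique) (simp_all add: power2_eq_square exp_add[symmetric])
  ultimately have "(k * a) ^ n \<le> sqrt (fact n) * exp (k\<^sup>2 * a\<^sup>2 / 2)"
    by (simp add: real_sqrt_mult)
  then have "(1 / k) ^ n * (k * a) ^ n \<le> (1 / k) ^ n * (sqrt (fact n) * exp (k\<^sup>2 * a\<^sup>2 / 2))"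
    by (rule mult_left_mono) (use assms in simp)
  then show ?thesis using assms by (simp add: power_mult_distrib[symmetric] ac_simps)
qed

lemma norm_gexp_0: "norm (gexp c 0 x) = exp (- x\<^sup>2 / 2 + Re c * x)"
  by (simp add: norm_exp_eq_Re del: of_real_power flip: of_real_power)

text \<open>The free parameter \<open>k\<close> is the point of this estimate: \<open>norm c\<close>
  enters only through \<open>exp (k\<^sup>2 * (norm c)\<^sup>2 / 2)\<close>, so that a Gaussian
  density in the imaginary part of \<open>c\<close> can beat this growth once \<open>k\<close> is
  small. The condition \<open>k \<le> 1/2\<close> lets \<open>1 / k\<close> also dominate the
  factors 2 coming from the powers of \<open>x\<close> and from \<open>sqrt n ^ n\<close>.\<close>

lemma norm_gexp_bound:
  assumes k: "0 < k" "k \<le> 1/2"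
  shows "\<bar>x\<bar> ^ m * norm (gexp c n x)
      \<le> (3 / k) ^ (n + m) * (sqrt (fact n) * sqrt (fact m)) * (3 * exp (k\<^sup>2 * (norm c)\<^sup>2 / 2
          + (Re c)\<^sup>2))"
proof -
  let ?e = "exp (k\<^sup>2 * (norm c)\<^sup>2 / 2 + (Re c)\<^sup>2)"
  have two: "2 \<le> 1 / k" using k by (simp add: field_simps)
  have p: "(a + b + d) ^ n \<le> 3 ^ n * (a ^ n + b ^ n + d ^ n)"
      if "0 \<le> a" "0 \<le> b" "0 \<le> d" for a b d :: real
  proof -
    let ?M = "Max {a, b, d}"
    have "a + b + d \<le> 3 * ?M" by simp
    then have "(a + b + d) ^ n \<le> (3 * ?M) ^ n" using that by (intro power_mono) auto
    also have "\<dots> = 3 ^ n * ?M ^ n" by (simp add: power_mult_distrib)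
    also have "?M ^ n \<le> a ^ n + b ^ n + d ^ n"
    proof -
      have "?M \<in> {a, b, d}" by (rule Max_in) auto
      then show ?thesis using that by auto
    qed
    finally show ?thesis by simp
  qed
  \<comment> \<open>One term of the exponential series at \<open>n\<close> gives
    \<open>sqrt (fact n) * exp (n / 2)\<close>, and
    \<open>exp (1/2) \<le> 2 \<le> 1 / k\<close>.\<close>
  have s: "sqrt (real n) ^ n \<le> sqrt (fact n) * (1 / k) ^ n"
  proof -
    have "sqrt (real n) ^ n \<le> sqrt (fact n) * exp (real n / 2)"
      using power_le_sqrt_fact[of "sqrt n" 1 n] by simp
    also have "exp (real n / 2) = exp (1 / 2) ^ n"
      by (simp add: exp_of_nat_mult[symmetric])
    also have "exp (1 / 2 :: real) ^ n \<le> 2 ^ n"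
    proof (rule power_mono)
      have "exp (1 / 2 :: real) \<le> 1 + 1/2 + (1/2)\<^sup>2" by (rule exp_bound) auto
      then show "exp (1 / 2 :: real) \<le> 2" by (simp add: power2_eq_square)
    qed simp
    also have "\<dots> \<le> (1 / k) ^ n" by (rule power_mono[OF two]) simp
    finally show ?thesis by simp
  qed
  have xm: "\<bar>x\<bar> ^ j \<le> sqrt (fact j) * (1 / k) ^ j * exp (x\<^sup>2 / 8)" for j
  proof -
    have "\<bar>x\<bar> ^ j \<le> sqrt (fact j) * 2 ^ j * exp (x\<^sup>2 / 8)"
      using power_le_sqrt_fact[of "\<bar>x\<bar>" "1/2" j] by (simp add: power2_eq_square)
    also have "\<dots> \<le> sqrt (fact j) * (1 / k) ^ j * exp (x\<^sup>2 / 8)"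
      using two k by (intro mult_mono power_mono) auto
    finally show ?thesis .
  qed
  have cn: "norm c ^ n \<le> sqrt (fact n) * (1 / k) ^ n * exp (k\<^sup>2 * (norm c)\<^sup>2 / 2)"
    by (rule power_le_sqrt_fact) (use k in auto)
  let ?S = "sqrt (fact n) * (1 / k) ^ n"
  let ?f = "exp (k\<^sup>2 * (norm c)\<^sup>2 / 2)"
  have "(\<bar>x\<bar> + norm c + sqrt n) ^ n \<le> 3 ^ n * (\<bar>x\<bar> ^ n + norm c ^ n + sqrt n ^ n)"
    by (rule p) auto
  also have "\<dots> \<le> 3 ^ n * (?S * exp (x\<^sup>2 / 8) + ?S * ?f + ?S)"
    by (intro mult_left_mono add_mono xm cn s) auto
  also have "\<dots> = 3 ^ n * ?S * (exp (x\<^sup>2 / 8) + ?f + 1)" by (simp add: algebra_simps)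
  also have "\<dots> \<le> 3 ^ n * ?S * (3 * (exp (x\<^sup>2 / 8) * ?f))"
  proof (rule mult_left_mono)
    have a: "exp (x\<^sup>2 / 8) * 1 \<le> exp (x\<^sup>2 / 8) * ?f" "1 * ?f \<le> exp (x\<^sup>2 / 8) * ?f" "1 * 1
        \<le> exp (x\<^sup>2 / 8) * ?f"
      by (intro mult_mono; simp)+
    then show "exp (x\<^sup>2 / 8) + ?f + 1 \<le> 3 * (exp (x\<^sup>2 / 8) * ?f)" by linarith
  qed (use k in auto)
  finally have q: "(\<bar>x\<bar> + norm c + sqrt n) ^ n \<le> 3 ^ n * ?S * (3 * (exp (x\<^sup>2 / 8) * ?f))" .
  have "\<bar>x\<bar> ^ m * norm (gexp c n x) \<le> \<bar>x\<bar> ^ m * ((\<bar>x\<bar> + norm c + sqrt n) ^ n * norm (gexp c 0 x))"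
    by (rule mult_left_mono[OF norm_gexp_le]) simp
  also have "\<dots> \<le> (sqrt (fact m) * (1 / k) ^ m * exp (x\<^sup>2 / 8)) *
      (3 ^ n * ?S * (3 * (exp (x\<^sup>2 / 8) * ?f)) * exp (- x\<^sup>2 / 2 + Re c * x))"
    unfolding norm_gexp_0 by (intro mult_mono xm q order_refl) (use k in auto)
  also have "\<dots> = (sqrt (fact m) * (1 / k) ^ m * 3 ^ n * ?S * 3) *
      (?f * (exp (x\<^sup>2 / 8) * exp (x\<^sup>2 / 8) * exp (- x\<^sup>2 / 2 + Re c * x)))"
    by (simp add: ac_simps)
  \<comment> \<open>The powers of \<open>x\<close> from \<open>x ^ m\<close> and from the derivative
    each consumed one factor \<open>exp (x\<^sup>2 / 8)\<close>; half of the Gaussian decay is left,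
    and completing the square against \<open>Re c * x\<close> costs
    \<open>exp ((Re c)\<^sup>2)\<close>.\<close>
  also have "exp (x\<^sup>2 / 8) * exp (x\<^sup>2 / 8) * exp (- x\<^sup>2 / 2 + Re c * x) = exp (- x\<^sup>2 / 4 + Re c * x)"
    unfolding exp_add[symmetric] by (rule arg_cong[of _ _ exp]) (simp add: field_simps)
  also have "?f * \<dots> \<le> ?f * exp ((Re c)\<^sup>2)"
  proof -
    have "0 \<le> (x / 2 - Re c)\<^sup>2" by simp
    then have "- x\<^sup>2 / 4 + Re c * x \<le> (Re c)\<^sup>2" by (simp add: power2_eq_square algebra_simps)
    then show ?thesis by simp
  qed
  also have "?f * exp ((Re c)\<^sup>2) = ?e" by (simp add: exp_add)
  finally have "\<bar>x\<bar> ^ m * norm (gexp c n x) \<le> (sqrt (fact m) * (1 / k) ^ m * 3 ^ n * ?S * 3) * ?e"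
    using k by (simp add: mult_left_mono)
  also have "\<dots> \<le> (sqrt (fact m) * (1 / k) ^ m * 3 ^ n * ?S * 3) * ?e * 3 ^ m"
    using mult_left_mono[of 1 "3 ^ m" "(sqrt (fact m) * (1 / k) ^ m * 3 ^ n * ?S * 3) * ?e"] k by simp
  also have "\<dots> = (3 / k) ^ (n + m) * (sqrt (fact n) * sqrt (fact m)) * (3 * ?e)"
    by (simp add: power_add power_divide ac_simps)
  finally show ?thesis .
qed

section \<open>Functionals annihilating the Gaussians\<close>

lemma integrable_inverse_square: "integrable lborel (\<lambda>y::real. inverse (1 + y\<^sup>2))"
  using integrable_inverse_1_plus_square by (simp add: set_integrable_def)

text \<open>The difference is a sum of nonnegative terms, as displayed in \<open>eq\<close>. In a
  Riemann sum this moves the decay from the sampling point to the integration variable at the cost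
  of a factor 3.\<close>

lemma one_plus_square_near: "\<bar>y - z\<bar> \<le> 1 \<Longrightarrow> inverse (1 + z\<^sup>2) \<le> 3 * inverse (1 + (y::real)\<^sup>2)"
proof -
  assume "\<bar>y - z\<bar> \<le> 1"
  then have "(y - z)\<^sup>2 \<le> 1" by (simp add: abs_square_le_1)
  moreover have eq: "3 * (1 + z\<^sup>2) - (1 + y\<^sup>2) = (2 * z - y)\<^sup>2 + z\<^sup>2 + 2 * (1 - (y - z)\<^sup>2)"
    by (simp add: power2_eq_square algebra_simps)
  ultimately have "0 \<le> 3 * (1 + z\<^sup>2) - (1 + y\<^sup>2)" unfolding eq by (intro add_nonneg_nonneg) auto
  then have "1 + y\<^sup>2 \<le> 3 * (1 + z\<^sup>2)" by simp
  moreover have "0 < 1 + y\<^sup>2" "0 < 1 + z\<^sup>2" by (simp_all add: add_pos_nonneg)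
  ultimately show ?thesis by (simp add: field_simps)
qed

text \<open>The growth of the Gaussian's derivatives with the geometric factor removed: the
  Gelfand-Shilov weight with \<open>s = t = 1/2\<close> and \<open>h = 1\<close>.\<close>

definition gauss_weight :: "nat \<Rightarrow> nat \<Rightarrow> real" where
  "gauss_weight n m = sqrt (fact n) * sqrt (fact m)"

text \<open>A test function space is described by the set of weights \<open>N\<close> that are admissible as
  bounds for \<open>x\<^sup>m \<partial>\<^sup>n g\<close>; convergence to \<open>0\<close> means being bounded by a null sequence of multiples
  of one fixed admissible weight.\<close>

locale weight_class =
  fixes adm :: "(nat \<Rightarrow> nat \<Rightarrow> real) \<Rightarrow> bool"
  assumes adm_add: "adm N \<Longrightarrow> adm M \<Longrightarrow> adm (\<lambda>n m. N n m + M n m)"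
    and adm_scale: "adm N \<Longrightarrow> 0 \<le> a \<Longrightarrow> adm (\<lambda>n m. a * N n m)"
    and adm_Suc_left: "adm N \<Longrightarrow> adm (\<lambda>n m. N (Suc n) m)"
    and adm_Suc_right: "adm N \<Longrightarrow> adm (\<lambda>n m. N n (Suc m))"
    and adm_geom: "adm N \<Longrightarrow> 1 \<le> A \<Longrightarrow> adm (\<lambda>n m. A ^ (n + m) * N n m)"
    and adm_mix: "adm N \<Longrightarrow> adm M \<Longrightarrow> (\<And>n m. 0 \<le> N n m) \<Longrightarrow> (\<And>n m. 0 \<le> M n m) \<Longrightarrow> adm (\<lambda>n m. N n 0 * M 0 m)"
    and adm_gauss: "adm gauss_weight"
begin

definition testfun :: "(real \<Rightarrow> complex) \<Rightarrow> bool" where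
  "testfun g \<longleftrightarrow> (\<exists>N. adm N \<and> bnd g N)"

lemma testfunI: "adm N \<Longrightarrow> bnd g N \<Longrightarrow> testfun g"
  by (auto simp: testfun_def)

lemma testfun_lin: "testfun f \<Longrightarrow> testfun g \<Longrightarrow> testfun (\<lambda>x. a * f x + b * g x)"
  unfolding testfun_def using bnd_lin adm_add adm_scale norm_ge_zero by meson

lemma bnd_gexp:
  obtains N where "adm N" "bnd (gexp c 0) N"
proof
  let ?N = "\<lambda>n m. (3 * exp ((1/2)\<^sup>2 * (norm c)\<^sup>2 / 2 + (Re c)\<^sup>2)) * (6 ^ (n + m) * gauss_weight n m)"
  show "adm ?N" by (intro adm_scale adm_geom adm_gauss) auto
  show "bnd (gexp c 0) ?N"
  proof (rule bndI[of "gexp c", OF gexp_deriv])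
    show "\<bar>x\<bar> ^ m * norm (gexp c n x) \<le> ?N n m" for n m x
      using norm_gexp_bound[of "1/2" x m c n] by (simp add: gauss_weight_def ac_simps)
  qed
qed

lemma testfun_gexp: "testfun (gexp c 0)"
  by (meson bnd_gexp testfunI)

text \<open>The weight that bounds the superposition of translates of a function bounded by \<open>M\<close> with
  coefficients bounded by \<open>N\<close>.\<close>

definition conv_weight :: "(nat \<Rightarrow> nat \<Rightarrow> real) \<Rightarrow> (nat \<Rightarrow> nat \<Rightarrow> real) \<Rightarrow> nat \<Rightarrow> nat \<Rightarrow> real" where
  "conv_weight N M n m = (let P = (\<lambda>n m. N n m + 2 * N n (m + 2) + N n (m + 4)) in
     2 ^ (n + m) * (M n 0 * P 0 m + P 0 0 * M n m))"

lemma adm_conv_weight: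
  assumes "adm N" "adm M" "\<And>n m. 0 \<le> N n m" "\<And>n m. 0 \<le> M n m"
  shows "adm (conv_weight N M)"
proof -
  let ?P = "\<lambda>n m. N n m + 2 * N n (Suc (Suc m)) + N n (Suc (Suc (Suc (Suc m))))"
  have 2: "adm (\<lambda>n m. N n (Suc (Suc m)))" by (intro adm_Suc_right assms)
  have 4: "adm (\<lambda>n m. N n (Suc (Suc (Suc (Suc m)))))"
    using 2[THEN adm_Suc_right, THEN adm_Suc_right] by simp
  have P: "adm ?P"
    by (intro adm_add adm_scale assms 2 4) simp
  have nn: "0 \<le> ?P n m" for n m using assms(3) by simp
  have "adm (\<lambda>n m. 2 ^ (n + m) * (M n 0 * ?P 0 m + ?P 0 0 * M n m))"
    using adm_geom[OF adm_add[OF adm_mix[OF assms(2) P assms(4) nn] adm_scale[OF assms(2) nn[of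
        0 0]]], of 2]
    by simp
  then show ?thesis by (simp add: conv_weight_def[abs_def] numeral_eq_Suc)
qed

end

lemma power_add_le: "0 \<le> a \<Longrightarrow> 0 \<le> b \<Longrightarrow> (a + b :: real) ^ m \<le> 2 ^ m * (a ^ m + b ^ m)"
proof -
  assume ab: "0 \<le> a" "0 \<le> b"
  have "(a + b) ^ m \<le> (2 * max a b) ^ m" using ab by (intro power_mono) auto
  also have "\<dots> = 2 ^ m * max a b ^ m" by (simp add: power_mult_distrib)
  also have "\<dots> \<le> 2 ^ m * (a ^ m + b ^ m)" using ab by (intro mult_left_mono) (auto simp: max_def)
  finally show ?thesis .
qed

text \<open>The three terms of \<open>P\<close> expand \<open>(1 + y\<^sup>2)\<^sup>2\<close>, and
  \<open>\<bar>x\<bar> ^ m\<close> is distributed over \<open>y\<close> and \<open>x - y\<close> at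
  the cost of \<open>2 ^ m\<close>. This is enlarged to \<open>2 ^ (n + m)\<close> so that
  \<open>adm_geom\<close> applies to the result.\<close>

lemma (in weight_class) conv_weight_bound:
  assumes "bnd f N" "bnd g M"
  shows "\<bar>x\<bar> ^ m * norm (f y * nderiv n g (x - y)) * (1 + y\<^sup>2)\<^sup>2 \<le> conv_weight N M n m"
proof -
  define P where "P = (\<lambda>n m. N n m + 2 * N n (m + 2) + N n (m + 4))"
  have f: "\<bar>y\<bar> ^ m * norm (f y) * (1 + y\<^sup>2)\<^sup>2 \<le> P 0 m" for m
  proof -
    have y2: "y\<^sup>2 = \<bar>y\<bar> ^ 2" by simp
    have "\<bar>y\<bar> ^ m * norm (f y) * (1 + y\<^sup>2)\<^sup>2 =
        \<bar>y\<bar> ^ m * norm (f y) + 2 * (\<bar>y\<bar> ^ (m + 2) * norm (f y)) + \<bar>y\<bar> ^ (m + 4) * norm (f y)"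
      unfolding y2 by (simp add: power_add power2_eq_square power4_eq_xxxx algebra_simps del: power2_abs)
    also have "\<dots> \<le> P 0 m"
      unfolding P_def by (intro add_mono mult_left_mono bndD[OF assms(1), of y _ 0, unfolded
          nderiv_0]) auto
    finally show ?thesis .
  qed
  have P0: "0 \<le> P 0 m" for m using bnd_nonneg[OF assms(1)] by (simp add: P_def)
  have "\<bar>x\<bar> ^ m \<le> (\<bar>y\<bar> + \<bar>x - y\<bar>) ^ m" by (intro power_mono) auto
  also have "\<dots> \<le> 2 ^ m * (\<bar>y\<bar> ^ m + \<bar>x - y\<bar> ^ m)" by (rule power_add_le) auto
  also have "\<dots> \<le> 2 ^ (n + m) * (\<bar>y\<bar> ^ m + \<bar>x - y\<bar> ^ m)"
    by (intro mult_right_mono power_increasing) auto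
  finally have "\<bar>x\<bar> ^ m * (norm (f y * nderiv n g (x - y)) * (1 + y\<^sup>2)\<^sup>2)
      \<le> 2 ^ (n + m) * (\<bar>y\<bar> ^ m + \<bar>x - y\<bar> ^ m) * (norm (f y * nderiv n g (x - y)) * (1 + y\<^sup>2)\<^sup>2)"
    by (rule mult_right_mono) simp
  also have "\<dots> = 2 ^ (n + m) * ((\<bar>y\<bar> ^ m * norm (f y) * (1
      + y\<^sup>2)\<^sup>2) * (\<bar>x - y\<bar> ^ 0 * norm (nderiv n g (x - y))) +
      (\<bar>y\<bar> ^ 0 * norm (f y) * (1 + y\<^sup>2)\<^sup>2) * (\<bar>x - y\<bar> ^ m * norm (nderiv n g (x - y))))"
    by (simp add: norm_mult algebra_simps)
  also have "\<dots> \<le> 2 ^ (n + m) * (P 0 m * M n 0 + P 0 0 * M n m)"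
    by (intro mult_left_mono add_mono mult_mono f bndD[OF assms(2)] P0) auto
  finally show ?thesis by (simp add: conv_weight_def P_def Let_def ac_simps)
qed

text \<open>Continuity is demanded only along null sequences inside one weight. This form follows
  from continuity in each of the topologies at hand, including the inductive limit, where such a
  sequence stays in a single step.\<close>

locale test_functional = weight_class +
  fixes u :: "(real \<Rightarrow> complex) \<Rightarrow> complex"
  assumes u_lin: "testfun f \<Longrightarrow> testfun g \<Longrightarrow> u (\<lambda>x. a * f x + b * g x) = a * u f + b * u g"
    and u_null: "adm N \<Longrightarrow> e \<longlonglongrightarrow> 0 \<Longrightarrow> (\<And>j. 0 \<le> e j) \<Longrightarrow> (\<And>j. bnd (\<psi> j) (\<lambda>n m. e j * N n m)) \<Longrightarrow> (\<lambda>j. u (\<psi> j)) \<longlonglongrightarrow> 0"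
begin

section \<open>Vanishing on sums, limits and integrals\<close>

lemma u_scale: "testfun f \<Longrightarrow> u (\<lambda>x. a * f x) = a * u f"
  using u_lin[of f f a 0] by simp

lemma u_diff: "testfun f \<Longrightarrow> testfun g \<Longrightarrow> u (\<lambda>x. f x - g x) = u f - u g"
  using u_lin[of f g 1 "-1"] by simp

lemma u_eq_0_sum:
  assumes "finite I" and "\<And>i. i \<in> I \<Longrightarrow> testfun (f i)" and "\<And>i. i \<in> I \<Longrightarrow> u (f i) = 0"
  shows "testfun (\<lambda>x. \<Sum>i\<in>I. a i * f i x) \<and> u (\<lambda>x. \<Sum>i\<in>I. a i * f i x) = 0"
  using assms
proof (induction rule: finite_induct)
  case empty
  \<comment> \<open>The zero function is obtained as a combination of Gaussians with coefficients
    0.\<close>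
  show ?case
    using testfun_lin[OF testfun_gexp testfun_gexp, where a = 0 and b = 0]
      u_lin[OF testfun_gexp testfun_gexp, where a = 0 and b = 0]
    by (simp del: gexp.simps)
next
  case (insert i I)
  then show ?case
    using testfun_lin[of "f i" "\<lambda>x. \<Sum>i\<in>I. a i * f i x" "a i" 1] u_lin[of "f i" "\<lambda>x. \<Sum>i\<in>I. a i
        * f i x" "a i" 1]
    by simp
qed

lemma u_eq_0_limit:
  assumes "testfun f" "adm N" "e \<longlonglongrightarrow> 0" "\<And>j. 0 \<le> e j" and "\<And>j. testfun (\<psi> j)" "\<And>j. u (\<psi> j) = 0"
    and "\<And>j. bnd (\<lambda>x. f x - \<psi> j x) (\<lambda>n m. e j * N n m)"
  shows "u f = 0"
proof -
  have "(\<lambda>j. u (\<lambda>x. f x - \<psi> j x)) \<longlonglongrightarrow> 0" by (rule u_null[OF assms(2,3,4,7)])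
  then show ?thesis using assms(1,5,6) by (simp add: u_diff LIMSEQ_const_iff)
qed

text \<open>The functional is exchanged with the integral by Riemann sums whose error tends to 0 in
  one weight. Of the two powers of \<open>1 + y\<^sup>2\<close> in the hypotheses, one makes the
  bounds integrable and the other makes the tail small at a known rate; the bound on the parameter
  derivative \<open>KY\<close> controls the discretisation.\<close>

lemma u_integral:
  fixes KD KY :: "nat \<Rightarrow> real \<Rightarrow> real \<Rightarrow> complex"
  assumes dx: "\<And>n y x. (KD n y has_vector_derivative KD (Suc n) y x) (at x)"
    and dy: "\<And>n y x. ((\<lambda>y. KD n y x) has_vector_derivative KY n y x) (at y)"
    and b1: "\<And>n m y x. \<bar>x\<bar> ^ m * norm (KD n y x) * (1 + y\<^sup>2)\<^sup>2 \<le> N n m"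
    and b2: "\<And>n m y x. \<bar>x\<bar> ^ m * norm (KY n y x) * (1 + y\<^sup>2)\<^sup>2 \<le> N n m"
    and N: "adm N" and u0: "\<And>y. u (KD 0 y) = 0"
  shows "testfun (\<lambda>x. \<integral>y. KD 0 y x \<partial>lborel) \<and> u (\<lambda>x. \<integral>y. KD 0 y x \<partial>lborel) = 0"
proof -
  define w where "w = (\<lambda>y::real. inverse (1 + y\<^sup>2))"
  define W where "W = integral\<^sup>L lborel w"
  define F where "F = (\<lambda>n x. \<integral>y. KD n y x \<partial>lborel)"
  have pos: "0 < 1 + y\<^sup>2" for y :: real by (simp add: add_pos_nonneg)
  have wint: "integrable lborel w" unfolding w_def by (rule integrable_inverse_square)
  have w0: "0 < w y" and w1: "w y \<le> 1" for y
    using pos[of y] by (auto simp: w_def inverse_le_1_iff)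
  have W0: "0 \<le> W" unfolding W_def using w0 by (intro Bochner_Integration.integral_nonneg) (simp add:
      less_imp_le)
  have c: "\<bar>x\<bar> ^ m * norm v \<le> N n m * w y * w y"
    if "\<bar>x\<bar> ^ m * norm v * (1 + y\<^sup>2)\<^sup>2 \<le> N n m" for x m v y n
  proof -
    have "(1 + y\<^sup>2) * w y = 1" using pos[of y] by (simp add: w_def)
    then have "(1 + y\<^sup>2)\<^sup>2 * (w y * w y) = 1" by (metis mult.commute mult.left_commute mult_1
        power2_eq_square)
    then show ?thesis
      using mult_right_mono[OF that, of "w y * w y"] w0[of y] by (simp add: mult.assoc)
  qed
  note c1 = c[OF b1] and c2 = c[OF b2]
  have N0: "0 \<le> N n m" for n m by (rule order_trans[OF _ b1[of 0 m n 0]]) simp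
  have b1': "\<bar>x\<bar> ^ m * norm (KD n y x) \<le> N n m * w y" for n m y x
    using order_trans[OF c1[of x m n y] mult_left_mono[OF w1[of y]]] N0[of n m] w0[of y] by simp
  have tK: "testfun (KD 0 y)" for y
  proof (rule testfunI[OF N bndI[of "\<lambda>n. KD n y", OF dx]])
    show "\<bar>x\<bar> ^ m * norm (KD n y x) \<le> N n m" for n m x
      using order_trans[OF b1'[of x m n y] mult_left_mono[OF w1[of y]]] N0[of n m] by simp
  qed
  have meas: "(\<lambda>y. KD n y x) \<in> borel_measurable lborel" for n x
  proof -
    have "continuous_on UNIV (\<lambda>y. KD n y x)"
      using dy by (meson continuous_at_imp_continuous_on has_vector_derivative_continuous)
    then show ?thesis by (simp add: borel_measurable_continuous_onI)
  qed
  have nb: "norm (KD n y x) \<le> N n 0 * w y" for n x y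
    using b1'[of x 0 n y] by simp
  note wi = has_vector_derivative_weighted_integral[of "\<lambda>n x y. KD n y x" lborel
      "\<lambda>n. N n 0" w, OF dx meas nb wint]
  have xF: "\<bar>x\<bar> ^ m * norm (F n x) \<le> W * N n m" for x m n
  proof -
    have "\<bar>x\<bar> ^ m * norm (F n x) = norm (\<integral>y. of_real (\<bar>x\<bar> ^ m) * KD n y x \<partial>lborel)"
      by (simp add: F_def norm_mult norm_power)
    also have "\<dots> \<le> (\<integral>y. N n m * w y \<partial>lborel)"
      using b1'[of x m n] wi(1) wint by (intro norm_integral_le) (auto simp: norm_mult norm_power)
    finally show ?thesis by (simp add: W_def mult.commute)
  qed
  have "bnd (F 0) (\<lambda>n m. W * N n m)"
    by (rule bndI[of F, OF _ xF]) (unfold F_def, rule wi(2))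
  then have tF: "testfun (\<lambda>x. \<integral>y. KD 0 y x \<partial>lborel)"
    unfolding F_def by (rule testfunI[rotated]) (intro adm_scale N W0)
  \<comment> \<open>The mesh \<open>1 / Suc j\<close> on the interval from \<open>- Suc j\<close> to
    \<open>Suc j\<close> ties truncation to refinement, so both errors are of order
    \<open>1 / Suc j\<close>.\<close>
  define I where "I = (\<lambda>j. {- int (Suc j ^ 2) ..< int (Suc j ^ 2)})"
  define p where "p = (\<lambda>j k. of_int k / real (Suc j))"
  define S where "S = (\<lambda>n j x. \<Sum>k\<in>I j. of_real (1 / real (Suc j)) * KD n (p j k) x)"
  \<comment> \<open>Step function in \<open>y\<close> whose integral is the Riemann sum; it turns
    the error into an integral of pointwise differences.\<close>
  define T where "T = (\<lambda>n j x y. \<Sum>k\<in>I j. indicator {p j k ..< p j k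
      + 1 / real (Suc j)} y *\<^sub>R KD n (p j k) x)"
  have intT: "integrable lborel (T n j x)" and ST: "S n j x = integral\<^sup>L lborel (T n j x)" for n j x
  proof -
    have i: "integrable lborel (indicat_real {p j k ..< p j k + 1 / real (Suc j)})" for k
      by (rule integrable_real_indicator) auto
    show "integrable lborel (T n j x)" unfolding T_def
      by (intro Bochner_Integration.integrable_sum integrable_scaleR_left i)
    show "S n j x = integral\<^sup>L lborel (T n j x)"
      unfolding S_def T_def
      by (subst Bochner_Integration.integral_sum) (auto intro!: integrable_scaleR_left i sum.cong
          simp: scaleR_conv_of_real)
  qed
  have step: "\<bar>x\<bar> ^ m * norm (KD n y x - T n j x y) \<le> 3 / real (Suc j) * N n m * w y" for x m n j y
  proof (cases "y \<in> {- real (Suc j) ..< real (Suc j)}")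
    case True
    \<comment> \<open>The floor selects the unique half-open cell containing \<open>y\<close>, so
      exactly one summand of \<open>T\<close> survives.\<close>
    define k where "k = \<lfloor>y * real (Suc j)\<rfloor>"
    have ind: "y \<in> {p j i ..< p j i + 1 / real (Suc j)} \<longleftrightarrow> i = k" for i
    proof -
      have "y \<in> {p j i ..< p j i + 1 / real (Suc j)}
          \<longleftrightarrow> of_int i \<le> y * real (Suc j) \<and> y * real (Suc j) < of_int i + 1"
        unfolding p_def by (auto simp: field_simps simp del: of_nat_Suc)
      then show ?thesis unfolding k_def
        using floor_unique[of i "y * real (Suc j)"] floor_correct[of "y * real (Suc j)"] by fastforce
    qed
    have kI: "k \<in> I j"
    proof -
      have sq: "real_of_int (int (Suc j ^ 2)) = real (Suc j) * real (Suc j)"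
        by (metis of_int_of_nat_eq of_nat_power power2_eq_square)
      have "- real (Suc j) * real (Suc j) \<le> y * real (Suc j)"
        using True by (intro mult_right_mono) auto
      then have "real_of_int (- int (Suc j ^ 2)) \<le> y * real (Suc j)"
        by (simp only: of_int_minus sq minus_mult_left)
      moreover have "y * real (Suc j) < real_of_int (int (Suc j ^ 2))"
        unfolding sq using True by (intro mult_strict_right_mono) auto
      ultimately show ?thesis unfolding I_def k_def
          unfolding atLeastLessThan_iff le_floor_iff floor_less_iff by blast
    qed
    have T: "T n j x y = KD n (p j k) x"
    proof -
      have "T n j x y = (\<Sum>i\<in>I j. if i = k then KD n (p j k) x else 0)"
        unfolding T_def using ind by (intro sum.cong) (auto simp: indicator_def)
      then show ?thesis using kI by (simp add: I_def)
    qed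
    have near: "\<bar>y - p j k\<bar> \<le> 1 / real (Suc j)" using ind[of k] by auto
    have one: "1 / real (Suc j) \<le> 1" by simp
    have "norm (of_real (\<bar>x\<bar> ^ m) * KD n y x - of_real (\<bar>x\<bar> ^ m) * KD n (p j k) x)
        \<le> 3 * N n m * w y * \<bar>y - p j k\<bar>"
    proof (rule norm_diff_le_vderiv)
      show "((\<lambda>y. of_real (\<bar>x\<bar> ^ m) * KD n y x) has_vector_derivative of_real (\<bar>x\<bar> ^ m)
          * KY n z x) (at z)" for z
        by (intro has_vector_derivative_mult_right dy)
      fix z assume "z \<in> closed_segment (p j k) y"
      then have "\<bar>y - z\<bar> \<le> \<bar>y - p j k\<bar>" by (auto simp: closed_segment_eq_real_ivl split: if_splits)
      then have "\<bar>y - z\<bar> \<le> 1" using near one by linarith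
      then have wz: "w z \<le> 3 * w y" unfolding w_def by (rule one_plus_square_near)
      have "norm (of_real (\<bar>x\<bar> ^ m) * KY n z x) = \<bar>x\<bar> ^ m * norm (KY n z x)"
        by (simp add: norm_mult norm_power)
      also have "\<dots> \<le> N n m * w z"
        using order_trans[OF c2[of x m n z] mult_left_mono[OF w1[of z]]] N0[of n m] w0[of z] by simp
      also have "\<dots> \<le> N n m * (3 * w y)" by (rule mult_left_mono[OF wz N0])
      finally show "norm (of_real (\<bar>x\<bar> ^ m) * KY n z x) \<le> 3 * N n m * w y" by simp
    qed
    also have "\<dots> \<le> 3 * N n m * w y * (1 / real (Suc j))"
      using N0[of n m] w0[of y] near by (intro mult_left_mono) auto
    also have "of_real (\<bar>x\<bar> ^ m) * KD n y x - of_real (\<bar>x\<bar> ^ m) * KD n (p j k) x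
        = of_real (\<bar>x\<bar> ^ m) * (KD n y x - T n j x y)"
      by (simp add: T algebra_simps)
    finally show ?thesis by (simp add: norm_mult norm_power)
  next
    case False
    have T: "T n j x y = 0"
      unfolding T_def
    proof (rule sum.neutral, rule ballI)
      fix k assume "k \<in> I j"
      then have "real_of_int (- int (Suc j ^ 2)) \<le> real_of_int k" "real_of_int (k + 1)
          \<le> real_of_int (int (Suc j ^ 2))"
        unfolding I_def of_int_le_iff by auto
      then have k: "- (real (Suc j))\<^sup>2 \<le> of_int k" "of_int k + 1 \<le> (real (Suc j))\<^sup>2"
        by simp_all
      have "- real (Suc j) \<le> p j k" "p j k + 1 / real (Suc j) \<le> real (Suc j)"
        using k unfolding p_def by (simp_all add: field_simps power2_eq_square del: of_nat_Suc)
      then have "y \<notin> {p j k ..< p j k + 1 / real (Suc j)}" using False by auto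
      then show "indicat_real {p j k..<p j k + 1 / real (Suc j)} y *\<^sub>R KD n (p j k) x = 0" by simp
    qed
    \<comment> \<open>Outside the sampled interval there is no cancellation; the rate comes from the
      second factor \<open>w y\<close>, because \<open>1 + y\<^sup>2\<close> exceeds
      \<open>Suc j\<close> there.\<close>
    have yj: "real (Suc j) \<le> \<bar>y\<bar>" using False by auto
    have "real (Suc j) \<le> (real (Suc j))\<^sup>2"
      unfolding power2_eq_square using mult_left_mono[of 1 "real (Suc j)" "real (Suc j)"] by simp
    also have "\<dots> \<le> y\<^sup>2" using yj by (metis abs_le_square_iff abs_of_nat)
    also have "\<dots> \<le> 1 + y\<^sup>2" by simp
    finally have "real (Suc j) \<le> 1 + y\<^sup>2" .
    then have wj: "w y \<le> 1 / real (Suc j)"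
      unfolding w_def inverse_eq_divide by (intro frac_le) auto
    have "\<bar>x\<bar> ^ m * norm (KD n y x) \<le> N n m * w y * (1 / real (Suc j))"
      using N0[of n m] w0[of y] by (intro order_trans[OF c1 mult_left_mono[OF wj]]) auto
    also have "\<dots> \<le> 3 / real (Suc j) * N n m * w y"
      using N0[of n m] w0[of y] by (simp add: field_simps)
    finally show ?thesis by (simp add: T)
  qed
  have diff: "\<bar>x\<bar> ^ m * norm (F n x - S n j x) \<le> 3 / real (Suc j) * (W * N n m)" for x m n j
  proof -
    have "of_real (\<bar>x\<bar> ^ m) * (F n x - S n j x)
        = (\<integral>y. of_real (\<bar>x\<bar> ^ m) * (KD n y x - T n j x y) \<partial>lborel)"
      unfolding F_def ST using wi(1) intT by simp
    also have "norm \<dots> \<le> (\<integral>y. 3 / real (Suc j) * N n m * w y \<partial>lborel)"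
      using step wi(1) intT wint by (intro norm_integral_le) (auto simp: norm_mult norm_power)
    finally show ?thesis by (simp add: W_def norm_mult norm_power ac_simps)
  qed
  have "u (\<lambda>x. \<integral>y. KD 0 y x \<partial>lborel) = 0"
  proof (rule u_eq_0_limit[OF tF adm_scale[OF N W0]])
    show "(\<lambda>j. 3 / real (Suc j)) \<longlonglongrightarrow> 0"
      using tendsto_mult_right[OF LIMSEQ_inverse_real_of_nat, of 3] by (simp add: divide_inverse)
    show "0 \<le> 3 / real (Suc j)" for j by simp
    have tu: "testfun (S 0 j) \<and> u (S 0 j) = 0" for j
      unfolding S_def by (rule u_eq_0_sum) (auto simp: I_def tK u0)
    then show "testfun (S 0 j)" "u (S 0 j) = 0" for j by auto
    have dS: "(S n j has_vector_derivative S (Suc n) j x) (at x)" for n j x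
      unfolding S_def by (intro has_vector_derivative_sum has_vector_derivative_mult_right dx)
    have dF: "(F n has_vector_derivative F (Suc n) x) (at x)" for n x
      unfolding F_def by (rule wi(2))
    show "bnd (\<lambda>x. (\<integral>y. KD 0 y x \<partial>lborel) - S 0 j x) (\<lambda>n m. 3 / real (Suc j) * (W * N n m))" for j
      using bndI[of "\<lambda>n x. F n x - S n j x", OF has_vector_derivative_diff[OF dF dS] diff]
      by (simp add: F_def)
  qed
  with tF show ?thesis ..
qed

end

section \<open>From Gaussians of unit width to narrower ones\<close>

lemma poly_times_gauss_le:
  "(1 + \<bar>p\<bar>) * (1 + p\<^sup>2)\<^sup>2 * exp (- p\<^sup>2 / 2 + p\<^sup>2 / 32) \<le> 8192" for p :: real
proof -
  let ?e = "exp (p\<^sup>2 / 16)"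
  have a: "1 + p\<^sup>2 \<le> 16 * ?e" using exp_ge_add_one_self[of "p\<^sup>2 / 16"] by linarith
  have "0 \<le> (1 - \<bar>p\<bar>)\<^sup>2" by simp
  then have "2 * \<bar>p\<bar> \<le> 1 + p\<^sup>2" by (simp add: power2_eq_square algebra_simps)
  then have b: "1 + \<bar>p\<bar> \<le> 2 * (16 * ?e)" using a zero_le_power2[of p] by linarith
  \<comment> \<open>Each factor \<open>1 + p\<^sup>2\<close> costs
    \<open>16 * exp (p\<^sup>2 / 16)\<close>, whence \<open>8192 = 2 * 16 * 16\<^sup>2\<close>; the
    total exponent \<open>3/16 - 1/2 + 1/32\<close> of \<open>p\<^sup>2\<close> is still
    negative.\<close>
  have "(1 + \<bar>p\<bar>) * (1 + p\<^sup>2)\<^sup>2 \<le> (2 * (16 * ?e)) * (16 * ?e)\<^sup>2"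
    by (intro mult_mono power_mono a b) auto
  also have "\<dots> = 8192 * exp (3 * (p\<^sup>2 / 16))"
    by (simp add: power2_eq_square exp_add[symmetric] del: exp_add)
  finally have "(1 + \<bar>p\<bar>) * (1 + p\<^sup>2)\<^sup>2 * exp (- p\<^sup>2 / 2 + p\<^sup>2 / 32) \<le>
      8192 * exp (3 * (p\<^sup>2 / 16)) * exp (- p\<^sup>2 / 2 + p\<^sup>2 / 32)"
    by (rule mult_right_mono) simp
  also have "\<dots> = 8192 * exp (- (9 * p\<^sup>2 / 32))"
    by (simp add: exp_add[symmetric])
  also have "\<dots> \<le> 8192" by simp
  finally show ?thesis .
qed

lemma std_normal_density_le: "std_normal_density v \<le> exp (- v\<^sup>2 / 2)"
proof -
  have "1 \<le> sqrt (2 * pi)" using pi_ge_two by simp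
  then have "1 / sqrt (2 * pi) * exp (- v\<^sup>2 / 2) \<le> 1 * exp (- v\<^sup>2 / 2)"
    by (intro mult_right_mono) auto
  then show ?thesis by (simp add: std_normal_density_def)
qed

lemma gauss_fourier:
  "(\<integral>p. of_real (std_normal_density p) * iexp (t * p) \<partial>lborel) = complex_of_real (exp (- t\<^sup>2 / 2))"
proof -
  have "char std_normal_distribution t = complex_of_real (exp (- t\<^sup>2 / 2))"
    by (simp add: char_std_normal_distribution)
  then show ?thesis
    unfolding char_def by (subst (asm) integral_density) (auto simp: scaleR_conv_of_real)
qed

context test_functional
begin

text \<open>For normally distributed \<open>p\<close> the average of
  \<open>exp (\<i> * t * p * x)\<close> is \<open>exp (- t\<^sup>2 * x\<^sup>2 / 2)\<close>.
  Multiplied by the original Gaussian this sharpens the coefficient 1 of \<open>x\<^sup>2\<close> to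
  \<open>1 + t\<^sup>2\<close>.\<close>

lemma u_narrow_gaussian:
  assumes u0: "\<And>c. u (gexp c 0) = 0"
  shows "u (\<lambda>x. exp (of_real (b * x - (1 + t\<^sup>2) * x\<^sup>2 / 2))) = 0"
proof -
  \<comment> \<open>Only the imaginary part varies with \<open>p\<close>, so the modulus of the
    Gaussian itself does not depend on \<open>p\<close>; growth in \<open>p\<close> comes from the
    derivatives alone.\<close>
  define c where "c = (\<lambda>p. complex_of_real b + \<i> * of_real (t * p))"
  define r where "r = (\<lambda>p. complex_of_real (std_normal_density p))"
  define KD where "KD = (\<lambda>n p x. r p * gexp (c p) n x)"
  define KY where "KY = (\<lambda>n p x. r p * ((\<i> * of_real t) * (of_real x * gexp (c p) n x
      + of_nat n * gexp (c p) (n - 1) x))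
      + (- of_real p * r p) * gexp (c p) n x)"
  \<comment> \<open>This choice gives both \<open>k \<le> 1/2\<close> and
    \<open>k * \<bar>t\<bar> \<le> 1/4\<close>. The growth in \<open>p\<close> allowed by
    \<open>norm_gexp_bound\<close> is then at most \<open>exp (p\<^sup>2 / 32)\<close>, far below
    the decay of the normal density.\<close>
  define k where "k = 1 / (2 + 4 * \<bar>t\<bar>)"
  have k: "0 < k" "k \<le> 1/2" by (auto simp: k_def field_simps add_pos_nonneg)
  have A1: "1 \<le> 3 / k" using k by (simp add: field_simps)
  define N0 where "N0 = (\<lambda>n m. (3 / k) ^ (n + m) * gauss_weight n m)"
  \<comment> \<open>The shifted summand pays for the factor \<open>x\<close> in the parameter
    derivative, the last one for the factor \<open>n\<close> in front of the derivative of order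
    \<open>n - 1\<close>.\<close>
  define N where "N = (\<lambda>n m. N0 n m + N0 n (Suc m) + 2 ^ (n + m) * N0 n m)"
  \<comment> \<open>\<open>8192\<close> comes from \<open>poly_times_gauss_le\<close>, the middle
    factor from \<open>norm_gexp_bound\<close>, and \<open>1 + \<bar>t\<bar>\<close> from the
    coefficients of \<open>KY\<close>.\<close>
  define C where "C = 8192 * (3 * exp (2 * b\<^sup>2)) * (1 + \<bar>t\<bar>)"
  have aN0: "adm N0" unfolding N0_def by (intro adm_geom adm_gauss A1)
  then have aN: "adm N" unfolding N_def by (intro adm_add adm_geom adm_Suc_right) auto
  have N0nn: "0 \<le> N0 n m" for n m using k by (simp add: N0_def gauss_weight_def)
  have kt: "k\<^sup>2 * t\<^sup>2 \<le> 1 / 16"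
  proof -
    have "k * \<bar>t\<bar> \<le> 1 / 4" by (simp add: k_def field_simps add_pos_nonneg)
    then have "(k * \<bar>t\<bar>)\<^sup>2 \<le> (1/4)\<^sup>2" using k by (intro power_mono) auto
    then show ?thesis by (simp add: power_mult_distrib power2_eq_square[of "1/4::real"])
  qed
  have expo: "k\<^sup>2 * (norm (c p))\<^sup>2 / 2 + (Re (c p))\<^sup>2 \<le> 2 * b\<^sup>2 + p\<^sup>2 / 32" for p
  proof -
    have "(norm (c p))\<^sup>2 = b\<^sup>2 + t\<^sup>2 * p\<^sup>2" unfolding cmod_power2 by (simp add: c_def power_mult_distrib)
    then have "k\<^sup>2 * (norm (c p))\<^sup>2 / 2 = k\<^sup>2 * b\<^sup>2 / 2 + (k\<^sup>2 * t\<^sup>2) * p\<^sup>2 / 2"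
        by (simp add: algebra_simps)
    moreover have "k\<^sup>2 * b\<^sup>2 \<le> 1 * b\<^sup>2" using k by (intro mult_right_mono power_le_one) auto
    moreover have "(k\<^sup>2 * t\<^sup>2) * p\<^sup>2 \<le> 1 / 16 * p\<^sup>2" using kt by (intro mult_right_mono) auto
    moreover have R: "Re (c p) = b" by (simp add: c_def)
    moreover have "0 \<le> b\<^sup>2" by simp
    ultimately show ?thesis unfolding R by linarith
  qed
  have g: "\<bar>x\<bar> ^ m * norm (gexp (c p) n x) \<le> N0 n m * (3 * exp (2 * b\<^sup>2)) * exp (p\<^sup>2 / 32)" for n m p x
  proof -
    have "\<bar>x\<bar> ^ m * norm (gexp (c p) n x) \<le> N0 n m * (3 * exp (k\<^sup>2 * (norm (c p))\<^sup>2 / 2 + (Re (c p))\<^sup>2))"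
      using norm_gexp_bound[OF k] by (simp add: N0_def gauss_weight_def)
    also have "\<dots> \<le> N0 n m * (3 * exp (2 * b\<^sup>2 + p\<^sup>2 / 32))"
      using expo[of p] N0nn by (intro mult_left_mono) auto
    finally show ?thesis by (simp add: exp_add)
  qed
  have r: "norm (r p) \<le> exp (- p\<^sup>2 / 2)" for p
    unfolding r_def norm_of_real abs_of_nonneg[OF normal_density_nonneg] by (rule std_normal_density_le)
  have bound: "norm (r p) * a * (N0 n m * (3 * exp (2 * b\<^sup>2)) * exp (p\<^sup>2 / 32)) * (1 + p\<^sup>2)\<^sup>2
      \<le> C * N0 n m"
    if "0 \<le> a" "a \<le> (1 + \<bar>t\<bar>) * (1 + \<bar>p\<bar>)" for a p n m
  proof -
    have "norm (r p) * a * (N0 n m * (3 * exp (2 * b\<^sup>2)) * exp (p\<^sup>2 / 32)) * (1 + p\<^sup>2)\<^sup>2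
      \<le> exp (- p\<^sup>2 / 2) * ((1 + \<bar>t\<bar>) * (1 + \<bar>p\<bar>)) * (N0 n m * (3 * exp (2 * b\<^sup>2)) * exp (p\<^sup>2 / 32))
          * (1 + p\<^sup>2)\<^sup>2"
      using that N0nn[of n m] by (intro mult_right_mono mult_mono r) auto
    also have "\<dots> = (1 + \<bar>t\<bar>) * (N0 n m * (3 * exp (2 * b\<^sup>2))) * ((1 + \<bar>p\<bar>) * (1
        + p\<^sup>2)\<^sup>2 * exp (- p\<^sup>2 / 2 + p\<^sup>2 / 32))"
      unfolding exp_add by (simp only: ac_simps)
    also have "\<dots> \<le> (1 + \<bar>t\<bar>) * (N0 n m * (3 * exp (2 * b\<^sup>2))) * 8192"
      using N0nn[of n m] by (intro mult_left_mono poly_times_gauss_le) auto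
    finally show ?thesis by (simp add: C_def ac_simps)
  qed
  have C0: "0 \<le> C" by (simp add: C_def)
  have g1: "\<bar>x\<bar> ^ m * norm (r p * a * gexp (c p) n x) * (1 + p\<^sup>2)\<^sup>2 \<le> C * N0 n m"
    if "norm a \<le> (1 + \<bar>t\<bar>) * (1 + \<bar>p\<bar>)" for a n m p x
  proof -
    have "\<bar>x\<bar> ^ m * norm (r p * a * gexp (c p) n x) * (1 + p\<^sup>2)\<^sup>2
        = norm (r p) * norm a * (\<bar>x\<bar> ^ m * norm (gexp (c p) n x)) * (1 + p\<^sup>2)\<^sup>2"
      by (simp add: norm_mult)
    also have "\<dots> \<le> norm (r p) * norm a * (N0 n m * (3 * exp (2 * b\<^sup>2)) * exp (p\<^sup>2 / 32)) * (1 + p\<^sup>2)\<^sup>2"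
      by (intro mult_right_mono mult_left_mono g) auto
    also have "\<dots> \<le> C * N0 n m" by (rule bound[OF norm_ge_zero that])
    finally show ?thesis .
  qed
  have le1: "1 \<le> (1 + \<bar>t\<bar>) * (1 + \<bar>p\<bar>)" "\<bar>t\<bar> \<le> (1 + \<bar>t\<bar>) * (1 + \<bar>p\<bar>)" "\<bar>p\<bar> \<le> (1 + \<bar>t\<bar>) * (1 + \<bar>p\<bar>)" for p
    by (simp_all add: algebra_simps)
  have CN: "C * N n m = C * N0 n m + C * N0 n (Suc m) + C * (2 ^ (n + m) * N0 n m)" for n m
    by (simp add: N_def algebra_simps)
  have dc: "((\<lambda>p. c p) has_vector_derivative \<i> * of_real t) (at p)" for p
    unfolding c_def by (auto intro!: derivative_eq_intros has_vector_derivative_real_field simp: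
        has_vector_derivative_def scaleR_conv_of_real)
  have dr: "((\<lambda>p. r p) has_vector_derivative - of_real p * r p) (at p)" for p
  proof -
    have "(std_normal_density has_real_derivative - p * std_normal_density p) (at p)"
    proof -
      have "((\<lambda>p. exp (- p\<^sup>2 / 2)) has_real_derivative exp (- p\<^sup>2 / 2) * - p) (at p)"
        by (auto intro!: derivative_eq_intros)
      from DERIV_cmult[OF this, of "1 / sqrt (2 * pi)"] show ?thesis
        by (simp add: std_normal_density_def[abs_def] ac_simps)
    qed
    from has_vector_derivative_of_real[OF this] show ?thesis by (simp add: r_def)
  qed
  have *: "testfun (\<lambda>x. \<integral>p. KD 0 p x \<partial>lborel) \<and> u (\<lambda>x. \<integral>p. KD 0 p x \<partial>lborel) = 0"
  proof (rule u_integral[where KD = KD and KY = KY and N = "\<lambda>n m. C * N n m"])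
    show "(KD n p has_vector_derivative KD (Suc n) p x) (at x)" for n p x
      unfolding KD_def by (intro has_vector_derivative_mult_right gexp_deriv)
    show "((\<lambda>p. KD n p x) has_vector_derivative KY n p x) (at p)" for n p x
    proof -
      have "((\<lambda>p. gexp (c p) n x) has_vector_derivative
          (\<i> * of_real t) * (of_real x * gexp (c p) n x + of_nat n * gexp (c p) (n - 1) x)) (at p)"
        using field_vector_diff_chain_at[OF dc gexp_param_deriv] by (simp add: o_def)
      from has_vector_derivative_mult[OF dr this] show ?thesis unfolding KD_def KY_def .
    qed
    show "\<bar>x\<bar> ^ m * norm (KD n p x) * (1 + p\<^sup>2)\<^sup>2 \<le> C * N n m" for n m p x
    proof -
      have "\<bar>x\<bar> ^ m * norm (KD n p x) * (1 + p\<^sup>2)\<^sup>2 \<le> C * N0 n m"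
        using g1[of 1 p x m n] le1[of p] by (simp add: KD_def)
      then show ?thesis unfolding CN using C0 N0nn[of n m] N0nn[of n "Suc m"]
        by (smt (verit) mult_nonneg_nonneg zero_le_power)
    qed
    show "\<bar>x\<bar> ^ m * norm (KY n p x) * (1 + p\<^sup>2)\<^sup>2 \<le> C * N n m" for n m p x
    proof -
      let ?it = "\<i> * of_real t :: complex"
      have "norm (KY n p x) \<le> norm (r p * ?it * (of_real x * gexp (c p) n x))
          + norm (r p * ?it * (of_nat n * gexp (c p) (n - 1) x))
          + norm (r p * (- of_real p) * gexp (c p) n x)"
        unfolding KY_def
        by (rule order_trans[OF norm_triangle_ineq add_mono[OF order_trans[OF _ norm_triangle_ineq]]])
          (simp_all add: algebra_simps)
      then have "\<bar>x\<bar> ^ m * norm (KY n p x) * (1 + p\<^sup>2)\<^sup>2 \<le>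
          \<bar>x\<bar> ^ m * (norm (r p * ?it * (of_real x * gexp (c p) n x))
              + norm (r p * ?it * (of_nat n * gexp (c p) (n - 1) x))
          + norm (r p * (- of_real p) * gexp (c p) n x)) * (1 + p\<^sup>2)\<^sup>2"
        by (intro mult_right_mono mult_left_mono) auto
      also have "\<dots> = \<bar>x\<bar> ^ Suc m * norm (r p * ?it * gexp (c p) n x) * (1 + p\<^sup>2)\<^sup>2
          + real n * (\<bar>x\<bar> ^ m * norm (r p * ?it * gexp (c p) (n - 1) x) * (1 + p\<^sup>2)\<^sup>2)
          + \<bar>x\<bar> ^ m * norm (r p * (- of_real p) * gexp (c p) n x) * (1 + p\<^sup>2)\<^sup>2"
        by (simp add: norm_mult algebra_simps)
      also have "\<dots> \<le> C * N0 n (Suc m) + real n * (C * N0 (n - 1) m) + C * N0 n m"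
        using le1[of p] by (intro add_mono mult_left_mono g1) (auto simp: norm_mult)
      \<comment> \<open>The factor \<open>n\<close> is absorbed by \<open>2 ^ n\<close>, and passing
        from \<open>n - 1\<close> to \<open>n\<close> is free because \<open>N0\<close> increases in
        its first argument.\<close>
      also have "real n * (C * N0 (n - 1) m) \<le> C * (2 ^ (n + m) * N0 n m)"
      proof -
        have "N0 (n - 1) m \<le> N0 n m"
          unfolding N0_def gauss_weight_def using A1 k
          by (intro mult_mono power_increasing) (auto intro!: real_sqrt_le_mono fact_mono)
        moreover have "real n \<le> 2 ^ (n + m)"
        proof -
          have "real n \<le> 2 ^ n" using of_nat_less_two_power[of n, where 'a = real] by simp
          also have "\<dots> \<le> 2 ^ (n + m)" by (rule power_increasing) auto
          finally show ?thesis .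
        qed
        ultimately have "real n * N0 (n - 1) m \<le> 2 ^ (n + m) * N0 n m" using N0nn
            by (intro mult_mono) auto
        then show ?thesis using C0 mult_left_mono[of _ _ C] by (metis mult.left_commute)
      qed
      finally show ?thesis unfolding CN by simp
    qed
    show "adm (\<lambda>n m. C * N n m)" by (intro adm_scale aN C0)
    show "u (KD 0 p) = 0" for p
      unfolding KD_def using u_scale[OF testfun_gexp] u0 by simp
  qed
  have "(\<integral>p. KD 0 p x \<partial>lborel) = exp (of_real (b * x - (1 + t\<^sup>2) * x\<^sup>2 / 2))" for x
  proof -
    have "KD 0 p x = gexp (of_real b) 0 x * (of_real (std_normal_density p) * iexp (t * x * p))" for p
      by (simp add: KD_def r_def c_def exp_add[symmetric] algebra_simps)
    then have "(\<integral>p. KD 0 p x \<partial>lborel) = gexp (of_real b) 0 x * of_real (exp (- (t * x)\<^sup>2 / 2))"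
      using gauss_fourier[of "t * x"] by simp
    also have "\<dots> = exp (of_real (b * x - (1 + t\<^sup>2) * x\<^sup>2 / 2))"
      by (simp add: exp_of_real[symmetric] exp_add[symmetric] del: exp_of_real)
        (rule arg_cong[of _ _ exp], simp add: field_simps)
    finally show ?thesis .
  qed
  then show ?thesis using * by simp
qed

end

section \<open>Mollification by narrow Gaussians\<close>

lemma bnd_dilate:
  assumes "bnd g N" "1 \<le> r"
  shows "bnd (\<lambda>x. g (r * x)) (\<lambda>n m. r ^ (n + m) * N n m)"
proof -
  let ?G = "\<lambda>n x. of_real r ^ n * nderiv n g (r * x)"
  have "bnd (?G 0) (\<lambda>n m. r ^ (n + m) * N n m)"
  proof (rule bndI)
    fix n x
    have 1: "((\<lambda>x. r * x) has_vector_derivative r) (at x)"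
      by (auto intro!: derivative_eq_intros)
    have "((\<lambda>x. nderiv n g (r * x)) has_vector_derivative r *\<^sub>R nderiv (Suc n) g (r * x)) (at x)"
      using vector_diff_chain_at[OF 1 smooth1D[OF bnd_smooth[OF assms(1)]]] by (simp add: o_def)
    from has_vector_derivative_mult_right[OF this, of "of_real r ^ n"]
    show "(?G n has_vector_derivative ?G (Suc n) x) (at x)"
      by (simp add: scaleR_conv_of_real ac_simps)
  next
    fix n m x
    have "\<bar>x\<bar> ^ m * norm (?G n x) = r ^ n * (\<bar>x\<bar> ^ m * norm (nderiv n g (r * x)))"
      using assms(2) by (simp add: norm_mult norm_power)
    \<comment> \<open>Dilation scales the bound by \<open>r ^ n / r ^ m\<close>; since
      \<open>1 \<le> r\<close>, both powers may be enlarged, which yields the shape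
      \<open>r ^ (n + m)\<close> covered by \<open>adm_geom\<close>.\<close>
    also have "\<dots> \<le> r ^ n * (r ^ m * (\<bar>x\<bar> ^ m * norm (nderiv n g (r * x))))"
      using assms(2) mult_right_mono[of 1 "r ^ m" "\<bar>x\<bar> ^ m * norm (nderiv n g (r * x))"]
      by (intro mult_left_mono) auto
    also have "\<dots> = r ^ n * (\<bar>r * x\<bar> ^ m * norm (nderiv n g (r * x)))"
      using assms(2) by (simp add: abs_mult power_mult_distrib)
    also have "\<dots> \<le> r ^ (n + m) * N n m"
      using assms(2) by (intro mult_mono bndD[OF assms(1)] power_increasing) auto
    finally show "\<bar>x\<bar> ^ m * norm (?G n x) \<le> r ^ (n + m) * N n m" .
  qed
  then show ?thesis by simp
qed

text \<open>This integrand governs the mollification error: \<open>\<bar>v\<bar>\<close> is the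
  displacement in the mean value inequality, and \<open>exp (v\<^sup>2 / 8)\<close> pays for
  \<open>\<bar>v\<bar> ^ m\<close> simultaneously for all \<open>m\<close>, up to
  \<open>gauss_weight\<close>.\<close>

lemma integrable_normal_weight:
  "integrable lborel (\<lambda>v. std_normal_density v * \<bar>v\<bar> * exp (v\<^sup>2 / 8))"
proof (rule Bochner_Integration.integrable_bound)
  show "integrable lborel (\<lambda>v. 8 * inverse (1 + v\<^sup>2) :: real)"
    by (intro integrable_mult_right integrable_inverse_square)
  show "AE v in lborel. norm (std_normal_density v * \<bar>v\<bar> * exp (v\<^sup>2 / 8)) \<le> norm (8 * inverse (1 + v\<^sup>2))"
  proof (rule AE_I2)
    fix v :: real
    define t where "t = v\<^sup>2 / 8"
    have t: "0 \<le> t" "v\<^sup>2 = 8 * t" by (simp_all add: t_def)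
    have "\<bar>v\<bar> * (1 + v\<^sup>2) \<le> 8 * exp (3 * t)"
    proof -
      have "0 \<le> (1 - \<bar>v\<bar>)\<^sup>2" by simp
      then have "2 * \<bar>v\<bar> \<le> 1 + v\<^sup>2" by (simp add: power2_eq_square algebra_simps)
      then have a: "\<bar>v\<bar> \<le> (1 + 8 * t) / 2" using t by simp
      have "\<bar>v\<bar> * (1 + v\<^sup>2) \<le> (1 + 8 * t) / 2 * (1 + 8 * t)"
        unfolding t(2) by (rule mult_right_mono[OF a]) (use t in simp)
      also have "\<dots> \<le> 8 * (1 + 3 * t + (3 * t)\<^sup>2 / 2)" using t
          by (simp add: power2_eq_square algebra_simps)
      also have "\<dots> \<le> 8 * exp (3 * t)"
        using exp_lower_Taylor_quadratic[of "3 * t"] t by simp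
      finally show ?thesis .
    qed
    note a = this
    have "std_normal_density v * exp (v\<^sup>2 / 8) \<le> exp (- (3 * t))"
    proof -
      have "std_normal_density v * exp (v\<^sup>2 / 8) \<le> exp (- v\<^sup>2 / 2) * exp (v\<^sup>2 / 8)"
        by (intro mult_right_mono std_normal_density_le) auto
      also have "\<dots> = exp (- (3 * t))" by (simp add: exp_add[symmetric] t_def)
      finally show ?thesis .
    qed
    note b = this
    have "(std_normal_density v * exp (v\<^sup>2 / 8)) * (\<bar>v\<bar> * (1 + v\<^sup>2))
        \<le> exp (- (3 * t)) * (8 * exp (3 * t))"
      by (rule mult_mono[OF b a]) auto
    also have "\<dots> = 8" by (simp add: exp_minus)
    finally have "std_normal_density v * \<bar>v\<bar> * exp (v\<^sup>2 / 8) * (1 + v\<^sup>2) \<le> 8" by (simp add: ac_simps)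
    then have "std_normal_density v * \<bar>v\<bar> * exp (v\<^sup>2 / 8) \<le> 8 * inverse (1 + v\<^sup>2)"
      by (simp add: field_simps add_pos_nonneg)
    then show "norm (std_normal_density v * \<bar>v\<bar> * exp (v\<^sup>2 / 8)) \<le> norm (8 * inverse (1 + v\<^sup>2))"
      by (simp add: abs_mult)
  qed
qed measurable

context test_functional
begin

text \<open>The average of \<open>g (x - v / r)\<close> over the standard normal density is a superposition of
  translates of the Gaussian of width \<open>1 / r\<close>, and \<open>u\<close> vanishes on the latter.\<close>

lemma u_smoothing:
  assumes u0: "\<And>c. u (gexp c 0) = 0" and N: "adm N" and g: "bnd g N"
    and r: "r\<^sup>2 = 1 + t\<^sup>2" "0 < r"
  defines "\<Psi> \<equiv> \<lambda>x. \<integral>v. of_real (std_normal_density v) * g (x - v / r) \<partial>lborel"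
  shows "testfun \<Psi>" "u \<Psi> = 0"
proof -
  have r1: "1 \<le> r"
  proof (rule power2_le_imp_le)
    show "1\<^sup>2 \<le> r\<^sup>2" using r by simp
  qed (use r in simp)
  define G where "G = (\<lambda>x. gexp 0 0 (r * x))"
  obtain M0 where M0: "adm M0" "bnd (gexp 0 0) M0" by (rule bnd_gexp)
  define M where "M = (\<lambda>n m. r ^ (n + m) * M0 n m)"
  have M: "adm M" "bnd G M" unfolding M_def G_def
    by (intro adm_geom M0 r1 bnd_dilate)+
  define KD where "KD = (\<lambda>n y x. g y * nderiv n G (x - y))"
  define KY where "KY = (\<lambda>n y x. g y * (- nderiv (Suc n) G (x - y)) + nderiv 1 g y * nderiv n G (x - y))"
  let ?N1 = "\<lambda>n m. N (Suc n) m" and ?M1 = "\<lambda>n m. M (Suc n) m"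
  \<comment> \<open>One weight has to serve both \<open>KD\<close> and \<open>KY\<close>. The
    derivative in \<open>y\<close> falls on either factor of the product, hence the two terms with a
    shifted weight.\<close>
  define Q where "Q = (\<lambda>n m. conv_weight N M n m + (conv_weight N ?M1 n m + conv_weight ?N1 M n m))"
  have Nn: "0 \<le> N n m" and Mn: "0 \<le> M n m" for n m
    using bnd_nonneg g M(2) by blast+
  have cw: "0 \<le> conv_weight N' M' n m" if "\<And>n m. 0 \<le> N' n m" "\<And>n m. 0 \<le> M' n m" for N' M' n m
    using that by (simp add: conv_weight_def Let_def)
  have Q: "conv_weight N M n m \<le> Q n m" "conv_weight N ?M1 n m + conv_weight ?N1 M n m \<le> Q n m" for n m
    using cw[of N M n m] cw[of N ?M1 n m] cw[of ?N1 M n m] Nn Mn by (auto simp: Q_def)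
  have aQ: "adm Q" unfolding Q_def
    using Nn Mn N M by (intro adm_add adm_conv_weight adm_Suc_left) auto
  have sG: "smooth1 G" and sg: "smooth1 g" using M(2) g bnd_smooth by auto
  have *: "testfun (\<lambda>x. \<integral>y. KD 0 y x \<partial>lborel) \<and> u (\<lambda>x. \<integral>y. KD 0 y x \<partial>lborel) = 0"
  proof (rule u_integral[where KD = KD and KY = KY and N = Q])
    show "(KD n y has_vector_derivative KD (Suc n) y x) (at x)" for n y x
      unfolding KD_def
      by (rule has_vector_derivative_mult_right)
        (rule smooth1D[OF smooth1_affine(1)[OF sG, of y], of n, unfolded smooth1_affine(2)[OF sG]])
    show "((\<lambda>y. KD n y x) has_vector_derivative KY n y x) (at y)" for n y x
    proof -
      have 1: "((\<lambda>y. x - y) has_vector_derivative -1) (at y)"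
        by (auto intro!: derivative_eq_intros)
      have "((\<lambda>y. nderiv n G (x - y)) has_vector_derivative - nderiv (Suc n) G (x - y)) (at y)"
        using vector_diff_chain_at[OF 1 smooth1D[OF sG]] by (simp add: o_def)
      from has_vector_derivative_mult[OF smooth1D[OF sg, of 0] this]
      show ?thesis by (simp add: KD_def KY_def)
    qed
    show "\<bar>x\<bar> ^ m * norm (KD n y x) * (1 + y\<^sup>2)\<^sup>2 \<le> Q n m" for n m y x
      unfolding KD_def by (rule order_trans[OF conv_weight_bound[OF g M(2)] Q(1)])
    show "\<bar>x\<bar> ^ m * norm (KY n y x) * (1 + y\<^sup>2)\<^sup>2 \<le> Q n m" for n m y x
    proof -
      have "\<bar>x\<bar> ^ m * norm (KY n y x) * (1 + y\<^sup>2)\<^sup>2 \<le>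
          \<bar>x\<bar> ^ m * (norm (g y * nderiv (Suc n) G (x - y))
              + norm (nderiv 1 g y * nderiv n G (x - y))) * (1 + y\<^sup>2)\<^sup>2"
        unfolding KY_def by (intro mult_right_mono mult_left_mono norm_triangle_le) (auto
            simp: norm_mult)
      also have "\<dots> = \<bar>x\<bar> ^ m * norm (g y * nderiv (Suc n) G (x - y)) * (1 + y\<^sup>2)\<^sup>2
          + \<bar>x\<bar> ^ m * norm (nderiv 1 g y * nderiv n G (x - y)) * (1 + y\<^sup>2)\<^sup>2"
        by (simp add: algebra_simps)
      also have "\<dots> \<le> conv_weight N ?M1 n m + conv_weight ?N1 M n m"
      proof (rule add_mono)
        have "nderiv n (nderiv 1 G) = nderiv (Suc n) G"
          using nderiv_eqI[of "\<lambda>n. nderiv (Suc n) G" n] smooth1D[OF sG] by simp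
        then show "\<bar>x\<bar> ^ m * norm (g y * nderiv (Suc n) G (x - y)) * (1 + y\<^sup>2)\<^sup>2 \<le> conv_weight N ?M1 n m"
          using conv_weight_bound[OF g bnd_nderiv[OF M(2)], of x m y n] by simp
        show "\<bar>x\<bar> ^ m * norm (nderiv 1 g y * nderiv n G (x - y)) * (1 + y\<^sup>2)\<^sup>2 \<le> conv_weight ?N1 M n m"
          by (rule conv_weight_bound[OF bnd_nderiv[OF g] M(2)])
      qed
      also have "\<dots> \<le> Q n m" by (rule Q)
      finally show ?thesis .
    qed
    show "adm Q" by (rule aQ)
    show "u (KD 0 y) = 0" for y
    proof -
      \<comment> \<open>Expanding the square in \<open>G (x - y)\<close> separates a constant
        depending on \<open>y\<close> from a centred narrow Gaussian with a linear exponent, which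
        is the form on which \<open>u\<close> is known to vanish.\<close>
      let ?E = "\<lambda>x. exp (of_real ((r\<^sup>2 * y) * x - (1 + t\<^sup>2) * x\<^sup>2 / 2)) :: complex"
      have "KD 0 y = (\<lambda>x. (g y * exp (of_real (- (r\<^sup>2 * y\<^sup>2 / 2)))) * ?E x)"
      proof
        fix x
        have "G (x - y) = exp (of_real (- (r\<^sup>2 * y\<^sup>2 / 2))) * ?E x"
          unfolding exp_add[symmetric] of_real_add[symmetric] r(1)[symmetric]
          by (simp add: G_def power2_eq_square exp_of_real[symmetric] del: exp_of_real) (simp add:
              algebra_simps diff_divide_distrib add_divide_distrib)
        then show "KD 0 y x = (g y * exp (of_real (- (r\<^sup>2 * y\<^sup>2 / 2)))) * ?E x" by (simp add: KD_def)
      qed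
      moreover have "testfun ?E"
      proof -
        \<comment> \<open>A narrow Gaussian is a dilated unit one, so its membership is inherited
          through \<open>bnd_dilate\<close>.\<close>
        have "?E = (\<lambda>x. gexp (of_real (r * y)) 0 (r * x))"
          unfolding r(1)[symmetric] by (simp add: fun_eq_iff power2_eq_square exp_of_real[symmetric]
              algebra_simps del: exp_of_real)
        moreover obtain L where "adm L" "bnd (gexp (of_real (r * y)) 0) L" by (rule bnd_gexp)
        ultimately show ?thesis
          using testfunI[OF adm_geom bnd_dilate] r1 by metis
      qed
      ultimately show ?thesis
        using u_scale[of ?E] u_narrow_gaussian[OF u0, of "r\<^sup>2 * y" t] by simp
    qed
  qed
  have eq: "\<Psi> = (\<lambda>x. of_real (r / sqrt (2 * pi)) * (\<integral>y. KD 0 y x \<partial>lborel))"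
  proof
    fix x
    \<comment> \<open>The substitution \<open>y = x - v / r\<close> turns the superposition of
      translates of the Gaussian into an average of translates of \<open>g\<close>.\<close>
    have "(\<integral>y. KD 0 y x \<partial>lborel) = (1 / r) *\<^sub>R (\<integral>v. KD 0 (x + (- 1 / r) * v) x \<partial>lborel)"
      using lborel_integral_real_affine[of "- 1 / r" "\<lambda>y. KD 0 y x" x] r by simp
    also have "(\<lambda>v. KD 0 (x + (- 1 / r) * v) x)
        = (\<lambda>v. of_real (sqrt (2 * pi)) * (of_real (std_normal_density v) * g (x - v / r)))"
      using r by (auto simp: fun_eq_iff KD_def G_def std_normal_density_def exp_of_real[symmetric]
          simp del: exp_of_real)
    finally show "\<Psi> x = of_real (r / sqrt (2 * pi)) * (\<integral>y. KD 0 y x \<partial>lborel)"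
      using r by (simp add: \<Psi>_def scaleR_conv_of_real)
  qed
  show "testfun \<Psi>" "u \<Psi> = 0"
    unfolding eq
    using testfun_lin[OF *[THEN conjunct1] *[THEN conjunct1], of "of_real (r / sqrt (2 * pi))" 0]
      u_scale[OF *[THEN conjunct1], of "of_real (r / sqrt (2 * pi))"] *
    by (simp_all only: mult_zero_left mult_zero_right add_0_right)
qed

text \<open>The mollifications differ from \<open>g\<close> by at most the average displacement
  times the next derivative. This is a bound by multiples \<open>C / r j\<close> of one weight,
  which is exactly the convergence \<open>u\<close> respects.\<close>

theorem u_eq_0:
  assumes u0: "\<And>c. u (gexp c 0) = 0" and g: "testfun g"
  shows "u g = 0"
proof -
  obtain N where N: "adm N" "bnd g N" using g by (auto simp: testfun_def)
  have Nn: "0 \<le> N n m" for n m using bnd_nonneg[OF N(2)] .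
  have sg: "smooth1 g" using N(2) by (rule bnd_smooth)
  define w where "w = (\<lambda>v. std_normal_density v * \<bar>v\<bar> * exp (v\<^sup>2 / 8))"
  define C where "C = integral\<^sup>L lborel w"
  have w0: "0 \<le> w v" for v by (simp add: w_def)
  have wint: "integrable lborel w" unfolding w_def by (rule integrable_normal_weight)
  have C0: "0 \<le> C" unfolding C_def using w0 by (intro Bochner_Integration.integral_nonneg)
  \<comment> \<open>The mean value inequality raises the order to \<open>Suc n\<close>. Splitting
    \<open>\<bar>x\<bar> ^ m\<close> between the intermediate point and \<open>v\<close> gives the
    two summands; the second mixes two weights and is the occasion for
    \<open>adm_mix\<close>.\<close>
  define L where "L = (\<lambda>n m. 2 ^ (n + m) * (N (Suc n) m + 2 ^ (n
      + m) * (N (Suc n) 0 * gauss_weight 0 m)))"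
  have "adm (\<lambda>n m. N (Suc n) 0 * gauss_weight 0 m)"
    using adm_mix[OF adm_Suc_left[OF N(1)] adm_gauss] Nn by (auto simp: gauss_weight_def)
  then have L: "adm L"
    unfolding L_def using adm_geom[OF adm_add[OF adm_Suc_left[OF N(1)] adm_geom[of _ 2]], of _ 2] by simp
  \<comment> \<open>The square \<open>1 + j\<^sup>2\<close> is the sharpening that
    \<open>u_narrow_gaussian\<close> supplies for \<open>t = j\<close>.\<close>
  define r where "r = (\<lambda>j. sqrt (1 + (real j)\<^sup>2))"
  have r: "(r j)\<^sup>2 = 1 + (real j)\<^sup>2" "0 < r j" "1 \<le> r j" for j
    by (simp_all add: r_def add_pos_nonneg)
  define H where "H = (\<lambda>j n x v. of_real (std_normal_density v) * nderiv n g (x - v / r j))"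
  define F where "F = (\<lambda>j n x. \<integral>v. H j n x v \<partial>lborel)"
  have dH: "((\<lambda>x. H j n x v) has_vector_derivative H j (Suc n) x v) (at x)" for j n x v
    unfolding H_def
    by (rule has_vector_derivative_mult_right)
      (rule smooth1D[OF smooth1_affine(1)[OF sg, of "v / r j"], of n, unfolded smooth1_affine(2)[OF sg]])
  have mH: "H j n x \<in> borel_measurable lborel" for j n x
    unfolding H_def using smooth1_measurable[OF sg, of n] by measurable
  have nH: "norm (H j n x v) \<le> N n 0 * std_normal_density v" for j n x v
    using mult_left_mono[OF bndD[OF N(2), of "x - v / r j" 0 n], of "std_normal_density v"]
    by (simp add: H_def norm_mult mult.commute)
  note wi = has_vector_derivative_weighted_integral[of "H j" lborel "\<lambda>n. N n 0" std_normal_density for j,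
      OF dH mH nH integrable_normal_density[OF zero_less_one]]
  have pt: "\<bar>x\<bar> ^ m * norm (of_real (std_normal_density v) * nderiv n g x - H j n x v)
      \<le> 1 / r j * L n m * w v"
    for x m v n j
  proof -
    let ?B = "2 ^ (n + m) * (N (Suc n) m + 2 ^ (n
        + m) * (N (Suc n) 0 * gauss_weight 0 m)) * exp (v\<^sup>2 / 8)"
    have e1: "1 \<le> exp (v\<^sup>2 / 8)" by simp
    have vm: "\<bar>v\<bar> ^ m \<le> 2 ^ (n + m) * gauss_weight 0 m * exp (v\<^sup>2 / 8)"
    proof -
      have "\<bar>v\<bar> ^ m \<le> sqrt (fact m) * 2 ^ m * exp (v\<^sup>2 / 8)"
        using power_le_sqrt_fact[of "\<bar>v\<bar>" "1/2" m] by (simp add: power2_eq_square)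
      also have "\<dots> \<le> sqrt (fact m) * 2 ^ (n + m) * exp (v\<^sup>2 / 8)"
        by (intro mult_right_mono mult_left_mono power_increasing) auto
      finally show ?thesis by (simp add: gauss_weight_def ac_simps)
    qed
    have "norm (of_real (\<bar>x\<bar> ^ m) * nderiv n g x - of_real (\<bar>x\<bar> ^ m) * nderiv n g (x - v / r j))
        \<le> ?B * \<bar>x - (x - v / r j)\<bar>"
    proof (rule norm_diff_le_vderiv)
      show "((\<lambda>x'. of_real (\<bar>x\<bar> ^ m) * nderiv n g x') has_vector_derivative of_real (\<bar>x\<bar> ^ m)
          * nderiv (Suc n) g z) (at z)" for z
        by (intro has_vector_derivative_mult_right smooth1D sg)
      fix z assume z: "z \<in> closed_segment (x - v / r j) x"
      have "\<bar>x - z\<bar> \<le> \<bar>v / r j\<bar>"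
        using z by (auto simp: closed_segment_eq_real_ivl simp del: abs_divide split: if_splits)
      then have "\<bar>x\<bar> \<le> \<bar>z\<bar> + \<bar>v / r j\<bar>" by linarith
      moreover have "\<bar>v / r j\<bar> \<le> \<bar>v\<bar>"
        using r[of j] by (simp add: divide_le_eq mult_left_le mult.commute[of
            "\<bar>v\<bar>"] mult_right_mono[of 1 "r j" "\<bar>v\<bar>", simplified])
      ultimately have "\<bar>x\<bar> ^ m \<le> (\<bar>z\<bar> + \<bar>v\<bar>) ^ m" by (intro power_mono) auto
      also have "\<dots> \<le> 2 ^ m * (\<bar>z\<bar> ^ m + \<bar>v\<bar> ^ m)" by (rule power_add_le) auto
      also have "\<dots> \<le> 2 ^ (n + m) * (\<bar>z\<bar> ^ m + \<bar>v\<bar> ^ m)"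
        by (intro mult_right_mono power_increasing) auto
      finally have "\<bar>x\<bar> ^ m * norm (nderiv (Suc n) g z)
          \<le> 2 ^ (n + m) * (\<bar>z\<bar> ^ m + \<bar>v\<bar> ^ m) * norm (nderiv (Suc n) g z)"
        by (rule mult_right_mono) simp
      also have "\<dots> = 2 ^ (n + m) * (\<bar>z\<bar> ^ m * norm (nderiv (Suc n) g z)
          + \<bar>v\<bar> ^ m * (\<bar>z\<bar> ^ 0 * norm (nderiv (Suc n) g z)))"
        by (simp add: algebra_simps)
      also have "\<dots> \<le> 2 ^ (n + m) * (N (Suc n) m + 2 ^ (n
          + m) * gauss_weight 0 m * exp (v\<^sup>2 / 8) * N (Suc n) 0)"
        by (intro mult_left_mono add_mono mult_mono bndD[OF N(2)] vm) (auto simp: gauss_weight_def)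
      also have "\<dots> \<le> 2 ^ (n + m) * (N (Suc n) m * exp (v\<^sup>2 / 8) + 2 ^ (n
          + m) * gauss_weight 0 m * exp (v\<^sup>2 / 8) * N (Suc n) 0)"
        using mult_left_mono[OF e1 Nn[of "Suc n" m]] by (intro mult_left_mono add_right_mono) auto
      also have "\<dots> = ?B" by (simp add: algebra_simps)
      finally show "norm (of_real (\<bar>x\<bar> ^ m) * nderiv (Suc n) g z) \<le> ?B"
          by (simp add: norm_mult norm_power)
    qed
    moreover have "of_real (\<bar>x\<bar> ^ m) * nderiv n g x - of_real (\<bar>x\<bar> ^ m) * nderiv n g (x - v / r j)
        = of_real (\<bar>x\<bar> ^ m) * (nderiv n g x - nderiv n g (x - v / r j))" by (simp add: algebra_simps)
    ultimately have "\<bar>x\<bar> ^ m * norm (nderiv n g x - nderiv n g (x - v / r j)) \<le> ?B * (\<bar>v\<bar> / r j)"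
      using r[of j] by (simp add: norm_mult norm_power)
    from mult_left_mono[OF this normal_density_nonneg[of 0 1 v]] show ?thesis
      unfolding H_def right_diff_distrib[symmetric] norm_mult w_def L_def
      by (simp add: ac_simps)
  qed
  have int_g: "integrable lborel (\<lambda>v. complex_of_real (std_normal_density v) * nderiv n g x)" for n x
    by (intro integrable_mult_left) (simp add: complex_of_real_integrable_eq)
  have Fg: "\<bar>x\<bar> ^ m * norm (nderiv n g x - F j n x) \<le> C / r j * L n m" for x m n j
  proof -
    have "(\<integral>v. complex_of_real (std_normal_density v) * nderiv n g x \<partial>lborel) = nderiv n g x"
      by simp
    then have "of_real (\<bar>x\<bar> ^ m) * (nderiv n g x - F j n x) =
        (\<integral>v. of_real (\<bar>x\<bar> ^ m) * (of_real (std_normal_density v) * nderiv n g x - H j n x v) \<partial>lborel)"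
      unfolding F_def using int_g wi(1) by simp
    also have "norm \<dots> \<le> (\<integral>v. 1 / r j * L n m * w v \<partial>lborel)"
    proof (rule norm_integral_le)
      show "norm (of_real (\<bar>x\<bar> ^ m) * (of_real (std_normal_density v) * nderiv n g x - H j n x v))
          \<le> 1 / r j * L n m * w v" for v
        using pt[of x m v n j] unfolding norm_mult by (simp add: norm_power)
    qed (use int_g wi(1) wint in auto)
    finally show ?thesis by (simp add: norm_mult norm_power C_def ac_simps)
  qed
  show ?thesis
  proof (rule u_eq_0_limit[OF g L])
    show "(\<lambda>j. C / r j) \<longlonglongrightarrow> 0"
      unfolding r_def by real_asymp
    show "0 \<le> C / r j" for j using C0 r[of j] by simp
    show "testfun (F j 0)" "u (F j 0) = 0" for j
      using u_smoothing[OF u0 N r(1,2)] by (simp_all add: F_def H_def)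
    have dF: "(F j n has_vector_derivative F j (Suc n) x) (at x)" for j n x
      unfolding F_def by (rule wi(2))
    show "bnd (\<lambda>x. g x - F j 0 x) (\<lambda>n m. C / r j * L n m)" for j
      using bndI[of "\<lambda>n x. nderiv n g x - F j n x", OF has_vector_derivative_diff[OF
          smooth1D[OF sg] dF] Fg]
      by simp
  qed
qed

end

section \<open>Weights of the Gelfand-Shilov spaces\<close>

definition gs_weight :: "real \<Rightarrow> real \<Rightarrow> real \<Rightarrow> nat \<Rightarrow> nat \<Rightarrow> real" where
  "gs_weight s t h n m = h ^ (n + m) * (fact n powr s * fact m powr t)"

definition gs_bounded :: "real \<Rightarrow> real \<Rightarrow> real \<Rightarrow> (nat \<Rightarrow> nat \<Rightarrow> real) \<Rightarrow> bool" where
  "gs_bounded s t h N \<longleftrightarrow> (\<exists>C\<ge>0. \<forall>n m. N n m \<le> C * gs_weight s t h n m)"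

lemma gs_weight_pos: "0 < h \<Longrightarrow> 0 < gs_weight s t h n m"
  by (simp add: gs_weight_def)

lemma gs_boundedI: "0 \<le> C \<Longrightarrow> (\<And>n m. N n m \<le> C * gs_weight s t h n m) \<Longrightarrow> gs_bounded s t h N"
  by (auto simp: gs_bounded_def)

lemma gs_weight_mono: "0 < h \<Longrightarrow> h \<le> k \<Longrightarrow> gs_weight s t h n m \<le> gs_weight s t k n m"
  by (simp add: gs_weight_def mult_right_mono power_mono)

lemma gs_bounded_mono: "0 < h \<Longrightarrow> h \<le> k \<Longrightarrow> gs_bounded s t h N \<Longrightarrow> gs_bounded s t k N"
  unfolding gs_bounded_def by (meson gs_weight_mono mult_left_mono order_trans)

lemma gs_bounded_add:
  assumes "gs_bounded s t h N" "gs_bounded s t h M"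
  shows "gs_bounded s t h (\<lambda>n m. N n m + M n m)"
proof -
  obtain C D where "0 \<le> C" "0 \<le> D" "\<And>n m. N n m \<le> C * gs_weight s t h n m" "\<And>n m. M n m
      \<le> D * gs_weight s t h n m"
    using assms unfolding gs_bounded_def by auto
  then show ?thesis by (intro gs_boundedI[of "C + D"]) (auto simp: distrib_right intro: add_mono)
qed

lemma gs_bounded_scale:
  assumes "gs_bounded s t h N" "0 \<le> a"
  shows "gs_bounded s t h (\<lambda>n m. a * N n m)"
proof -
  obtain C where "0 \<le> C" "\<And>n m. N n m \<le> C * gs_weight s t h n m"
    using assms unfolding gs_bounded_def by auto
  then show ?thesis using assms(2)
    by (intro gs_boundedI[of "a * C"]) (auto simp: mult.assoc intro: mult_left_mono)
qed

lemma gs_bounded_geom: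
  assumes "gs_bounded s t h N" "1 \<le> A"
  shows "gs_bounded s t (A * h) (\<lambda>n m. A ^ (n + m) * N n m)"
proof -
  obtain C where C: "0 \<le> C" "\<And>n m. N n m \<le> C * gs_weight s t h n m"
    using assms unfolding gs_bounded_def by auto
  show ?thesis
  proof (rule gs_boundedI[OF C(1)])
    fix n m
    have "A ^ (n + m) * N n m \<le> A ^ (n + m) * (C * gs_weight s t h n m)"
      using C(2) assms(2) by (intro mult_left_mono) auto
    then show "A ^ (n + m) * N n m \<le> C * gs_weight s t (A * h) n m"
      by (simp add: gs_weight_def power_mult_distrib ac_simps)
  qed
qed

text \<open>An index shift multiplies a factorial only by \<open>n + 1 \<le> 2 ^ n\<close>, a
  geometric factor that a change of \<open>h\<close> absorbs.\<close>

lemma fact_Suc_powr_le: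
  assumes "0 \<le> s"
  shows "fact (Suc n) powr s \<le> (2 powr s) ^ n * (fact n powr s :: real)"
proof -
  have "Suc n \<le> 2 ^ n" by (induction n) auto
  then have "real (Suc n) \<le> 2 ^ n" by (metis of_nat_le_iff of_nat_numeral of_nat_power)
  then have "real (Suc n) powr s \<le> (2 ^ n) powr s" using assms by (intro powr_mono2) auto
  also have "(2 ^ n :: real) powr s = (2 powr s) ^ n"
    by (simp add: powr_realpow[symmetric] powr_powr mult.commute)
  finally have "real (Suc n) powr s * fact n powr s \<le> (2 powr s) ^ n * fact n powr s"
    by (rule mult_right_mono) simp
  then show ?thesis by (simp add: powr_mult del: of_nat_Suc)
qed

lemma gs_bounded_Suc_left:
  assumes "gs_bounded s t h N" "0 \<le> s" "0 < h"
  shows "gs_bounded s t (2 powr s * h) (\<lambda>n m. N (Suc n) m)"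
proof -
  obtain C where C: "0 \<le> C" "\<And>n m. N n m \<le> C * gs_weight s t h n m"
    using assms unfolding gs_bounded_def by auto
  have p: "1 \<le> 2 powr s" using assms(2) by (simp add: ge_one_powr_ge_zero)
  show ?thesis
  proof (rule gs_boundedI[of "C * h"])
    show "0 \<le> C * h" using C assms by simp
    fix n m
    have "N (Suc n) m \<le> C * (h ^ (Suc n + m) * (fact (Suc n) powr s * fact m powr t))"
      using C(2)[of "Suc n" m] by (simp add: gs_weight_def)
    also have "\<dots> \<le> C * (h ^ (Suc n + m) * ((2 powr s) ^ (n + m) * fact n powr s * fact m powr t))"
    proof (intro mult_left_mono mult_right_mono C(1))
      have "fact (Suc n) powr s \<le> (2 powr s) ^ n * (fact n powr s :: real)"
          by (rule fact_Suc_powr_le[OF assms(2)])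
      also have "\<dots> \<le> (2 powr s) ^ (n + m) * (fact n powr s :: real)"
        using p by (intro mult_right_mono power_increasing) auto
      finally show "fact (Suc n) powr s \<le> (2 powr s) ^ (n + m) * (fact n powr s :: real)" .
    qed (use assms in auto)
    finally show "N (Suc n) m \<le> C * h * gs_weight s t (2 powr s * h) n m"
      by (simp add: gs_weight_def power_mult_distrib ac_simps)
  qed
qed

lemma gs_bounded_swap: "gs_bounded s t h N \<longleftrightarrow> gs_bounded t s h (\<lambda>n m. N m n)"
proof -
  have "gs_weight s t h n m = gs_weight t s h m n" for n m
    by (simp add: gs_weight_def ac_simps)
  then show ?thesis unfolding gs_bounded_def by metis
qed

lemma gs_bounded_Suc_right:
  assumes "gs_bounded s t h N" "0 \<le> t" "0 < h"
  shows "gs_bounded s t (2 powr t * h) (\<lambda>n m. N n (Suc m))"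
  using gs_bounded_Suc_left[of t s h "\<lambda>n m. N m n"] assms gs_bounded_swap[of s t] by auto

text \<open>The weight is a product of a factor in \<open>n\<close> and a factor in
  \<open>m\<close>, so bounds on pure derivatives and on pure decay combine at the same
  \<open>h\<close>.\<close>

lemma gs_bounded_mix:
  assumes N: "gs_bounded s t h N" "\<And>n m. 0 \<le> N n m" and M: "gs_bounded s t h M" "\<And>n m. 0 \<le> M n m"
      and h: "0 < h"
  shows "gs_bounded s t h (\<lambda>n m. N n 0 * M 0 m)"
proof -
  obtain C where C: "0 \<le> C" "\<And>n m. N n m \<le> C * gs_weight s t h n m"
    using N unfolding gs_bounded_def by auto
  obtain D where D: "0 \<le> D" "\<And>n m. M n m \<le> D * gs_weight s t h n m"
    using M unfolding gs_bounded_def by auto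
  show ?thesis
  proof (rule gs_boundedI[of "C * D"])
    fix n m
    have "N n 0 * M 0 m \<le> (C * gs_weight s t h n 0) * (D * gs_weight s t h 0 m)"
      using C D N M gs_weight_pos[OF h] by (intro mult_mono C D) (auto simp: less_imp_le)
    then show "N n 0 * M 0 m \<le> C * D * gs_weight s t h n m"
      by (simp add: gs_weight_def power_add ac_simps)
  qed (use C D in auto)
qed

text \<open>The surplus \<open>fact n powr (s - 1/2)\<close> outgrows every geometric sequence, so
  even a small \<open>h\<close> is compensated. This is where the strict inequality
  \<open>s > 1/2\<close> enters.\<close>

lemma sqrt_fact_le_powr:
  fixes h :: real
  assumes "1/2 < s" "0 < h"
  shows "\<exists>C\<ge>0. \<forall>n. sqrt (fact n) \<le> C * (h ^ n * fact n powr s)"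
proof -
  define d where "d = s - 1/2"
  \<comment> \<open>Chosen so that \<open>x powr d = 1 / h\<close>; one term of the exponential
    series at \<open>x\<close>, raised to the power \<open>d\<close>, then gives the
    estimate.\<close>
  define x where "x = h powr (- 1 / d)"
  have d: "0 < d" using assms by (simp add: d_def)
  have x: "0 < x" using assms by (simp add: x_def)
  show ?thesis
  proof (intro exI[of _ "exp x powr d"] conjI allI)
    fix n
    have "x ^ n / fact n \<le> exp x" by (rule power_div_fact_le_exp) (use x in simp)
    then have "x ^ n \<le> exp x * fact n" by (simp add: field_simps)
    then have "(x ^ n) powr d \<le> (exp x * fact n) powr d" using x d by (intro powr_mono2) auto
    also have "(x ^ n) powr d = (x powr d) ^ n" using x
        by (simp add: powr_realpow[symmetric] powr_powr mult.commute)
    also have "x powr d = 1 / h" unfolding x_def powr_powr using d assms by (simp add: powr_minus_divide)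
    finally have a: "(1 / h) ^ n \<le> exp x powr d * fact n powr d" by (simp add: powr_mult)
    have "sqrt (fact n) = h ^ n * ((1 / h) ^ n * fact n powr (1/2))"
      using assms by (simp add: powr_half_sqrt power_divide)
    also have "\<dots> \<le> h ^ n * (exp x powr d * fact n powr d * fact n powr (1/2))"
      using assms by (intro mult_left_mono mult_right_mono a) auto
    also have "\<dots> = exp x powr d * (h ^ n * fact n powr (d + 1/2))" by (simp add: powr_add)
    finally show "sqrt (fact n) \<le> exp x powr d * (h ^ n * fact n powr s)" by (simp add: d_def)
  qed simp
qed

lemma gs_bounded_gauss:
  assumes "1/2 < s" "1/2 < t" "0 < h"
  shows "gs_bounded s t h gauss_weight"
proof -
  obtain C where C: "0 \<le> C" "\<And>n. sqrt (fact n) \<le> C * (h ^ n * fact n powr s)"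
    using sqrt_fact_le_powr[OF assms(1,3)] by auto
  obtain D where D: "0 \<le> D" "\<And>n. sqrt (fact n) \<le> D * (h ^ n * fact n powr t)"
    using sqrt_fact_le_powr[OF assms(2,3)] by auto
  show ?thesis
  proof (rule gs_boundedI[of "C * D"])
    fix n m
    have "gauss_weight n m \<le> (C * (h ^ n * fact n powr s)) * (D * (h ^ m * fact m powr t))"
      unfolding gauss_weight_def using C(1) assms by (intro mult_mono C(2) D(2)) auto
    then show "gauss_weight n m \<le> C * D * gs_weight s t h n m"
      by (simp add: gs_weight_def power_add ac_simps)
  qed (use C D in auto)
qed

section \<open>Admissible weights for the inductive and projective limits\<close>

definition gs_adm :: "real \<Rightarrow> real \<Rightarrow> (nat \<Rightarrow> nat \<Rightarrow> real) \<Rightarrow> bool" where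
  "gs_adm s t N \<longleftrightarrow> (\<exists>h>0. gs_bounded s t h N)"

definition sigma_adm :: "real \<Rightarrow> real \<Rightarrow> (nat \<Rightarrow> nat \<Rightarrow> real) \<Rightarrow> bool" where
  "sigma_adm s t N \<longleftrightarrow> (\<forall>h>0. gs_bounded s t h N)"

text \<open>For Schwartz functions the bounds only have to be finite, so no growth condition
  remains.\<close>

lemma weight_class_all: "weight_class (\<lambda>_. True)"
  by unfold_locales auto

lemma weight_class_gs:
  assumes "1/2 < s" "1/2 < t"
  shows "weight_class (gs_adm s t)"
proof
  have common: "\<exists>h>0. gs_bounded s t h N \<and> gs_bounded s t h M" if NM: "gs_adm s t N"
      "gs_adm s t M" for N M
  proof -
    obtain h k where "0 < h" "0 < k" "gs_bounded s t h N" "gs_bounded s t k M"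
      using NM by (auto simp: gs_adm_def)
    then show ?thesis
      by (intro exI[of _ "max h k"]) (auto intro: gs_bounded_mono[of h] gs_bounded_mono[of k])
  qed
  fix N M
  show "gs_adm s t (\<lambda>n m. N n m + M n m)" if "gs_adm s t N" "gs_adm s t M"
    using common[OF that] gs_bounded_add by (auto simp: gs_adm_def)
  show "gs_adm s t (\<lambda>n m. N n 0 * M 0 m)" if "gs_adm s t N" "gs_adm s t M" "\<And>n m. 0
      \<le> N n m" "\<And>n m. 0 \<le> M n m"
    using common[OF that(1,2)] gs_bounded_mix that(3,4) unfolding gs_adm_def by metis
  show "gs_adm s t (\<lambda>n m. a * N n m)" if "gs_adm s t N" "0 \<le> a" for a
    using that gs_bounded_scale unfolding gs_adm_def by blast
  show "gs_adm s t (\<lambda>n m. A ^ (n + m) * N n m)" if N: "gs_adm s t N" "1 \<le> A" for A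
  proof -
    obtain h where "0 < h" "gs_bounded s t h N" using N by (auto simp: gs_adm_def)
    then have "0 < A * h" "gs_bounded s t (A * h) (\<lambda>n m. A ^ (n + m) * N n m)"
      using N(2) gs_bounded_geom by auto
    then show ?thesis unfolding gs_adm_def by blast
  qed
  show "gs_adm s t (\<lambda>n m. N (Suc n) m)" "gs_adm s t (\<lambda>n m. N n (Suc m))" if N: "gs_adm s t N"
  proof -
    obtain h where h: "0 < h" "gs_bounded s t h N" using N by (auto simp: gs_adm_def)
    have "0 < 2 powr s * h" "gs_bounded s t (2 powr s * h) (\<lambda>n m. N (Suc n) m)"
      using h gs_bounded_Suc_left assms by auto
    then show "gs_adm s t (\<lambda>n m. N (Suc n) m)" unfolding gs_adm_def by blast
    have "0 < 2 powr t * h" "gs_bounded s t (2 powr t * h) (\<lambda>n m. N n (Suc m))"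
      using h gs_bounded_Suc_right assms by auto
    then show "gs_adm s t (\<lambda>n m. N n (Suc m))" unfolding gs_adm_def by blast
  qed
  show "gs_adm s t gauss_weight"
    using gs_bounded_gauss[OF assms, of 1] unfolding gs_adm_def by (intro exI[of _ 1]) simp
qed

text \<open>Here \<open>h\<close> is prescribed and may not grow; each loss of a geometric factor is
  undone by starting from a correspondingly smaller \<open>h\<close>.\<close>

lemma weight_class_sigma:
  assumes "1/2 < s" "1/2 < t"
  shows "weight_class (sigma_adm s t)"
proof
  fix N M
  show "sigma_adm s t (\<lambda>n m. N n m + M n m)" if "sigma_adm s t N" "sigma_adm s t M"
    using that gs_bounded_add unfolding sigma_adm_def by blast
  show "sigma_adm s t (\<lambda>n m. N n 0 * M 0 m)" if "sigma_adm s t N" "sigma_adm s t M" "\<And>n m. 0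
      \<le> N n m" "\<And>n m. 0 \<le> M n m"
    using that gs_bounded_mix unfolding sigma_adm_def by metis
  show "sigma_adm s t (\<lambda>n m. a * N n m)" if "sigma_adm s t N" "0 \<le> a" for a
    using that gs_bounded_scale unfolding sigma_adm_def by blast
  show "sigma_adm s t (\<lambda>n m. A ^ (n + m) * N n m)" if "sigma_adm s t N" "1 \<le> A" for A
    unfolding sigma_adm_def
  proof (intro allI impI)
    fix h :: real assume "0 < h"
    then show "gs_bounded s t h (\<lambda>n m. A ^ (n + m) * N n m)"
      using gs_bounded_geom[of s t "h / A" N A] that by (auto simp: sigma_adm_def)
  qed
  show "sigma_adm s t (\<lambda>n m. N (Suc n) m)" if "sigma_adm s t N"
    unfolding sigma_adm_def
  proof (intro allI impI)
    fix h :: real assume "0 < h"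
    then show "gs_bounded s t h (\<lambda>n m. N (Suc n) m)"
      using gs_bounded_Suc_left[of s t "h / 2 powr s" N] that assms by (auto simp: sigma_adm_def)
  qed
  show "sigma_adm s t (\<lambda>n m. N n (Suc m))" if "sigma_adm s t N"
    unfolding sigma_adm_def
  proof (intro allI impI)
    fix h :: real assume "0 < h"
    then show "gs_bounded s t h (\<lambda>n m. N n (Suc m))"
      using gs_bounded_Suc_right[of s t "h / 2 powr t" N] that assms by (auto simp: sigma_adm_def)
  qed
  show "sigma_adm s t gauss_weight"
    using gs_bounded_gauss[OF assms] by (simp add: sigma_adm_def)
qed

section \<open>Functions of several variables\<close>

lemma ex_list_count: "\<exists>is :: 'n::finite list. \<forall>i. count_list is i = \<alpha> i"
proof -
  obtain xs where "mset xs = Abs_multiset \<alpha>" using ex_mset by blast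
  then have "count (mset xs) i = \<alpha> i" for i by (simp add: Abs_multiset_inverse)
  then show ?thesis by (auto simp: count_mset)
qed

lemma multi_deriv_list:
  "\<exists>is. (\<forall>i. count_list is i = \<alpha> i) \<and> (\<forall>f. multi_deriv \<alpha> f = iter_partial is f)"
proof (intro exI conjI)
  show "\<forall>i. count_list (SOME is. \<forall>i. count_list is i = \<alpha> i) i = \<alpha> i" by (rule someI_ex[OF ex_list_count])
qed (simp add: multi_deriv_def)

definition single_index :: "'n \<Rightarrow> nat \<Rightarrow> 'n \<Rightarrow> nat" where
  "single_index k n = (\<lambda>i. if i = k then n else 0)"

text \<open>A list in which only \<open>k\<close> occurs, and occurs \<open>n\<close> times, is
  unique, so along one axis the choice made in \<open>multi_deriv\<close> disappears.\<close>

lemma multi_deriv_single_index: "multi_deriv (single_index k n) f = iter_partial (replicate n k) f"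
proof -
  obtain "is" where l: "\<And>i. count_list is i = single_index k n i"
      "\<And>f. multi_deriv (single_index k n) f = iter_partial is f"
    using multi_deriv_list[of "single_index k n"] by blast
  have "set is \<subseteq> {k}"
  proof
    fix i assume "i \<in> set is"
    then have "count_list is i \<noteq> 0" by (simp add: count_list_0_iff)
    then show "i \<in> {k}" using l(1)[of i] by (auto simp: single_index_def split: if_splits)
  qed
  then have r: "is = replicate (length is) k" by (intro replicate_eqI) auto
  have "count_list (replicate m k) k = m" for m by (induction m) auto
  then have "length is = n" using l(1)[of k] r by (metis single_index_def)
  then show ?thesis using l(2) r by metis
qed

lemma multi_abs_single [simp]: "multi_abs (single_index k n) = n"
  and multi_fact_single [simp]: "multi_fact (single_index k n) = fact n"
  and multi_power_single [simp]: "multi_power x (single_index k n) = (x $ k) ^ n"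
proof -
  have "(\<Prod>i\<in>UNIV. (fact (single_index k n i) :: real)) = (\<Prod>i\<in>UNIV. if i = k then fact n else 1)"
    by (rule prod.cong) (auto simp: single_index_def)
  then show "multi_fact (single_index k n) = fact n" by (simp add: multi_fact_def)
  have "(\<Prod>i\<in>UNIV. (x $ i) ^ single_index k n i) = (\<Prod>i\<in>UNIV. if i = k then (x $ k) ^ n else 1)"
    by (rule prod.cong) (auto simp: single_index_def)
  then show "multi_power x (single_index k n) = (x $ k) ^ n" by (simp add: multi_power_def)
qed (simp add: multi_abs_def single_index_def)

section \<open>Tensor products of functions of one variable\<close>

definition tens :: "('n::finite \<Rightarrow> real \<Rightarrow> complex) \<Rightarrow> real^'n \<Rightarrow> complex" where
  "tens g x = (\<Prod>i\<in>UNIV. g i (x $ i))"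

lemma tens_derivative:
  assumes "\<And>i. smooth1 (g i)"
  shows "tens g differentiable (at x)" "partial_deriv k (tens g) x = tens (g(k := nderiv 1 (g k))) x"
proof -
  let ?D = "\<lambda>v. \<Sum>i\<in>UNIV. (v $ i) *\<^sub>R nderiv 1 (g i) (x $ i) * (\<Prod>j\<in>UNIV - {i}. g j (x $ j))"
  have "((\<lambda>x. g i (x $ i)) has_derivative (\<lambda>v. (v $ i) *\<^sub>R nderiv 1 (g i) (x $ i))) (at x)" for i
  proof -
    have 1: "((\<lambda>x. x $ i) has_derivative (\<lambda>v. v $ i)) (at x)"
      by (rule bounded_linear_imp_has_derivative) (rule bounded_linear_vec_nth)
    have 2: "(g i has_derivative (\<lambda>h. h *\<^sub>R nderiv 1 (g i) (x $ i))) (at (x $ i))"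
      using smooth1D[OF assms, of 0 i "x $ i"] by (simp add: has_vector_derivative_def)
    show ?thesis using has_derivative_compose[OF 1 2] by simp
  qed
  then have D: "(tens g has_derivative ?D) (at x)"
    unfolding tens_def[abs_def] by (intro has_derivative_prod) auto
  then show "tens g differentiable (at x)" by (auto simp: differentiable_def)
  have "partial_deriv k (tens g) x = ?D (axis k 1)"
    unfolding partial_deriv_def frechet_derivative_at[OF D, symmetric] ..
  also have "\<dots> = (\<Sum>i\<in>UNIV. if i = k then nderiv 1 (g k) (x $ k) * (\<Prod>j\<in>UNIV - {k}. g j (x $ j)) else 0)"
    by (rule sum.cong) (auto simp: axis_def)
  also have "\<dots> = nderiv 1 (g k) (x $ k) * (\<Prod>j\<in>UNIV - {k}. g j (x $ j))" by simp
  also have "\<dots> = tens (g(k := nderiv 1 (g k))) x"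
    unfolding tens_def by (subst prod.remove[of UNIV k]) auto
  finally show "partial_deriv k (tens g) x = tens (g(k := nderiv 1 (g k))) x" .
qed

text \<open>Each partial derivative acts on its own factor, so only the number of occurrences in the
  list matters. For tensor products the order of differentiation is therefore immaterial without any
  theorem on symmetry of derivatives.\<close>

lemma iter_partial_tens:
  assumes "\<And>i. smooth1 (g i)"
  shows "iter_partial is (tens g) = tens (\<lambda>i. nderiv (count_list is i) (g i))"
proof (induction "is")
  case Nil show ?case by (simp add: iter_partial_def)
next
  case (Cons k "is")
  let ?g = "\<lambda>i. nderiv (count_list is i) (g i)"
  have s: "smooth1 (?g i)" for i using assms by (rule smooth1_nderiv)
  have "iter_partial (k # is) (tens g) = partial_deriv k (tens ?g)"
    using Cons by (simp add: iter_partial_def)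
  also have "\<dots> = tens (?g(k := nderiv 1 (?g k)))" using tens_derivative(2)[of ?g, OF s] by blast
  also have "?g(k := nderiv 1 (?g k)) = (\<lambda>i. nderiv (count_list (k # is) i) (g i))"
    by (auto simp: fun_eq_iff nderiv_Suc)
  finally show ?case .
qed

lemma smooth_fun_tens: "(\<And>i. smooth1 (g i)) \<Longrightarrow> smooth_fun (tens g)"
  unfolding smooth_fun_def by (simp add: iter_partial_tens tens_derivative(1) smooth1_nderiv)

lemma multi_deriv_tens:
  assumes "\<And>i. smooth1 (g i)"
  shows "multi_deriv \<alpha> (tens g) = tens (\<lambda>i. nderiv (\<alpha> i) (g i))"
proof -
  obtain "is" where l: "\<And>i. count_list is i = \<alpha> i" "\<And>f. multi_deriv \<alpha> f = iter_partial is f"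
    using multi_deriv_list[of \<alpha>] by blast
  show ?thesis unfolding l(2) iter_partial_tens[OF assms] l(1) ..
qed

abbreviation weighted_deriv :: "('n::finite \<Rightarrow> nat) \<Rightarrow> ('n \<Rightarrow> nat) \<Rightarrow> (real^'n \<Rightarrow> complex) \<Rightarrow> real^'n
    \<Rightarrow> real" where
  "weighted_deriv \<alpha> \<beta> f x \<equiv> norm (of_real (multi_power x \<beta>) * multi_deriv \<alpha> f x)"

lemma weighted_deriv_tens:
  assumes "\<And>i. bnd (g i) (N i)"
  shows "weighted_deriv \<alpha> \<beta> (tens g) x \<le> (\<Prod>i\<in>UNIV. N i (\<alpha> i) (\<beta> i))"
proof -
  have "norm (multi_power x \<beta>) = (\<Prod>i\<in>UNIV. \<bar>x $ i\<bar> ^ \<beta> i)"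
    by (simp add: multi_power_def abs_prod power_abs)
  then have "weighted_deriv \<alpha> \<beta> (tens g) x = (\<Prod>i\<in>UNIV. \<bar>x $ i\<bar> ^ \<beta> i
      * norm (nderiv (\<alpha> i) (g i) (x $ i)))"
    by (simp add: multi_deriv_tens[OF bnd_smooth[OF assms]] tens_def norm_mult prod_norm[symmetric]
        prod.distrib)
  also have "\<dots> \<le> (\<Prod>i\<in>UNIV. N i (\<alpha> i) (\<beta> i))"
    by (intro prod_mono conjI bndD assms) auto
  finally show ?thesis .
qed

section \<open>Restriction to coordinate lines and functions on \<open>real^1\<close>\<close>

definition upd :: "real^'n \<Rightarrow> 'n::finite \<Rightarrow> real \<Rightarrow> real^'n" where
  "upd y k x = (\<chi> i. if i = k then x else y $ i)"

lemma upd_nth [simp]: "upd y k x $ i = (if i = k then x else y $ i)"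
  by (simp add: upd_def)

lemma smooth_fun_line:
  assumes "smooth_fun f"
  shows "((\<lambda>x. iter_partial (replicate n k) f (upd y k x)) has_vector_derivative
    iter_partial (replicate (Suc n) k) f (upd y k x)) (at x)"
proof -
  let ?F = "iter_partial (replicate n k) f"
  have eq: "upd y k = (\<lambda>x. (\<chi> i. if i = k then 0 else y $ i) + x *\<^sub>R axis k 1)"
    by (auto simp: fun_eq_iff vec_eq_iff axis_def)
  have 1: "(upd y k has_derivative (\<lambda>h. h *\<^sub>R axis k 1)) (at x)"
    unfolding eq by (auto intro!: derivative_eq_intros)
  have 2: "(?F has_derivative frechet_derivative ?F (at (upd y k x))) (at (upd y k x))"
    using assms unfolding smooth_fun_def frechet_derivative_works by blast
  interpret F: bounded_linear "frechet_derivative ?F (at (upd y k x))"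
    using 2 by (rule has_derivative_bounded_linear)
  show ?thesis
    using has_derivative_compose[OF 1 2] F.scaleR
    unfolding has_vector_derivative_def replicate_Suc iter_partial_def foldr.simps o_apply
        partial_deriv_def by simp
qed

lemma smooth_fun_continuous: "smooth_fun f \<Longrightarrow> continuous_on UNIV (iter_partial is f)"
  unfolding smooth_fun_def
  by (meson continuous_at_imp_continuous_on differentiable_imp_continuous_within)

lemma upd_one: "upd y (1 :: 1) x = vec x"
  by (simp add: vec_eq_iff)

lemma vec_nth_one [simp]: "vec (x $ (1 :: 1)) = x"
  by (simp add: vec_eq_iff)

lemma tens_one: "tens (\<lambda>_. g) = (\<lambda>x. g (x $ (1 :: 1)))"
  by (auto simp: tens_def fun_eq_iff UNIV_1)

lemma
  fixes f :: "real^1 \<Rightarrow> complex"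
  assumes "smooth_fun f"
  shows smooth1_vec: "smooth1 (\<lambda>x. f (vec x))"
    and nderiv_vec: "nderiv n (\<lambda>x. f (vec x)) x = multi_deriv (single_index 1 n) f (vec x)"
proof -
  let ?G = "\<lambda>n x. iter_partial (replicate n 1) f (vec x)"
  have *: "(?G n has_vector_derivative ?G (Suc n) x) (at x)" for n x
    using smooth_fun_line[OF assms, of n 1 0 x] by (simp add: upd_one)
  have 0: "?G 0 = (\<lambda>x. f (vec x))" by (simp add: iter_partial_def)
  show "smooth1 (\<lambda>x. f (vec x))" using smooth1I[of ?G, OF *] unfolding 0 .
  show "nderiv n (\<lambda>x. f (vec x)) x = multi_deriv (single_index 1 n) f (vec x)"
    using nderiv_eqI[of ?G, OF *] unfolding 0 multi_deriv_single_index by metis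
qed

lemma bnd_vec:
  fixes f :: "real^1 \<Rightarrow> complex"
  assumes "smooth_fun f" and "\<And>n m x. weighted_deriv (single_index 1 n) (single_index 1 m) f x \<le> N n m"
  shows "bnd (\<lambda>x. f (vec x)) N"
  unfolding bnd_def
proof (intro conjI allI smooth1_vec assms)
  show "\<bar>x\<bar> ^ m * norm (nderiv n (\<lambda>x. f (vec x)) x) \<le> N n m" for n m x
    using assms(2)[where n = n and m = m and x = "vec x"]
        by (simp add: nderiv_vec[OF assms(1)] norm_mult norm_power)
qed

lemma
  assumes "bnd g N"
  shows smooth_fun_nth: "smooth_fun (\<lambda>x. g (x $ (1 :: 1)))"
    and weighted_deriv_nth: "weighted_deriv \<alpha> \<beta> (\<lambda>x. g (x $ (1 :: 1))) x \<le> N (\<alpha> 1) (\<beta> 1)"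
  using smooth_fun_tens[of "\<lambda>_ :: 1. g"] weighted_deriv_tens[where g = "\<lambda>_ :: 1. g"
      and N = "\<lambda>_. N"] bnd_smooth[OF assms] assms
  by (simp_all add: tens_one UNIV_1)

text \<open>Membership in the intersection over all \<open>h\<close> gives one weight for each
  \<open>h\<close>, whereas a test function needs a single weight valid for all of them. The
  pointwise smallest one serves every \<open>h\<close>.\<close>

definition opt_weight :: "(real \<Rightarrow> complex) \<Rightarrow> nat \<Rightarrow> nat \<Rightarrow> real" where
  "opt_weight g n m = (SUP x. \<bar>x\<bar> ^ m * norm (nderiv n g x))"

lemma bnd_opt_weight:
  assumes "smooth1 g" "\<And>n m. \<exists>C. \<forall>x. \<bar>x\<bar> ^ m * norm (nderiv n g x) \<le> C"
  shows "bnd g (opt_weight g)"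
  unfolding bnd_def opt_weight_def
proof (intro conjI allI assms cSUP_upper)
  show "bdd_above (range (\<lambda>x. \<bar>x\<bar> ^ m * norm (nderiv n g x)))" for n m
    using assms(2)[of m n] by (auto simp: bdd_above_def)
qed simp

lemma opt_weight_le: "bnd g N \<Longrightarrow> opt_weight g n m \<le> N n m"
  unfolding opt_weight_def by (rule cSUP_least) (auto simp: bndD)

section \<open>The spaces expressed through weighted derivatives\<close>

definition gs_multi_weight :: "real \<Rightarrow> real \<Rightarrow> real \<Rightarrow> ('n::finite \<Rightarrow> nat) \<Rightarrow> ('n \<Rightarrow> nat) \<Rightarrow> real" where
  "gs_multi_weight s t h \<alpha> \<beta> = h ^ (multi_abs \<alpha>
      + multi_abs \<beta>) * multi_fact \<alpha> powr s * multi_fact \<beta> powr t"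

lemma multi_fact_pos: "0 < multi_fact \<alpha>"
  by (simp add: multi_fact_def prod_pos)

lemma gs_multi_weight_pos: "0 < h \<Longrightarrow> 0 < gs_multi_weight s t h \<alpha> \<beta>"
  using multi_fact_pos[of \<alpha>] multi_fact_pos[of \<beta>] by (simp add: gs_multi_weight_def)

lemma gs_multi_weight_prod: "gs_multi_weight s t h \<alpha> \<beta> = (\<Prod>i\<in>UNIV. gs_weight s t h (\<alpha> i) (\<beta> i))"
  by (simp add: gs_multi_weight_def gs_weight_def multi_abs_def multi_fact_def prod.distrib power_add
      power_sum prod_powr_distrib)

lemma gs_multi_weight_single [simp]: "gs_multi_weight s t h (single_index k n) (single_index k m)
    = gs_weight s t h n m"
  by (simp add: gs_multi_weight_def gs_weight_def)

lemma gs_multi_weight_one: "gs_multi_weight s t h \<alpha> \<beta> = gs_weight s t h (\<alpha> (1 :: 1)) (\<beta> 1)"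
  by (simp add: gs_multi_weight_prod UNIV_1)

lemma GS_quotient_le_iff:
  "0 < h \<Longrightarrow> GS_quotient s t h f (\<alpha>, \<beta>, x) \<le> C \<longleftrightarrow> weighted_deriv \<alpha> \<beta> f x \<le> C * gs_multi_weight s t h \<alpha> \<beta>"
  using gs_multi_weight_pos[of h s t \<alpha> \<beta>] by (simp add: GS_quotient_def gs_multi_weight_def
      pos_divide_le_eq)

lemma GS_stepI:
  assumes "0 < h" "smooth_fun f" "\<And>\<alpha> \<beta> x. weighted_deriv \<alpha> \<beta> f x \<le> C * gs_multi_weight s t h \<alpha> \<beta>"
  shows "f \<in> GS_step s t h" "GS_norm s t h f \<le> C"
proof -
  have "GS_quotient s t h f p \<le> C" for p
    using assms GS_quotient_le_iff[of h s t f] by (cases p) auto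
  then show "f \<in> GS_step s t h" "GS_norm s t h f \<le> C"
    using assms(2) by (auto simp: GS_step_def GS_norm_def intro!: cSUP_least bdd_aboveI2)
qed

lemma GS_stepD:
  assumes "0 < h" "f \<in> GS_step s t h"
  shows "smooth_fun f" "weighted_deriv \<alpha> \<beta> f x \<le> GS_norm s t h f * gs_multi_weight s t h \<alpha> \<beta>"
proof -
  show "smooth_fun f" using assms by (simp add: GS_step_def)
  have "GS_quotient s t h f (\<alpha>, \<beta>, x) \<le> GS_norm s t h f"
    unfolding GS_norm_def using assms by (intro cSUP_upper) (auto simp: GS_step_def)
  then show "weighted_deriv \<alpha> \<beta> f x \<le> GS_norm s t h f * gs_multi_weight s t h \<alpha> \<beta>"
    using GS_quotient_le_iff[OF assms(1)] by blast
qed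

lemma GS_norm_nonneg:
  fixes f :: "real^'n::finite \<Rightarrow> complex"
  assumes "0 < h" "f \<in> GS_step s t h"
  shows "0 \<le> GS_norm s t h f"
proof -
  have "0 \<le> GS_norm s t h f * gs_multi_weight s t h (\<lambda>_ :: 'n. 0) (\<lambda>_. 0)"
    by (rule order_trans[OF norm_ge_zero GS_stepD(2)[OF assms]])
  then show ?thesis
    using gs_multi_weight_pos[OF assms(1), of s t "\<lambda>_ :: 'n. 0" "\<lambda>_. 0"]
    by (simp add: zero_le_mult_iff)
qed

lemma GS_step_vec:
  fixes f :: "real^1 \<Rightarrow> complex"
  assumes "0 < h" "f \<in> GS_step s t h"
  shows "bnd (\<lambda>x. f (vec x)) (\<lambda>n m. GS_norm s t h f * gs_weight s t h n m)"
  using GS_stepD(2)[OF assms, where \<alpha> = "single_index 1 n" and \<beta> = "single_index 1 m" for n m]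
  by (intro bnd_vec GS_stepD(1)[OF assms]) simp

lemma GS_step_nth:
  assumes "0 < h" "bnd g (\<lambda>n m. C * gs_weight s t h n m)"
  shows "(\<lambda>x. g (x $ (1 :: 1))) \<in> GS_step s t h" "GS_norm s t h (\<lambda>x. g (x $ (1 :: 1))) \<le> C"
  using GS_stepI[OF assms(1) smooth_fun_nth[OF assms(2)], of C s t] weighted_deriv_nth[OF assms(2)]
  by (simp_all add: gs_multi_weight_one)

lemma schwartzI:
  assumes "smooth_fun f" "\<And>\<alpha> \<beta> x. weighted_deriv \<alpha> \<beta> f x \<le> C \<alpha> \<beta>"
  shows "f \<in> schwartz" "schwartz_seminorm \<alpha> \<beta> f \<le> C \<alpha> \<beta>"
  using assms by (auto simp: schwartz_def schwartz_seminorm_def intro!: cSUP_least bdd_aboveI2)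

lemma schwartzD:
  assumes "f \<in> schwartz"
  shows "smooth_fun f" "weighted_deriv \<alpha> \<beta> f x \<le> schwartz_seminorm \<alpha> \<beta> f"
proof -
  show "smooth_fun f" using assms by (simp add: schwartz_def)
  show "weighted_deriv \<alpha> \<beta> f x \<le> schwartz_seminorm \<alpha> \<beta> f"
    unfolding schwartz_seminorm_def using assms by (intro cSUP_upper) (auto simp: schwartz_def)
qed

lemma GS_step_schwartz: "0 < h \<Longrightarrow> GS_step s t h \<subseteq> schwartz"
  by (auto intro!: schwartzI(1) GS_stepD)

section \<open>Seminorm topologies\<close>

text \<open>Differentiability of all iterates is needed at every step, because
  \<open>frechet_derivative\<close> is an arbitrary value at points where no derivative
  exists.\<close>

lemma iter_partial_lin:
  assumes "smooth_fun f" "smooth_fun g"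
  shows "iter_partial is (\<lambda>x. a * f x + b * g x)
      = (\<lambda>x. a * iter_partial is f x + b * iter_partial is g x)"
proof (induction "is")
  case (Cons k "is")
  let ?F = "iter_partial is f" and ?G = "iter_partial is g"
  have F: "(?F has_derivative frechet_derivative ?F (at x)) (at x)"
    and G: "(?G has_derivative frechet_derivative ?G (at x)) (at x)" for x
    using assms unfolding smooth_fun_def frechet_derivative_works by blast+
  have "frechet_derivative (\<lambda>x. a * ?F x + b * ?G x) (at x)
      = (\<lambda>v. a * frechet_derivative ?F (at x) v + b * frechet_derivative ?G (at x) v)" for x
    by (rule frechet_derivative_at[symmetric])
      (intro has_derivative_add has_derivative_mult_right F G)
  then show ?case using Cons by (simp add: iter_partial_def partial_deriv_def)
qed (simp add: iter_partial_def)

lemma smooth_fun_lin: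
  assumes "smooth_fun f" "smooth_fun g"
  shows "smooth_fun (\<lambda>x. a * f x + b * g x)"
  unfolding smooth_fun_def iter_partial_lin[OF assms]
  using assms unfolding smooth_fun_def by (auto intro!: derivative_intros)

lemma weighted_deriv_lin:
  assumes "smooth_fun f" "smooth_fun g"
  shows "weighted_deriv \<alpha> \<beta> (\<lambda>x. a * f x + b * g x) x
      \<le> norm a * weighted_deriv \<alpha> \<beta> f x + norm b * weighted_deriv \<alpha> \<beta> g x"
proof -
  have "of_real (multi_power x \<beta>) * multi_deriv \<alpha> (\<lambda>x. a * f x + b * g x) x
    = a * (of_real (multi_power x \<beta>) * multi_deriv \<alpha> f x)
        + b * (of_real (multi_power x \<beta>) * multi_deriv \<alpha> g x)"
    unfolding multi_deriv_def iter_partial_lin[OF assms] by (simp add: algebra_simps)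
  then show ?thesis by (simp only: norm_triangle_ineq norm_mult[symmetric])
qed

definition lin_closed :: "('a \<Rightarrow> complex) set \<Rightarrow> bool" where
  "lin_closed X \<longleftrightarrow> X \<noteq> {} \<and> (\<forall>f\<in>X. \<forall>g\<in>X. \<forall>a b. (\<lambda>x. a * f x + b * g x) \<in> X)"

text \<open>The properties on which the convergence and continuity arguments rest;
  \<open>P \<noteq> {}\<close> makes the basic balls cover \<open>X\<close>, so that the topology
  has \<open>X\<close> as its carrier.\<close>

definition seminorms :: "('a \<Rightarrow> complex) set \<Rightarrow> (('a \<Rightarrow> complex) \<Rightarrow> real) set \<Rightarrow> bool" where
  "seminorms X P \<longleftrightarrow> lin_closed X \<and> P \<noteq> {} \<and>
     (\<forall>p\<in>P. p (\<lambda>_. 0) = 0 \<and> (\<forall>f\<in>X. \<forall>g\<in>X. p (\<lambda>x. f x + g x) \<le> p f + p g))"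

lemma seminorms_zero: "seminorms X P \<Longrightarrow> p \<in> P \<Longrightarrow> p (\<lambda>_. 0) = 0"
  and seminorms_add: "seminorms X P \<Longrightarrow> p \<in> P \<Longrightarrow> f \<in> X \<Longrightarrow> g \<in> X \<Longrightarrow> p (\<lambda>x. f x + g x) \<le> p f + p g"
  and seminorms_lin_closed: "seminorms X P \<Longrightarrow> lin_closed X"
  by (simp_all add: seminorms_def)

lemma lin_closedD: "lin_closed X \<Longrightarrow> f \<in> X \<Longrightarrow> g \<in> X \<Longrightarrow> (\<lambda>x. a * f x + b * g x) \<in> X"
  by (simp add: lin_closed_def)

lemma lin_closed_zero: "lin_closed X \<Longrightarrow> (\<lambda>_. 0) \<in> X"
  using lin_closedD[of X _ _ 0 0] by (auto simp: lin_closed_def)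

lemma lin_closed_scale: "lin_closed X \<Longrightarrow> f \<in> X \<Longrightarrow> (\<lambda>x. a * f x) \<in> X"
  using lin_closedD[of X f f a 0] by simp

lemma lin_closed_diff: "lin_closed X \<Longrightarrow> f \<in> X \<Longrightarrow> g \<in> X \<Longrightarrow> (\<lambda>x. f x - g x) \<in> X"
  using lin_closedD[of X f g 1 "-1"] by simp

lemma topspace_seminorm_topology:
  assumes "seminorms X P"
  shows "topspace (seminorm_topology X P) = X"
proof -
  obtain p where "p \<in> P" "p (\<lambda>_. 0) = 0" using assms by (auto simp: seminorms_def)
  then have "f \<in> \<Union> {{g \<in> X. p (\<lambda>x. g x - f x) < e} | f p e. f \<in> X \<and> p \<in> P \<and> e > 0}" if "f \<in> X" for f
    using that by (intro UnionI[of "{g \<in> X. p (\<lambda>x. g x - f x) < 1}"] CollectI exI[of _ f] exI[of _ p]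
        exI[of _ 1]) auto
  then show ?thesis unfolding seminorm_topology_def topology_generated_by_topspace by auto
qed

text \<open>The generating balls may be centred anywhere, so for a ball around \<open>f\<close> that
  contains 0 subadditivity is used in the form
  \<open>p (\<psi> j - f) \<le> p (\<psi> j) + p (- f)\<close>. The property then passes to finite
  intersections and unions by induction on the generation of open sets.\<close>

lemma limitin_seminorm_topology:
  assumes XP: "seminorms X P" and X: "\<And>j. \<psi> j \<in> X" and lim: "\<And>p. p \<in> P \<Longrightarrow> (\<lambda>j. p (\<psi> j)) \<longlonglongrightarrow> 0"
  shows "limitin (seminorm_topology X P) \<psi> (\<lambda>_. 0) sequentially"
proof -
  have lin: "lin_closed X" using XP by (simp add: seminorms_def)
  have "eventually (\<lambda>j. \<psi> j \<in> U) sequentially"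
    if "generate_topology_on {{g \<in> X. p (\<lambda>x. g x - f x) < e} | f p e. f \<in> X \<and> p \<in> P
        \<and> e > 0} U" "(\<lambda>_. 0) \<in> U" for U
    using that
  proof induction
    case (UN K)
    then obtain k where "k \<in> K" "(\<lambda>_. 0) \<in> k" by blast
    with UN have "eventually (\<lambda>j. \<psi> j \<in> k) sequentially" by blast
    then show ?case by (rule eventually_mono) (use \<open>k \<in> K\<close> in blast)
  next
    case (Basis U)
    then obtain f p e where U: "U = {g \<in> X. p (\<lambda>x. g x - f x) < e}" "f \<in> X" "p \<in> P" "e > 0" by auto
    then have d: "p (\<lambda>x. - f x) < e" using Basis by simp
    have "eventually (\<lambda>j. p (\<psi> j) < e - p (\<lambda>x. - f x)) sequentially"
      using lim[OF U(3)] d by (intro order_tendstoD) auto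
    then show ?case
    proof (rule eventually_mono)
      fix j assume "p (\<psi> j) < e - p (\<lambda>x. - f x)"
      moreover have "p (\<lambda>x. \<psi> j x + - f x) \<le> p (\<psi> j) + p (\<lambda>x. - f x)"
      proof -
        have "(\<lambda>x. - f x) \<in> X" using lin_closed_scale[OF lin U(2), of "-1"] by simp
        then show ?thesis by (rule seminorms_add[OF XP U(3) X])
      qed
      ultimately show "\<psi> j \<in> U" using X by (simp add: U(1))
    qed
  qed (auto intro: eventually_conj)
  then show ?thesis
    using lin_closed_zero[OF lin] topspace_seminorm_topology[OF XP]
    unfolding limitin_def by (auto simp: seminorm_topology_def openin_topology_generated_by_iff)
qed

lemma dual_space_linear:
  assumes "u \<in> dual_space X T" "lin_closed X" "f \<in> X" "g \<in> X"
  shows "u (\<lambda>x. a * f x + b * g x) = a * u f + b * u g"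
  using assms lin_closed_scale[OF assms(2)] by (simp add: dual_space_def)

lemma dual_space_null:
  assumes "u \<in> dual_space X (seminorm_topology X P)" "seminorms X P"
    and "\<And>j. \<psi> j \<in> X" "\<And>p. p \<in> P \<Longrightarrow> (\<lambda>j. p (\<psi> j)) \<longlonglongrightarrow> 0"
  shows "(\<lambda>j. u (\<psi> j)) \<longlonglongrightarrow> 0"
proof -
  have lin: "lin_closed X" using assms(2) by (simp add: seminorms_def)
  have "u (\<lambda>_. 0) = 0"
    using dual_space_linear[OF assms(1) lin assms(3)[of 0] assms(3)[of 0], of 0 0] by simp
  moreover have "limitin euclidean (u \<circ> \<psi>) (u (\<lambda>_. 0)) sequentially"
  proof (rule continuous_map_limit)
    show "continuous_map (seminorm_topology X P) euclidean u" using assms(1)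
        by (simp add: dual_space_def)
    show "limitin (seminorm_topology X P) \<psi> (\<lambda>_. 0) sequentially"
      by (rule limitin_seminorm_topology[OF assms(2)]) (use assms(3,4) in auto)
  qed
  ultimately show ?thesis by (simp add: o_def)
qed

lemma continuous_map_seminorm_topology:
  assumes X: "seminorms X P" and Y: "seminorms Y Q"
    and L: "\<And>f. f \<in> X \<Longrightarrow> L f \<in> Y" "\<And>f g. f \<in> X \<Longrightarrow> g \<in> X \<Longrightarrow> L (\<lambda>x. f x - g x) = (\<lambda>x. L f x - L g x)"
    and bound: "\<And>q. q \<in> Q \<Longrightarrow> \<exists>p\<in>P. \<exists>C\<ge>0. \<forall>f\<in>X. q (L f) \<le> C * p f"
  shows "continuous_map (seminorm_topology X P) (seminorm_topology Y Q) L"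
proof -
  have lin: "lin_closed X" "lin_closed Y" using X Y by (simp_all add: seminorms_def)
  show ?thesis
    unfolding seminorm_topology_def[of Y]
  proof (rule continuous_on_generated_topo)
    show "L ` topspace (seminorm_topology X P) \<subseteq> \<Union> {{g \<in> Y. p (\<lambda>x. g x - f x) < e} | f p e. f \<in> Y
        \<and> p \<in> Q \<and> e > 0}"
      using topspace_seminorm_topology[OF Y] L(1)
      unfolding topspace_seminorm_topology[OF X] by (auto simp: seminorm_topology_def)
    fix U assume "U \<in> {{g \<in> Y. p (\<lambda>x. g x - f x) < e} | f p e. f \<in> Y \<and> p \<in> Q \<and> e > 0}"
    then obtain f q e where U: "U = {g \<in> Y. q (\<lambda>x. g x - f x) < e}" "f \<in> Y" "q \<in> Q" by auto
    obtain p C where p: "p \<in> P" "0 \<le> C" "\<And>f. f \<in> X \<Longrightarrow> q (L f) \<le> C * p f" using bound[OF U(3)] by blast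
    let ?V = "L -` U \<inter> topspace (seminorm_topology X P)"
    show "openin (seminorm_topology X P) ?V"
    proof (subst openin_subopen, intro ballI)
      fix g assume "g \<in> ?V"
      then have g: "g \<in> X" "q (\<lambda>x. L g x - f x) < e"
        by (auto simp: U(1) topspace_seminorm_topology[OF X])
      \<comment> \<open>The distance left to the boundary of the target ball, divided by the bound
        of \<open>L\<close>; the \<open>+ 1\<close> admits \<open>C = 0\<close> and makes the final
        inequality strict.\<close>
      define d where "d = (e - q (\<lambda>x. L g x - f x)) / (C + 1)"
      have d: "d > 0" using g p(2) by (simp add: d_def)
      let ?B = "{k \<in> X. p (\<lambda>x. k x - g x) < d}"
      have "openin (seminorm_topology X P) ?B"
        unfolding seminorm_topology_def using g p d by (intro topology_generated_by_Basis) auto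
      moreover have "g \<in> ?B" using g d seminorms_zero[OF X p(1)] by simp
      moreover have "?B \<subseteq> ?V"
      proof
        fix k assume k: "k \<in> ?B"
        then have kg: "(\<lambda>x. k x - g x) \<in> X" using lin_closed_diff[OF lin(1)] g by blast
        have "q (\<lambda>x. (L k x - L g x) + (L g x - f x)) \<le> q (\<lambda>x. L k x - L g x) + q (\<lambda>x. L g x - f x)"
          using U L(1) k g by (intro seminorms_add[OF Y U(3)] lin_closed_diff[OF lin(2)]) auto
        also have "q (\<lambda>x. L k x - L g x) \<le> C * p (\<lambda>x. k x - g x)"
          using p(3)[OF kg] L(2) k g by simp
        also have "\<dots> \<le> C * d" using k p(2) by (intro mult_left_mono) auto
        also have "C * d < e - q (\<lambda>x. L g x - f x)"
        proof -
          have "(C + 1) * d = e - q (\<lambda>x. L g x - f x)" using p(2) by (simp add: d_def)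
          then show ?thesis using d by (simp add: algebra_simps)
        qed
        finally have "q (\<lambda>x. L k x - f x) < e" by simp
        then show "k \<in> ?V" using k L(1) by (simp add: U(1) topspace_seminorm_topology[OF X])
      qed
      ultimately show "\<exists>T. openin (seminorm_topology X P) T \<and> g \<in> T \<and> T \<subseteq> ?V" by blast
    qed
  qed
qed

section \<open>Linearity and seminorms of the test function spaces\<close>

lemma
  shows smooth_fun_zero: "smooth_fun (\<lambda>_ :: real^'n::finite. 0)"
    and weighted_deriv_zero: "weighted_deriv \<alpha> \<beta> (\<lambda>_ :: real^'n. 0) x = 0"
proof -
  have sm: "smooth1 (\<lambda>_. 0)" using smooth1I[of "\<lambda>_ _. 0"] by simp
  have nd: "nderiv n (\<lambda>_. 0) = (\<lambda>_. 0)" for n using nderiv_eqI[of "\<lambda>_ _. 0" n] by simp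
  have tz: "tens (\<lambda>_ :: 'n. \<lambda>_. 0) = (\<lambda>_. 0)" by (simp add: tens_def fun_eq_iff)
  show "smooth_fun (\<lambda>_ :: real^'n. 0)" using smooth_fun_tens[of "\<lambda>_ :: 'n. \<lambda>_. 0", OF sm] unfolding tz .
  show "weighted_deriv \<alpha> \<beta> (\<lambda>_ :: real^'n. 0) x = 0"
    using multi_deriv_tens[of "\<lambda>_ :: 'n. \<lambda>_. 0" \<alpha>, OF sm] unfolding tz nd by simp
qed

lemma GS_step_lin:
  assumes "0 < h" "f \<in> GS_step s t h" "g \<in> GS_step s t h"
  shows "(\<lambda>x. a * f x + b * g x) \<in> GS_step s t h"
    and "GS_norm s t h (\<lambda>x. a * f x + b * g x) \<le> norm a * GS_norm s t h f + norm b * GS_norm s t h g"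
proof -
  have *: "weighted_deriv \<alpha> \<beta> (\<lambda>x. a * f x + b * g x) x
      \<le> (norm a * GS_norm s t h f + norm b * GS_norm s t h g) * gs_multi_weight s t h \<alpha> \<beta>" for \<alpha> \<beta> x
  proof -
    have "weighted_deriv \<alpha> \<beta> (\<lambda>x. a * f x + b * g x) x
        \<le> norm a * weighted_deriv \<alpha> \<beta> f x + norm b * weighted_deriv \<alpha> \<beta> g x"
      by (intro weighted_deriv_lin GS_stepD(1)[OF assms(1,2)] GS_stepD(1)[OF assms(1,3)])
    also have "\<dots> \<le> norm a * (GS_norm s t h f * gs_multi_weight s t h \<alpha> \<beta>)
        + norm b * (GS_norm s t h g * gs_multi_weight s t h \<alpha> \<beta>)"
      by (intro add_mono mult_left_mono GS_stepD(2)[OF assms(1,2)] GS_stepD(2)[OF assms(1,3)]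
          norm_ge_zero)
    finally show ?thesis by (simp add: algebra_simps)
  qed
  have sm: "smooth_fun (\<lambda>x. a * f x + b * g x)"
    by (intro smooth_fun_lin GS_stepD(1)[OF assms(1,2)] GS_stepD(1)[OF assms(1,3)])
  show "(\<lambda>x. a * f x + b * g x) \<in> GS_step s t h"
    "GS_norm s t h (\<lambda>x. a * f x + b * g x) \<le> norm a * GS_norm s t h f + norm b * GS_norm s t h g"
    by (rule GS_stepI[OF assms(1) sm *])+
qed

lemma GS_step_zero:
  assumes "0 < h"
  shows "(\<lambda>_ :: real^'n::finite. 0) \<in> GS_step s t h" "GS_norm s t h (\<lambda>_ :: real^'n. 0) = 0"
proof -
  have *: "weighted_deriv \<alpha> \<beta> (\<lambda>_. 0) x \<le> 0 * gs_multi_weight s t h \<alpha> \<beta>" for \<alpha> \<beta> and x :: "real^'n"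
    by (simp add: weighted_deriv_zero)
  show z: "(\<lambda>_ :: real^'n. 0) \<in> GS_step s t h" by (rule GS_stepI(1)[OF assms smooth_fun_zero *])
  have "GS_norm s t h (\<lambda>_ :: real^'n. 0) \<le> 0" by (rule GS_stepI(2)[OF assms smooth_fun_zero *])
  then show "GS_norm s t h (\<lambda>_ :: real^'n. 0) = 0" using GS_norm_nonneg[OF assms z] by simp
qed

lemma seminorms_GS_step:
  assumes "0 < h"
  shows "seminorms (GS_step s t h :: (real^'n::finite \<Rightarrow> complex) set) {GS_norm s t h}"
proof -
  have "lin_closed (GS_step s t h :: (real^'n \<Rightarrow> complex) set)"
    unfolding lin_closed_def using GS_step_zero(1)[OF assms] by (auto intro: GS_step_lin(1)[OF assms])
  moreover have "GS_norm s t h (\<lambda>x. f x + g x) \<le> GS_norm s t h f + GS_norm s t h g"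
    if "f \<in> GS_step s t h" "g \<in> GS_step s t h" for f g :: "real^'n \<Rightarrow> complex"
    using GS_step_lin(2)[OF assms that, of 1 1] by simp
  ultimately show ?thesis using GS_step_zero(2)[OF assms] by (simp add: seminorms_def)
qed

lemma GS_step_mono:
  assumes "0 < h" "h \<le> k"
  shows "GS_step s t h \<subseteq> (GS_step s t k :: (real^'n::finite \<Rightarrow> complex) set)"
proof
  fix f :: "real^'n \<Rightarrow> complex" assume f: "f \<in> GS_step s t h"
  have w: "gs_multi_weight s t h \<alpha> \<beta> \<le> gs_multi_weight s t k \<alpha> \<beta>" for \<alpha> \<beta> :: "'n \<Rightarrow> nat"
    unfolding gs_multi_weight_prod using assms gs_weight_pos[OF assms(1), of s t] gs_weight_mono[OF
        assms, of s t]
    by (intro prod_mono) (auto simp: less_imp_le)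
  have *: "weighted_deriv \<alpha> \<beta> f x \<le> GS_norm s t h f * gs_multi_weight s t k \<alpha> \<beta>" for \<alpha> \<beta> x
    by (rule order_trans[OF GS_stepD(2)[OF assms(1) f] mult_left_mono[OF w GS_norm_nonneg[OF
        assms(1) f]]])
  show "f \<in> GS_step s t k"
    by (rule GS_stepI(1)[OF _ GS_stepD(1)[OF assms(1) f] *]) (use assms in simp)
qed

lemma lin_closed_GS: "lin_closed (GS s t :: (real^'n::finite \<Rightarrow> complex) set)"
  unfolding lin_closed_def
proof (intro conjI ballI allI)
  show "GS s t \<noteq> ({} :: (real^'n \<Rightarrow> complex) set)"
    using GS_step_zero(1)[of 1 s t] unfolding GS_def
        by (metis UN_I empty_iff greaterThan_iff zero_less_one)
  fix f g :: "real^'n \<Rightarrow> complex" and a b assume "f \<in> GS s t" "g \<in> GS s t"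
  then obtain h k where hk: "0 < h" "f \<in> GS_step s t h" "0 < k" "g \<in> GS_step s t k"
      by (auto simp: GS_def)
  have "f \<in> GS_step s t (max h k)" by (rule GS_step_mono[THEN subsetD, OF hk(1) _ hk(2)]) simp
  moreover have "g \<in> GS_step s t (max h k)" by (rule GS_step_mono[THEN subsetD, OF hk(3) _ hk(4)]) simp
  ultimately have "(\<lambda>x. a * f x + b * g x) \<in> GS_step s t (max h k)"
    using hk by (intro GS_step_lin) auto
  then show "(\<lambda>x. a * f x + b * g x) \<in> GS s t" using hk unfolding GS_def
      by (intro UN_I[of "max h k"]) auto
qed

lemma seminorm_on_zero:
  fixes p :: "(real^'n::finite \<Rightarrow> complex) \<Rightarrow> real"
  assumes "seminorm_on (GS s t) p"
  shows "p (\<lambda>_. 0) = 0"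
proof -
  have "\<forall>f\<in>GS s t. \<forall>c. p (\<lambda>x. c * f x) = norm c * p f" using assms by (simp add: seminorm_on_def)
  from this[THEN bspec, OF lin_closed_zero[OF lin_closed_GS], THEN spec, of 0] show ?thesis by simp
qed

lemma seminorms_GS:
  "seminorms (GS s t :: (real^'n::finite \<Rightarrow> complex) set) {p. seminorm_on (GS s t) p
      \<and> (\<forall>h>0. continuous_map (GS_step_topology s t h) euclideanreal p)}"
proof -
  have "seminorm_on (GS s t :: (real^'n \<Rightarrow> complex) set) (\<lambda>_. 0)" by (simp add: seminorm_on_def)
  then have "{p. seminorm_on (GS s t :: (real^'n \<Rightarrow> complex) set) p
      \<and> (\<forall>h>0. continuous_map (GS_step_topology s t h) euclideanreal p)} \<noteq> {}"
    by (auto intro!: exI[of _ "\<lambda>_. 0"])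
  then show ?thesis
    unfolding seminorms_def
  proof (intro conjI ballI lin_closed_GS)
    fix p :: "(real^'n \<Rightarrow> complex) \<Rightarrow> real"
    assume "p \<in> {p. seminorm_on (GS s t) p \<and> (\<forall>h>0. continuous_map (GS_step_topology s t h)
        euclideanreal p)}"
    then have p: "seminorm_on (GS s t) p" by simp
    show "p (\<lambda>_. 0) = 0" by (rule seminorm_on_zero[OF p])
    show "p (\<lambda>x. f x + g x) \<le> p f + p g" if "f \<in> GS s t" "g \<in> GS s t" for f g
      using p that by (simp add: seminorm_on_def)
  qed
qed

lemma seminorms_GS_Sigma: "seminorms (GS_Sigma s t :: (real^'n::finite \<Rightarrow> complex) set) (GS_norm s
    t ` {0<..})"
proof -
  have "lin_closed (GS_Sigma s t :: (real^'n \<Rightarrow> complex) set)"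
    unfolding lin_closed_def GS_Sigma_def using GS_step_zero(1)[of _ s t] by (auto intro: GS_step_lin(1))
  moreover have "GS_norm s t h (\<lambda>x. f x + g x) \<le> GS_norm s t h f + GS_norm s t h g"
    if "0 < h" "f \<in> GS_Sigma s t" "g \<in> GS_Sigma s t" for f g :: "real^'n \<Rightarrow> complex" and h
    using GS_step_lin(2)[OF that(1), of f s t g 1 1] that by (simp add: GS_Sigma_def)
  ultimately show ?thesis using GS_step_zero(2) by (auto simp: seminorms_def)
qed

lemma schwartz_lin:
  assumes "f \<in> schwartz" "g \<in> schwartz"
  shows "(\<lambda>x. a * f x + b * g x) \<in> schwartz"
    and "schwartz_seminorm \<alpha> \<beta> (\<lambda>x. a * f x + b * g x)
        \<le> norm a * schwartz_seminorm \<alpha> \<beta> f + norm b * schwartz_seminorm \<alpha> \<beta> g"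
proof -
  have *: "weighted_deriv \<alpha> \<beta> (\<lambda>x. a * f x + b * g x) x
      \<le> norm a * schwartz_seminorm \<alpha> \<beta> f + norm b * schwartz_seminorm \<alpha> \<beta> g" for \<alpha> \<beta> x
    by (rule order_trans[OF weighted_deriv_lin])
      (intro schwartzD assms add_mono mult_left_mono norm_ge_zero)+
  have sm: "smooth_fun (\<lambda>x. a * f x + b * g x)"
    by (intro smooth_fun_lin schwartzD assms)
  show "(\<lambda>x. a * f x + b * g x) \<in> schwartz" by (rule schwartzI(1)[OF sm *])
  show "schwartz_seminorm \<alpha> \<beta> (\<lambda>x. a * f x + b * g x)
      \<le> norm a * schwartz_seminorm \<alpha> \<beta> f + norm b * schwartz_seminorm \<alpha> \<beta> g"
    by (rule schwartzI(2)[OF sm *])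
qed

lemma schwartz_zero: "(\<lambda>_ :: real^'n::finite. 0) \<in> schwartz"
    "schwartz_seminorm \<alpha> \<beta> (\<lambda>_ :: real^'n. 0) = 0"
  using smooth_fun_zero by (auto simp: schwartz_def schwartz_seminorm_def weighted_deriv_zero)

lemma schwartz_seminorm_nonneg: "f \<in> schwartz \<Longrightarrow> 0 \<le> schwartz_seminorm \<alpha> \<beta> f"
  by (rule order_trans[OF norm_ge_zero schwartzD(2)])

lemma seminorms_schwartz: "seminorms (schwartz :: (real^'n::finite \<Rightarrow> complex) set) {schwartz_seminorm
    \<alpha> \<beta> | \<alpha> \<beta>. True}"
proof -
  have "lin_closed (schwartz :: (real^'n \<Rightarrow> complex) set)"
    unfolding lin_closed_def using schwartz_zero(1) by (auto intro: schwartz_lin(1))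
  moreover have "schwartz_seminorm \<alpha> \<beta> (\<lambda>x. f x + g x)
      \<le> schwartz_seminorm \<alpha> \<beta> f + schwartz_seminorm \<alpha> \<beta> g"
    if "f \<in> schwartz" "g \<in> schwartz" for f g :: "real^'n \<Rightarrow> complex" and \<alpha> \<beta>
    using schwartz_lin(2)[OF that, of \<alpha> \<beta> 1 1] by simp
  ultimately show ?thesis using schwartz_zero(2) by (auto simp: seminorms_def)
qed

section \<open>Uniqueness for functionals on the line\<close>

lemma testfun_functional:
  fixes X :: "(real^1 \<Rightarrow> complex) set"
  assumes wc: "weight_class adm" and lin: "lin_closed X"
    and X: "\<And>g. weight_class.testfun adm g \<Longrightarrow> (\<lambda>x. g (x $ (1 :: 1))) \<in> X"
    and u: "\<And>f g a b. f \<in> X \<Longrightarrow> g \<in> X \<Longrightarrow> u (\<lambda>x. a * f x + b * g x) = a * u f + b * u g"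
    and null: "\<And>N e \<psi>. adm N \<Longrightarrow> e \<longlonglongrightarrow> 0 \<Longrightarrow> (\<And>j. 0 \<le> e j) \<Longrightarrow>
      (\<And>j. bnd (\<psi> j) (\<lambda>n m. e j * N n m)) \<Longrightarrow> (\<lambda>j. u (\<lambda>x. \<psi> j (x $ 1))) \<longlonglongrightarrow> 0"
  shows "test_functional adm (\<lambda>g. u (\<lambda>x. g (x $ 1)))"
proof -
  interpret weight_class adm by (rule wc)
  show ?thesis by unfold_locales (use X u null in auto)
qed

text \<open>Stated through linearity and null sequences instead of membership in the dual, so that
  it also applies directly to integration against a Schwartz function.\<close>

lemma dual_schwartz_eq_0:
  fixes u :: "(real^1 \<Rightarrow> complex) \<Rightarrow> complex"
  assumes lin: "\<And>f g a b. f \<in> schwartz \<Longrightarrow> g \<in> schwartz \<Longrightarrow> u (\<lambda>x. a * f x + b * g x) = a * u f + b * u g"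
    and null: "\<And>\<psi>. (\<And>j. \<psi> j \<in> schwartz) \<Longrightarrow> (\<And>\<alpha> \<beta>. (\<lambda>j. schwartz_seminorm \<alpha> \<beta> (\<psi> j)) \<longlonglongrightarrow> 0)
        \<Longrightarrow> (\<lambda>j. u (\<psi> j)) \<longlonglongrightarrow> 0"
    and u0: "\<And>c. u (\<lambda>x. gexp c 0 (x $ 1)) = 0" and \<phi>: "\<phi> \<in> schwartz"
  shows "u \<phi> = 0"
proof -
  interpret weight_class "\<lambda>_. True" by (rule weight_class_all)
  have mem: "(\<lambda>x. g (x $ (1 :: 1))) \<in> schwartz" if "bnd g N" for g N
    by (rule schwartzI(1)[OF smooth_fun_nth[OF that] weighted_deriv_nth[OF that]])
  have sn: "schwartz_seminorm \<alpha> \<beta> (\<lambda>x. g (x $ (1 :: 1))) \<le> N (\<alpha> 1) (\<beta> 1)" if "bnd g N" for g N \<alpha> \<beta>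
    by (rule schwartzI(2)[OF smooth_fun_nth[OF that] weighted_deriv_nth[OF that]])
  interpret test_functional "\<lambda>_. True" "\<lambda>g. u (\<lambda>x. g (x $ 1))"
  proof (rule testfun_functional[OF weight_class_all seminorms_lin_closed[OF seminorms_schwartz] _ lin])
    fix N e and \<psi> :: "nat \<Rightarrow> real \<Rightarrow> complex"
    assume e: "e \<longlonglongrightarrow> 0" and b: "\<And>j. bnd (\<psi> j) (\<lambda>n m. e j * N n m)"
    show "(\<lambda>j. u (\<lambda>x. \<psi> j (x $ 1))) \<longlonglongrightarrow> 0"
    proof (rule null)
      show "(\<lambda>x. \<psi> j (x $ (1 :: 1))) \<in> schwartz" for j by (rule mem[OF b])
      fix \<alpha> \<beta>
      show "(\<lambda>j. schwartz_seminorm \<alpha> \<beta> (\<lambda>x. \<psi> j (x $ (1 :: 1)))) \<longlonglongrightarrow> 0"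
      proof (rule tendsto_sandwich[where f = "\<lambda>_. 0" and h = "\<lambda>j. e j * N (\<alpha> 1) (\<beta> 1)"])
        show "(\<lambda>j. e j * N (\<alpha> 1) (\<beta> 1)) \<longlonglongrightarrow> 0" by (rule tendsto_mult_left_zero[OF e])
        show "\<forall>\<^sub>F j in sequentially. 0 \<le> schwartz_seminorm \<alpha> \<beta> (\<lambda>x. \<psi> j (x $ (1 :: 1)))"
          by (intro always_eventually allI schwartz_seminorm_nonneg mem[OF b])
        show "\<forall>\<^sub>F j in sequentially. schwartz_seminorm \<alpha> \<beta> (\<lambda>x. \<psi> j (x $ (1 :: 1)))
            \<le> e j * N (\<alpha> 1) (\<beta> 1)"
          by (intro always_eventually allI sn[OF b])
      qed simp
    qed
  qed (auto simp: testfun_def mem)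
  have "bnd (\<lambda>x. \<phi> (vec x)) (\<lambda>n m. schwartz_seminorm (single_index 1 n) (single_index 1 m) \<phi>)"
    by (intro bnd_vec schwartzD \<phi>)
  then have "testfun (\<lambda>x. \<phi> (vec x))" by (auto simp: testfun_def)
  from u_eq_0[OF u0 this] show ?thesis by simp
qed

text \<open>One common weight keeps the whole sequence in one step, with the null sequence
  \<open>e\<close> as its norm up to a constant.\<close>

lemma GS_norm_null:
  fixes \<psi> :: "nat \<Rightarrow> real \<Rightarrow> complex"
  assumes "0 < h" "gs_bounded s t h N" "e \<longlonglongrightarrow> 0" "\<And>j. 0 \<le> e j" "\<And>j. bnd (\<psi> j) (\<lambda>n m. e j * N n m)"
  shows "(\<lambda>x. \<psi> j (x $ (1 :: 1))) \<in> GS_step s t h"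
    and "(\<lambda>j. GS_norm s t h (\<lambda>x. \<psi> j (x $ (1 :: 1)))) \<longlonglongrightarrow> 0"
proof -
  obtain C where C: "\<And>n m. N n m \<le> C * gs_weight s t h n m" using assms(2) by (auto simp: gs_bounded_def)
  have b: "bnd (\<psi> j) (\<lambda>n m. (e j * C) * gs_weight s t h n m)" for j
    using bnd_mono[OF assms(5)] mult_left_mono[OF C assms(4)] by (simp add: mult.assoc)
  show mem: "(\<lambda>x. \<psi> j (x $ (1 :: 1))) \<in> GS_step s t h" for j by (rule GS_step_nth[OF assms(1) b])
  show "(\<lambda>j. GS_norm s t h (\<lambda>x. \<psi> j (x $ (1 :: 1)))) \<longlonglongrightarrow> 0"
    by (rule tendsto_sandwich[OF always_eventually always_eventually tendsto_const
        tendsto_mult_left_zero[OF assms(3)]])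
      (use GS_norm_nonneg[OF assms(1) mem] GS_step_nth(2)[OF assms(1) b] in auto)
qed

lemma GS_step_testfun:
  assumes "0 < h" "bnd g N" "gs_bounded s t h N"
  shows "(\<lambda>x. g (x $ (1 :: 1))) \<in> GS_step s t h"
proof -
  obtain C where "\<And>n m. N n m \<le> C * gs_weight s t h n m" using assms(3) by (auto simp: gs_bounded_def)
  then show ?thesis by (intro GS_step_nth(1)[OF assms(1)] bnd_mono[OF assms(2)])
qed

lemma gs_bounded_vec:
  fixes f :: "real^1 \<Rightarrow> complex"
  assumes "0 < h" "f \<in> GS_step s t h"
  shows "gs_bounded s t h (opt_weight (\<lambda>x. f (vec x)))"
      "bnd (\<lambda>x. f (vec x)) (opt_weight (\<lambda>x. f (vec x)))"
proof -
  note b = GS_step_vec[OF assms]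
  show "gs_bounded s t h (opt_weight (\<lambda>x. f (vec x)))"
    by (rule gs_boundedI[OF GS_norm_nonneg[OF assms] opt_weight_le[OF b]])
  show "bnd (\<lambda>x. f (vec x)) (opt_weight (\<lambda>x. f (vec x)))"
    using bndD[OF b] by (intro bnd_opt_weight bnd_smooth[OF b]) blast
qed

lemma dual_GS_Sigma_eq_0:
  fixes u :: "(real^1 \<Rightarrow> complex) \<Rightarrow> complex"
  assumes st: "1/2 < s" "1/2 < t" and u: "u \<in> dual_space (GS_Sigma s t) (GS_Sigma_topology s t)"
    and u0: "\<And>c. u (\<lambda>x. gexp c 0 (x $ 1)) = 0" and \<phi>: "\<phi> \<in> GS_Sigma s t"
  shows "u \<phi> = 0"
proof -
  interpret weight_class "sigma_adm s t" by (rule weight_class_sigma[OF st])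
  interpret test_functional "sigma_adm s t" "\<lambda>g. u (\<lambda>x. g (x $ 1))"
  proof (rule testfun_functional[OF weight_class_sigma[OF st] seminorms_lin_closed[OF
      seminorms_GS_Sigma]])
    show "(\<lambda>x. g (x $ (1 :: 1))) \<in> GS_Sigma s t" if "testfun g" for g
      using that by (auto simp: testfun_def sigma_adm_def GS_Sigma_def intro: GS_step_testfun)
    show "u (\<lambda>x. a * f x + b * g x) = a * u f + b * u g"
        if "f \<in> GS_Sigma s t" "g \<in> GS_Sigma s t" for f g a b
      by (rule dual_space_linear[OF u seminorms_lin_closed[OF seminorms_GS_Sigma] that])
    fix N e and \<psi> :: "nat \<Rightarrow> real \<Rightarrow> complex"
    assume N: "sigma_adm s t N" and e: "e \<longlonglongrightarrow> 0" "\<And>j. 0 \<le> e j" and b: "\<And>j. bnd (\<psi> j) (\<lambda>n m. e j * N n m)"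
    show "(\<lambda>j. u (\<lambda>x. \<psi> j (x $ 1))) \<longlonglongrightarrow> 0"
    proof (rule dual_space_null[OF u[unfolded GS_Sigma_topology_def] seminorms_GS_Sigma])
      show "(\<lambda>x. \<psi> j (x $ (1 :: 1))) \<in> GS_Sigma s t" for j
        using N unfolding GS_Sigma_def sigma_adm_def by (blast intro: GS_norm_null(1)[OF _ _ e b])
      show "(\<lambda>j. p (\<lambda>x. \<psi> j (x $ 1))) \<longlonglongrightarrow> 0" if "p \<in> GS_norm s t ` {0<..}"
          for p :: "(real^1 \<Rightarrow> complex) \<Rightarrow> real"
        using that N by (auto simp: sigma_adm_def intro: GS_norm_null(2)[OF _ _ e b])
    qed
  qed
  have "\<phi> \<in> GS_step s t h" if "0 < h" for h using \<phi> that by (auto simp: GS_Sigma_def)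
  \<comment> \<open>The optimal weight is taken because one weight must be bounded for all
    \<open>h\<close> at once.\<close>
  then have "testfun (\<lambda>x. \<phi> (vec x))"
    unfolding testfun_def sigma_adm_def
    by (intro exI[of _ "opt_weight (\<lambda>x. \<phi> (vec x))"] conjI allI impI gs_bounded_vec(1)
        gs_bounded_vec(2)[OF zero_less_one, of \<phi> s t]) simp_all
  from u_eq_0[OF u0 this] show ?thesis by simp
qed

lemma continuous_seminorm_null:
  assumes h: "0 < h" and p: "seminorm_on (GS s t) p"
      "continuous_map (GS_step_topology s t h) euclideanreal p"
    and \<psi>: "\<And>j. \<psi> j \<in> GS_step s t h" "(\<lambda>j. GS_norm s t h (\<psi> j)) \<longlonglongrightarrow> 0"
  shows "(\<lambda>j. p (\<psi> j)) \<longlonglongrightarrow> 0"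
proof -
  have "limitin (GS_step_topology s t h) \<psi> (\<lambda>_. 0) sequentially"
    unfolding GS_step_topology_def using \<psi> by (intro limitin_seminorm_topology seminorms_GS_step h) auto
  from continuous_map_limit[OF p(2) this] have "(\<lambda>j. p (\<psi> j)) \<longlonglongrightarrow> p (\<lambda>_. 0)" by (simp add: o_def)
  moreover have "p (\<lambda>_. 0) = 0" by (rule seminorm_on_zero[OF p(1)])
  ultimately show ?thesis by simp
qed

text \<open>The inductive limit topology is never examined directly. The sequences that occur lie in
  one step and tend to 0 there, and every defining seminorm is continuous on each step.\<close>

lemma dual_GS_eq_0:
  fixes u :: "(real^1 \<Rightarrow> complex) \<Rightarrow> complex"
  assumes st: "1/2 < s" "1/2 < t" and u: "u \<in> dual_space (GS s t) (GS_topology s t)"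
    and u0: "\<And>c. u (\<lambda>x. gexp c 0 (x $ 1)) = 0" and \<phi>: "\<phi> \<in> GS s t"
  shows "u \<phi> = 0"
proof -
  interpret weight_class "gs_adm s t" by (rule weight_class_gs[OF st])
  interpret test_functional "gs_adm s t" "\<lambda>g. u (\<lambda>x. g (x $ 1))"
  proof (rule testfun_functional[OF weight_class_gs[OF st] seminorms_lin_closed[OF seminorms_GS]])
    show "(\<lambda>x. g (x $ (1 :: 1))) \<in> GS s t" if "testfun g" for g
      using that by (auto simp: testfun_def gs_adm_def GS_def intro: GS_step_testfun)
    show "u (\<lambda>x. a * f x + b * g x) = a * u f + b * u g" if "f \<in> GS s t" "g \<in> GS s t" for f g a b
      by (rule dual_space_linear[OF u seminorms_lin_closed[OF seminorms_GS] that])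
    fix N e and \<psi> :: "nat \<Rightarrow> real \<Rightarrow> complex"
    assume N: "gs_adm s t N" and e: "e \<longlonglongrightarrow> 0" "\<And>j. 0 \<le> e j" and b: "\<And>j. bnd (\<psi> j) (\<lambda>n m. e j * N n m)"
    then obtain h where h: "0 < h" "gs_bounded s t h N" by (auto simp: gs_adm_def)
    note null = GS_norm_null[OF h e b]
    show "(\<lambda>j. u (\<lambda>x. \<psi> j (x $ 1))) \<longlonglongrightarrow> 0"
    proof (rule dual_space_null[OF u[unfolded GS_topology_def] seminorms_GS])
      show "(\<lambda>x. \<psi> j (x $ (1 :: 1))) \<in> GS s t" for j
        unfolding GS_def using h(1) null(1)[of j] by (intro UN_I[of h]) auto
      fix p :: "(real^1 \<Rightarrow> complex) \<Rightarrow> real"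
      assume "p \<in> {p. seminorm_on (GS s t) p \<and> (\<forall>h>0. continuous_map (GS_step_topology s t h)
          euclideanreal p)}"
      then have p: "seminorm_on (GS s t) p" "continuous_map (GS_step_topology s t h) euclideanreal p"
        using h(1) by auto
      show "(\<lambda>j. p (\<lambda>x. \<psi> j (x $ 1))) \<longlonglongrightarrow> 0"
        by (rule continuous_seminorm_null[OF h(1) p null])
    qed
  qed
  obtain h where "0 < h" "\<phi> \<in> GS_step s t h" using \<phi> by (auto simp: GS_def)
  then have "testfun (\<lambda>x. \<phi> (vec x))"
    using gs_bounded_vec[of h \<phi> s t] unfolding testfun_def gs_adm_def by blast
  from u_eq_0[OF u0 this] show ?thesis by simp
qed

section \<open>Lifting test functions by a Gaussian\<close>

definition gauss_lift :: "'d::finite \<Rightarrow> (real^1 \<Rightarrow> complex) \<Rightarrow> real^'d \<Rightarrow> complex" where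
  "gauss_lift k \<phi> = tens (\<lambda>i. if i = k then (\<lambda>x. \<phi> (vec x)) else gexp 0 0)"

lemma gauss_lift_eq: "gauss_lift k \<phi> x = \<phi> (vec (x $ k)) * (\<Prod>i\<in>UNIV - {k}. gexp 0 0 (x $ i))"
  unfolding gauss_lift_def tens_def by (subst prod.remove[of UNIV k]) (auto simp del: gexp.simps)

lemma gauss_lift_lin:
  "gauss_lift k (\<lambda>x. a * f x + b * g x) = (\<lambda>x. a * gauss_lift k f x + b * gauss_lift k g x)"
  by (simp add: gauss_lift_eq fun_eq_iff distrib_right mult.assoc del: gexp.simps)

lemma gauss_lift_diff: "gauss_lift k (\<lambda>x. f x - g x) = (\<lambda>x. gauss_lift k f x - gauss_lift k g x)"
  using gauss_lift_lin[of k 1 f "-1" g] by simp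

lemma
  assumes "bnd (\<lambda>x. \<phi> (vec x)) N" "bnd (gexp 0 0) M"
  shows smooth_fun_gauss_lift: "smooth_fun (gauss_lift k \<phi>)"
    and weighted_deriv_gauss_lift:
      "weighted_deriv \<alpha> \<beta> (gauss_lift k \<phi>) x \<le> N (\<alpha> k) (\<beta> k) * (\<Prod>i\<in>UNIV - {k}. M (\<alpha> i) (\<beta> i))"
proof -
  let ?g = "\<lambda>i. if i = k then (\<lambda>x. \<phi> (vec x)) else gexp 0 0"
  have b: "bnd (?g i) (if i = k then N else M)" for i using assms by auto
  show "smooth_fun (gauss_lift k \<phi>)" unfolding gauss_lift_def
      by (rule smooth_fun_tens[OF bnd_smooth[OF b]])
  have "weighted_deriv \<alpha> \<beta> (gauss_lift k \<phi>) x \<le> (\<Prod>i\<in>UNIV. (if i = k then N else M) (\<alpha> i) (\<beta> i))"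
    unfolding gauss_lift_def by (rule weighted_deriv_tens[OF b])
  also have "\<dots> = N (\<alpha> k) (\<beta> k) * (\<Prod>i\<in>UNIV - {k}. M (\<alpha> i) (\<beta> i))"
    by (subst prod.remove[of UNIV k]) auto
  finally show "weighted_deriv \<alpha> \<beta> (gauss_lift k \<phi>) x \<le> N (\<alpha> k) (\<beta> k) * (\<Prod>i\<in>UNIV - {k}. M (\<alpha> i) (\<beta> i))" .
qed

text \<open>The multi-index weight factors over the coordinates, so each of the remaining
  \<open>CARD('d) - 1\<close> Gaussians contributes one factor \<open>D\<close>. The parameter
  \<open>h\<close> is kept, and this is what yields continuity in the inductive and projective
  limits alike.\<close>

lemma gauss_lift_GS_step:
  fixes k :: "'d::finite"
  assumes h: "0 < h" and D: "bnd (gexp 0 0) (\<lambda>n m. D * gs_weight s t h n m)" and \<phi>: "\<phi> \<in> GS_step s t h"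
  shows "gauss_lift k \<phi> \<in> GS_step s t h"
    and "GS_norm s t h (gauss_lift k \<phi>) \<le> D ^ (CARD('d) - 1) * GS_norm s t h \<phi>"
proof -
  note b = GS_step_vec[OF h \<phi>]
  have "weighted_deriv \<alpha> \<beta> (gauss_lift k \<phi>) x \<le> (D ^ (CARD('d) - 1) * GS_norm s t h \<phi>)
      * gs_multi_weight s t h \<alpha> \<beta>" for \<alpha> \<beta> x
  proof -
    have "gs_multi_weight s t h \<alpha> \<beta> = gs_weight s t h (\<alpha> k) (\<beta> k)
        * (\<Prod>i\<in>UNIV - {k}. gs_weight s t h (\<alpha> i) (\<beta> i))"
      unfolding gs_multi_weight_prod by (subst prod.remove[of UNIV k]) auto
    then show ?thesis
      using weighted_deriv_gauss_lift[OF b D, where \<alpha> = \<alpha> and \<beta> = \<beta> and k = k and x = x]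
          by (simp add: prod.distrib card_Diff_singleton ac_simps)
  qed
  then show "gauss_lift k \<phi> \<in> GS_step s t h"
    and "GS_norm s t h (gauss_lift k \<phi>) \<le> D ^ (CARD('d) - 1) * GS_norm s t h \<phi>"
    using GS_stepI[OF h smooth_fun_gauss_lift[OF b D]] by blast+
qed

lemma gexp_bnd_GS:
  assumes "1/2 < s" "1/2 < t" "0 < h"
  shows "\<exists>D\<ge>0. bnd (gexp c 0) (\<lambda>n m. D * gs_weight s t h n m)"
proof -
  interpret weight_class "sigma_adm s t" by (rule weight_class_sigma[OF assms(1,2)])
  obtain N where N: "sigma_adm s t N" "bnd (gexp c 0) N" by (rule bnd_gexp)
  then obtain D where D: "0 \<le> D" "\<And>n m. N n m \<le> D * gs_weight s t h n m"
    using assms(3) unfolding sigma_adm_def gs_bounded_def by auto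
  show ?thesis using D(1) bnd_mono[OF N(2) D(2)] by blast
qed

text \<open>At the critical exponents the Gaussian estimate holds for a fixed \<open>h\<close>;
  \<open>6\<close> is the value of \<open>3 / k\<close> in \<open>norm_gexp_bound\<close> at
  \<open>k = 1/2\<close>. One such step suffices, since \<open>S_half\<close> is a union.\<close>

lemma gexp_bnd_half: "\<exists>D\<ge>0. bnd (gexp c 0) (\<lambda>n m. D * gs_weight (1/2) (1/2) 6 n m)"
proof (intro exI conjI)
  let ?D = "3 * exp ((1/2)\<^sup>2 * (norm c)\<^sup>2 / 2 + (Re c)\<^sup>2)"
  show "0 \<le> ?D" by simp
  show "bnd (gexp c 0) (\<lambda>n m. ?D * gs_weight (1/2) (1/2) 6 n m)"
  proof (rule bndI[of "gexp c", OF gexp_deriv])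
    show "\<bar>x\<bar> ^ m * norm (gexp c n x) \<le> ?D * gs_weight (1/2) (1/2) 6 n m" for n m x
      using norm_gexp_bound[of "1/2" x m c n] by (simp add: gs_weight_def powr_half_sqrt ac_simps)
  qed
qed

lemma GS_Sigma_subset: "GS_Sigma s t \<subseteq> GS s t"
proof
  fix f assume "f \<in> GS_Sigma s t"
  then have "f \<in> GS_step s t 1" by (simp add: GS_Sigma_def)
  then show "f \<in> GS s t" unfolding GS_def by (intro UN_I[of 1]) auto
qed

lemma GS_subset_schwartz: "GS s t \<subseteq> schwartz"
  unfolding GS_def using GS_step_schwartz by blast

lemma gexp_GS_Sigma:
  assumes "1/2 < s" "1/2 < t"
  shows "(\<lambda>x. gexp c 0 (x $ (1 :: 1))) \<in> GS_Sigma s t"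
  unfolding GS_Sigma_def using gexp_bnd_GS[OF assms, of _ c] GS_step_nth(1) by fastforce

lemma gexp_S_half: "(\<lambda>x. gexp c 0 (x $ (1 :: 1))) \<in> GS_step (1/2) (1/2) 6"
  using gexp_bnd_half[of c] GS_step_nth(1)[of 6] by fastforce

section \<open>The Bargmann kernel on a coordinate axis\<close>

lemma norm_vec_square: "(norm (x :: real^'n))\<^sup>2 = (\<Sum>i\<in>UNIV. (x $ i)\<^sup>2)"
  unfolding power2_norm_eq_inner inner_vec_def by (simp add: power2_eq_square)

lemma bargmann_kernel_one:
  "bargmann_kernel (vec z :: complex^1) =
    (\<lambda>x. (of_real (pi powr (- 1 / 4)) * exp (- z\<^sup>2 / 2)) * gexp (of_real (sqrt 2) * z) 0 (x $ 1))"
proof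
  fix x :: "real^1"
  have "norm x ^ 2 = (x $ 1)\<^sup>2" by (simp add: norm_vec_square UNIV_1)
  then show "bargmann_kernel (vec z) x = (of_real (pi powr (- 1 / 4)) * exp (- z\<^sup>2 / 2))
      * gexp (of_real (sqrt 2) * z) 0 (x $ 1)"
    by (simp add: bargmann_kernel_def bilin_def UNIV_1 exp_add[symmetric] mult.assoc)
      (rule arg_cong[of _ _ exp], simp add: power2_eq_square field_simps)
qed

lemma bilin_axis: "bilin (axis k z) w = z * w $ k"
proof -
  have "bilin (axis k z) w = (\<Sum>j\<in>UNIV. if j = k then z * w $ k else 0)"
    unfolding bilin_def by (rule sum.cong) (auto simp: axis_def)
  then show ?thesis by simp
qed

text \<open>On the axis the linear term of the exponent sees only the coordinate \<open>k\<close>;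
  the rest is a pure Gaussian. Splitting the normalising power of \<open>pi\<close> accordingly
  produces the constant used later in the reduced function and functional.\<close>

lemma bargmann_kernel_axis:
  "bargmann_kernel (axis k z :: complex^'d::finite) =
    (\<lambda>x. of_real (pi powr (- (real CARD('d) - 1) / 4)) * gauss_lift k (bargmann_kernel (vec z)) x)"
proof
  fix x :: "real^'d"
  let ?S = "\<Sum>i\<in>UNIV - {k}. (x $ i)\<^sup>2"
  have "(norm x)\<^sup>2 = (\<Sum>i\<in>UNIV. (x $ i)\<^sup>2)" by (rule norm_vec_square)
  also have "\<dots> = (x $ k)\<^sup>2 + ?S" by (subst sum.remove[of UNIV k]) auto
  finally have n: "(norm x)\<^sup>2 = (x $ k)\<^sup>2 + ?S" .
  have g: "(\<Prod>i\<in>UNIV - {k}. gexp 0 0 (x $ i)) = exp (of_real (- ?S / 2))"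
    by (simp add: exp_sum[symmetric] sum_negf sum_divide_distrib)
  have p: "pi powr (- real CARD('d) / 4) = pi powr (- (real CARD('d) - 1) / 4) * pi powr (- 1 / 4)"
    by (simp add: powr_add[symmetric] diff_divide_distrib)
  have "- (1/2) * (z\<^sup>2 + of_real ((x $ k)\<^sup>2 + ?S)) + of_real (sqrt 2) * (z * of_real (x $ k))
    = - z\<^sup>2 / 2 + (- (of_real (x $ k))\<^sup>2 / 2 + of_real (sqrt 2) * z * of_real (x $ k))
        + of_real (- ?S / 2)"
    by (simp add: field_simps)
  then have "exp (- (1/2) * (z\<^sup>2 + of_real ((x $ k)\<^sup>2 + ?S)) + of_real (sqrt 2) * (z * of_real (x $ k)))
    = exp (- z\<^sup>2 / 2) * gexp (of_real (sqrt 2) * z) 0 (x $ k) * exp (of_real (- ?S / 2))"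
    by (simp only: exp_add gexp.simps)
  then show "bargmann_kernel (axis k z) x = of_real (pi powr (- (real CARD('d) - 1) / 4))
      * gauss_lift k (bargmann_kernel (vec z)) x"
    unfolding bargmann_kernel_def[of "axis k z"] bilin_axis n p gauss_lift_eq bargmann_kernel_one g
    by (simp add: power2_eq_square ac_simps del: gexp.simps)
qed

lemma bargmann_kernel_one_mem:
  assumes "lin_closed X" "(\<lambda>x. gexp (of_real (sqrt 2) * z) 0 (x $ (1 :: 1))) \<in> X"
  shows "bargmann_kernel (vec z) \<in> X"
  unfolding bargmann_kernel_one by (rule lin_closed_scale[OF assms])

lemma S_half_bargmann_kernel_one: "bargmann_kernel (vec z :: complex^1) \<in> GS_step (1/2) (1/2) 6"
  by (rule bargmann_kernel_one_mem[OF seminorms_lin_closed[OF seminorms_GS_step] gexp_S_half]) simp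

lemma GS_step_half_S_half: "GS_step (1/2) (1/2) 6 \<subseteq> S_half"
  unfolding GS_def by (rule UN_upper) simp

lemma S_half_bargmann_kernel_axis: "bargmann_kernel (axis k z :: complex^'d::finite) \<in> GS_step
    (1/2) (1/2) 6"
proof -
  have l: "lin_closed (GS_step (1/2) (1/2) 6 :: (real^'d \<Rightarrow> complex) set)"
    by (rule seminorms_lin_closed[OF seminorms_GS_step]) simp
  obtain D where D: "bnd (gexp 0 0) (\<lambda>n m. D * gs_weight (1/2) (1/2) 6 n m)" using gexp_bnd_half by blast
  show ?thesis
    unfolding bargmann_kernel_axis
    by (rule lin_closed_scale[OF l gauss_lift_GS_step(1)[OF _ D S_half_bargmann_kernel_one]]) simp
qed

text \<open>\<open>as_functional\<close> returns 0 outside \<open>S_half\<close>; membership of the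
  kernels is what makes the transform the actual pairing and not this default value.\<close>

lemma bargmann_Functional_one: "bargmann (Functional u) (vec z :: complex^1)
    = u (bargmann_kernel (vec z))"
  and bargmann_Functional_axis: "bargmann (Functional v) (axis k z) = v (bargmann_kernel (axis k z))"
  using S_half_bargmann_kernel_one[of z] S_half_bargmann_kernel_axis[of k z] GS_step_half_S_half
  by (auto simp: bargmann_def)

text \<open>The transpose of the lift, with the case distinction restoring the normalisation of
  functionals outside their space.\<close>

lemma dual_space_lift:
  fixes u :: "(real^'d::finite \<Rightarrow> complex) \<Rightarrow> complex"
  assumes u: "u \<in> dual_space Y (seminorm_topology Y Q)"
    and X: "seminorms X P" and Y: "seminorms Y Q"
    and L: "\<And>f. f \<in> X \<Longrightarrow> gauss_lift k f \<in> Y"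
    and cont: "continuous_map (seminorm_topology X P) (seminorm_topology Y Q) (gauss_lift k)"
  shows "(\<lambda>f. if f \<in> X then c * u (gauss_lift k f) else 0) \<in> dual_space X (seminorm_topology X P)"
proof -
  let ?v = "\<lambda>f. if f \<in> X then c * u (gauss_lift k f) else 0"
  have lX: "lin_closed X" and lY: "lin_closed Y" using X Y by (auto intro: seminorms_lin_closed)
  have lin: "?v (\<lambda>x. a * f x + b * g x) = a * ?v f + b * ?v g" if "f \<in> X" "g \<in> X" for f g a b
    using that lin_closedD[OF lX that] dual_space_linear[OF u lY L[OF that(1)] L[OF that(2)]]
    by (simp add: gauss_lift_lin algebra_simps)
  have "continuous_map (seminorm_topology X P) euclidean ((\<lambda>z. c * z) \<circ> (u \<circ> gauss_lift k))"
  proof (intro continuous_map_compose[OF _ _])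
    show "continuous_map (seminorm_topology Y Q) euclidean u" using u by (simp add: dual_space_def)
    show "continuous_map euclidean euclidean (\<lambda>z. c * z)"
      by (simp add: continuous_map_iff_continuous2 continuous_intros)
  qed (rule cont)
  then have "continuous_map (seminorm_topology X P) euclidean ?v"
    by (rule continuous_map_eq) (simp add: topspace_seminorm_topology[OF X])
  then show ?thesis
    unfolding dual_space_def mem_Collect_eq
  proof (intro conjI ballI allI impI)
    show "?v (\<lambda>x. f x + g x) = ?v f + ?v g" if "f \<in> X" "g \<in> X" for f g
      using lin[OF that, of 1 1] by (simp only: mult_1)
    show "?v (\<lambda>x. a * f x) = a * ?v f" if "f \<in> X" for f a
      using lin[OF that that, of a 0] by (simp only: mult_zero_left add_0_right)
  qed auto
qed

section \<open>Averaging functions against a Gaussian\<close>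

lemma axis_in_Basis: "axis i (1 :: real) \<in> Basis"
  by (auto simp: Basis_vec_def)

lemma emeasure_box_cart:
  fixes l u :: "real^'n"
  assumes "\<And>i. l $ i \<le> u $ i"
  shows "emeasure lborel (box l u) = (\<Prod>i\<in>UNIV. ennreal (u $ i - l $ i))"
proof -
  have "emeasure lborel (box l u) = ennreal (\<Prod>b\<in>Basis. (u - l) \<bullet> b)"
    using assms by (intro emeasure_lborel_box) (auto simp: Basis_vec_def inner_axis)
  also have "(\<Prod>b\<in>Basis. (u - l) \<bullet> b) = (\<Prod>i\<in>UNIV. u $ i - l $ i)"
  proof -
    have B: "(Basis :: (real^'n) set) = (\<lambda>i. axis i 1) ` UNIV" by (auto simp: Basis_vec_def)
    moreover have "inj (\<lambda>i :: 'n. axis i (1 :: real))" by (auto simp: inj_def axis_eq_axis)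
    ultimately show ?thesis unfolding B by (subst prod.reindex) (simp_all add: inner_axis)
  qed
  finally show ?thesis using assms by (simp add: prod_ennreal)
qed

lemma vec_measurable: "(vec :: real \<Rightarrow> real^1) \<in> borel_measurable borel"
  by (intro borel_measurable_continuous_onI linear_continuous_on linear_conv_bounded_linear[THEN iffD1])
    (auto simp: linear_iff vec_eq_iff)

lemma lborel_vec: "distr lborel borel (vec :: real \<Rightarrow> real^1) = lborel"
proof (rule lborel_eqI[symmetric])
  fix l u :: "real^1" assume lu: "\<And>b. b \<in> Basis \<Longrightarrow> l \<bullet> b \<le> u \<bullet> b"
  have le: "l $ i \<le> u $ i" for i using lu[of "axis i 1"] by (simp add: inner_axis axis_in_Basis)
  have "vec -` box l u = {l $ 1 <..< u $ 1}" by (auto simp: mem_box_cart)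
  then have "emeasure (distr lborel borel vec) (box l u) = ennreal (u $ 1 - l $ 1)"
    using vec_measurable le[of 1] by (simp add: emeasure_distr)
  also have "\<dots> = emeasure lborel (box l u)"
    using le by (simp add: emeasure_box_cart UNIV_1)
  finally show "emeasure (distr lborel borel vec) (box l u) = ennreal (\<Prod>b\<in>Basis. (u - l) \<bullet> b)"
    using lu by (simp add: emeasure_lborel_box)
qed simp

lemma
  fixes g :: "real^1 \<Rightarrow> complex"
  assumes [measurable]: "g \<in> borel_measurable borel"
  shows integrable_vec: "integrable lborel g \<longleftrightarrow> integrable lborel (\<lambda>x. g (vec x))"
    and integral_vec: "integral\<^sup>L lborel g = (\<integral>x. g (vec x) \<partial>lborel)"
  using integrable_distr_eq[of vec lborel borel g] integral_distr[of vec lborel borel g] vec_measurable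
  by (simp_all add: lborel_vec)

lemma bnd_integrable:
  assumes "bnd g N"
  shows "integrable lborel g"
proof (rule Bochner_Integration.integrable_bound)
  show "integrable lborel (\<lambda>y. (N 0 0 + N 0 2) * inverse (1 + y\<^sup>2))"
    by (intro integrable_mult_right integrable_inverse_square)
  show "g \<in> borel_measurable lborel" using smooth1_measurable[OF bnd_smooth[OF assms], of 0] by simp
  have "norm (g x) \<le> (N 0 0 + N 0 2) * inverse (1 + x\<^sup>2)" for x
  proof -
    have p: "0 < 1 + x\<^sup>2" by (simp add: add_pos_nonneg)
    have "norm (g x) * (1 + x\<^sup>2) = \<bar>x\<bar> ^ 0 * norm (nderiv 0 g x) + \<bar>x\<bar> ^ 2 * norm (nderiv 0 g x)"
      by (simp add: algebra_simps)
    also have "\<dots> \<le> N 0 0 + N 0 2" by (intro add_mono bndD[OF assms])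
    finally show ?thesis using p by (simp add: field_simps)
  qed
  then show "AE x in lborel. norm (g x) \<le> norm ((N 0 0 + N 0 2) * inverse (1 + x\<^sup>2))"
    using bnd_nonneg[OF assms] by (intro AE_I2) (simp add: abs_mult)
qed

definition gauss_density :: "'a::euclidean_space \<Rightarrow> real" where
  "gauss_density y = exp (- (norm y)\<^sup>2 / 2)"

lemma integrable_gauss_real: "integrable lborel (\<lambda>x::real. exp (- x\<^sup>2 / 2))"
proof -
  have "(\<lambda>x::real. exp (- x\<^sup>2 / 2)) = (\<lambda>x. sqrt (2 * pi) * std_normal_density x)"
    by (simp add: std_normal_density_def)
  then show ?thesis by simp
qed

lemma integrable_gauss_density: "integrable lborel (gauss_density :: 'a::euclidean_space \<Rightarrow> real)"
proof (rule integrableI_nonneg)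
  show "(gauss_density :: 'a \<Rightarrow> real) \<in> borel_measurable lborel"
    unfolding gauss_density_def[abs_def] by measurable
  have eq: "gauss_density x = (\<Prod>b\<in>Basis. exp (- (x \<bullet> b)\<^sup>2 / 2))" for x :: 'a
  proof -
    have "(norm x)\<^sup>2 = (\<Sum>b\<in>Basis. (x \<bullet> b)\<^sup>2)"
      unfolding power2_norm_eq_inner by (subst euclidean_inner) (simp add: power2_eq_square)
    then show ?thesis
      by (simp add: gauss_density_def exp_sum[symmetric] sum_negf sum_divide_distrib)
  qed
  have "(\<integral>\<^sup>+x. ennreal (gauss_density (x :: 'a)) \<partial>lborel)
      = (\<integral>\<^sup>+x. (\<Prod>b\<in>Basis. ennreal (exp (- ((x :: 'a) \<bullet> b)\<^sup>2 / 2))) \<partial>lborel)"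
    unfolding eq by (simp add: prod_ennreal)
  also have "\<dots> = (\<Prod>b\<in>(Basis :: 'a set). \<integral>\<^sup>+x. ennreal (exp (- x\<^sup>2 / 2)) \<partial>lborel)"
    by (rule nn_integral_lborel_prod) auto
  also have "\<dots> < \<infinity>"
  proof -
    have "(\<integral>\<^sup>+x. ennreal (exp (- (x::real)\<^sup>2 / 2)) \<partial>lborel) < \<infinity>"
      using integrable_gauss_real by (subst nn_integral_eq_integral) auto
    then show ?thesis by (simp add: ennreal_prod_eq_top less_top power_less_top_ennreal)
  qed
  finally show "(\<integral>\<^sup>+x. ennreal (gauss_density (x :: 'a)) \<partial>lborel) < \<infinity>" .
qed (simp add: gauss_density_def)

section \<open>Exchanging a coordinate with an additional variable\<close>

lemma upd_continuous:
  fixes k :: "'n::finite"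
  shows "continuous_on UNIV (\<lambda>y. upd y k x)" "continuous_on UNIV (\<lambda>p. upd (snd p) k (fst p))"
proof -
  have eq: "upd y k x = y + (x - y $ k) *\<^sub>R axis k 1" for x and y :: "real^'n"
    by (auto simp: vec_eq_iff axis_def)
  show "continuous_on UNIV (\<lambda>y. upd y k x)" "continuous_on UNIV (\<lambda>p. upd (snd p) k (fst p))"
    unfolding eq by (intro continuous_intros)+
qed

text \<open>Written as an involution on pairs, the replacement of the coordinate \<open>k\<close>
  becomes a permutation of coordinates in one more dimension, to which Fubini's theorem can be
  applied.\<close>

definition swap_coord :: "'n::finite \<Rightarrow> real \<times> (real^'n) \<Rightarrow> real \<times> (real^'n)" where
  "swap_coord k = (\<lambda>(x, y). (y $ k, upd y k x))"

lemma swap_coord_measurable: "swap_coord k \<in> borel_measurable borel"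
proof -
  have "swap_coord k = (\<lambda>p. (snd p $ k, upd (snd p) k (fst p)))" by (auto simp: swap_coord_def)
  moreover have "continuous_on UNIV \<dots>" by (intro continuous_intros upd_continuous)
  ultimately show ?thesis by (simp add: borel_measurable_continuous_onI)
qed

text \<open>The preimage of a box is a box with two side lengths exchanged, and the volume of boxes
  determines Lebesgue measure.\<close>

lemma distr_swap_coord: "distr lborel borel (swap_coord k)
    = (lborel :: (real \<times> (real^'n::finite)) measure)"
proof (rule lborel_eqI[symmetric])
  fix l u :: "real \<times> (real^'n)" assume lu: "\<And>b. b \<in> Basis \<Longrightarrow> l \<bullet> b \<le> u \<bullet> b"
  obtain l1 l2 where l: "l = (l1, l2)" by (cases l)
  obtain u1 u2 where u: "u = (u1, u2)" by (cases u)
  have le1: "l1 \<le> u1" using lu[of "(1, 0)"] by (simp add: l u Basis_prod_def)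
  have le2: "l2 $ i \<le> u2 $ i" for i
    using lu[of "(0, axis i 1)"] by (simp add: l u Basis_prod_def inner_axis axis_in_Basis image_iff)
  have box: "emeasure lborel (box (a, c) (b, d)) = ennreal (b - a) * (\<Prod>i\<in>UNIV. ennreal (d $ i - c $ i))"
    if "a \<le> b" "\<And>i. c $ i \<le> d $ i" for a b :: real and c d :: "real^'n"
  proof -
    have "emeasure (lborel \<Otimes>\<^sub>M lborel) (box a b \<times> box c d)
        = emeasure lborel (box a b) * emeasure lborel (box c d)"
      by (rule lborel.emeasure_pair_measure_Times) auto
    then show ?thesis
      using that emeasure_box_cart[OF that(2)] unfolding lborel_prod box_prod fst_conv snd_conv by simp
  qed
  have pre: "swap_coord k -` box l u = box (l2 $ k, upd l2 k l1) (u2 $ k, upd u2 k u1)"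
    by (auto simp: swap_coord_def l u box_prod mem_box_cart split: if_splits)
  have "emeasure (distr lborel borel (swap_coord k)) (box l u)
      = emeasure lborel (swap_coord k -` box l u)"
    using swap_coord_measurable[of k] by (simp add: emeasure_distr)
  also have "\<dots> = ennreal (u2 $ k - l2 $ k) * (\<Prod>i\<in>UNIV. ennreal (upd u2 k u1 $ i - upd l2 k l1 $ i))"
    unfolding pre using le1 le2 by (intro box) auto
  also have "\<dots> = ennreal (u1 - l1) * (\<Prod>i\<in>UNIV. ennreal (u2 $ i - l2 $ i))"
    by (simp add: prod.remove[of UNIV k] ac_simps)
  also have "\<dots> = emeasure lborel (box l u)"
    unfolding l u by (rule box[symmetric]) (use le1 le2 in auto)
  finally show "emeasure (distr lborel borel (swap_coord k)) (box l u) = ennreal (\<Prod>b\<in>Basis. (u - l) \<bullet> b)"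
    using lu by (simp add: emeasure_lborel_box)
qed simp

text \<open>The coordinate that is replaced is integrated against a Gaussian as well; this only changes
  the normalisation and avoids integrals over a space of one dimension less.\<close>

definition gauss_average :: "'n::finite \<Rightarrow> (real^'n \<Rightarrow> complex) \<Rightarrow> real \<Rightarrow> complex" where
  "gauss_average k f x = (\<integral>y. f (upd y k x) * of_real (gauss_density y) \<partial>lborel)"

text \<open>The coordinate \<open>k\<close> of \<open>upd y k x\<close> is \<open>x\<close> itself,
  so derivatives and powers in \<open>x\<close> are those of \<open>f\<close> along one axis. Only
  seminorms with single indices enter, and they carry over up to a constant.\<close>

lemma bnd_gauss_average:
  fixes f :: "real^'n::finite \<Rightarrow> complex"
  assumes sm: "smooth_fun f" and S: "\<And>n m y. weighted_deriv (single_index k n) (single_index k m)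
      f y \<le> S n m"
  shows "bnd (gauss_average k f) (\<lambda>n m. integral\<^sup>L lborel (gauss_density :: real^'n \<Rightarrow> real) * S n m)"
proof -
  let ?w = "gauss_density :: real^'n \<Rightarrow> real"
  define H where "H = (\<lambda>n x y. iter_partial (replicate n k) f (upd y k x) * of_real (?w y))"
  define F where "F = (\<lambda>n x. \<integral>y. H n x y \<partial>lborel)"
  have w0: "0 \<le> ?w y" for y by (simp add: gauss_density_def)
  have dH: "((\<lambda>x. H n x y) has_vector_derivative H (Suc n) x y) (at x)" for n x y
    unfolding H_def by (intro has_vector_derivative_mult_left smooth_fun_line sm)
  have mw: "?w \<in> borel_measurable borel" unfolding gauss_density_def[abs_def] by measurable
  have mH: "H n x \<in> borel_measurable lborel" for n x
  proof -
    have "continuous_on UNIV (\<lambda>y. iter_partial (replicate n k) f (upd y k x))"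
      by (rule continuous_on_compose2[OF smooth_fun_continuous[OF sm] upd_continuous(1)]) simp
    from borel_measurable_continuous_onI[OF this] show ?thesis
      unfolding H_def using mw by (intro borel_measurable_times borel_measurable_of_real) auto
  qed
  have bH: "\<bar>x\<bar> ^ m * norm (H n x y) \<le> S n m * ?w y" for n m x y
    using mult_right_mono[OF S[where n = n and m = m and y = "upd y k x"] w0[of y]] w0[of y]
    by (simp add: H_def norm_mult norm_power multi_deriv_single_index ac_simps)
  have nH: "norm (H n x y) \<le> S n 0 * ?w y" for n x y using bH[of x 0 n y] by simp
  note wi = has_vector_derivative_weighted_integral[of H lborel
      "\<lambda>n. S n 0" ?w, OF dH mH nH integrable_gauss_density]
  have "bnd (F 0) (\<lambda>n m. integral\<^sup>L lborel ?w * S n m)"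
  proof (rule bndI[of F])
    show "(F n has_vector_derivative F (Suc n) x) (at x)" for n x unfolding F_def by (rule wi(2))
    show "\<bar>x\<bar> ^ m * norm (F n x) \<le> integral\<^sup>L lborel ?w * S n m" for n m x
    proof -
      have "\<bar>x\<bar> ^ m * norm (F n x) = norm (\<integral>y. of_real (\<bar>x\<bar> ^ m) * H n x y \<partial>lborel)"
        by (simp add: F_def norm_mult norm_power)
      also have "\<dots> \<le> (\<integral>y. S n m * ?w y \<partial>lborel)"
        using bH wi(1) integrable_gauss_density
            by (intro norm_integral_le) (auto simp: norm_mult norm_power)
      finally show ?thesis by (simp add: mult.commute)
    qed
  qed
  moreover have "F 0 = gauss_average k f" by (simp add: F_def H_def gauss_average_def fun_eq_iff
      iter_partial_def)
  ultimately show ?thesis by simp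
qed

text \<open>Boundedness of \<open>f\<close> and integrability of \<open>g\<close> and of the
  Gaussian justify Fubini. Exchanging \<open>x\<close> with the coordinate \<open>k\<close> frees
  \<open>f\<close> from the substitution and leaves a Gaussian integral as a constant
  factor.\<close>

lemma integral_gauss_average:
  fixes f :: "real^'n::finite \<Rightarrow> complex"
  assumes f: "f \<in> borel_measurable borel" "\<And>y. norm (f y) \<le> B" and g: "integrable lborel g"
  shows "(\<integral>x. gauss_average k f x * g x \<partial>lborel) =
    of_real (\<integral>x. exp (- x\<^sup>2 / 2) \<partial>lborel) * (\<integral>y. f y * (g (y $ k)
        * (\<Prod>i\<in>UNIV - {k}. gexp 0 0 (y $ i))) \<partial>lborel)"
proof -
  let ?w = "gauss_density :: real^'n \<Rightarrow> real"
  define G where "G = (\<lambda>p. f (upd (snd p) k (fst p)) * of_real (?w (snd p)) * g (fst p))"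
  define P where "P = (\<lambda>y. \<Prod>i\<in>UNIV - {k}. gexp 0 0 (y $ i))"
  have g_meas: "g \<in> borel_measurable borel" using borel_measurable_integrable[OF g] by simp
  have mw: "?w \<in> borel_measurable borel" unfolding gauss_density_def[abs_def] by measurable
  have mu: "(\<lambda>p. upd (snd p) k (fst p)) \<in> borel_measurable (borel :: (real \<times> (real^'n)) measure)"
    by (rule borel_measurable_continuous_onI[OF upd_continuous(2)])
  have ms: "snd \<in> borel_measurable (borel :: (real \<times> (real^'n)) measure)"
      "fst \<in> borel_measurable (borel :: (real \<times> (real^'n)) measure)"
    by (intro borel_measurable_continuous_onI continuous_intros)+
  have mG: "G \<in> borel_measurable borel"
    unfolding G_def
    using measurable_compose[OF mu f(1)] measurable_compose[OF ms(1) mw] measurable_compose[OF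
        ms(2) g_meas]
    by (intro borel_measurable_times borel_measurable_of_real) auto
  have "integrable (lborel \<Otimes>\<^sub>M lborel) (\<lambda>p. g (fst p) * complex_of_real (?w (snd p)))"
  proof (rule lborel_pair.Fubini_integrable)
    show "(\<lambda>p. g (fst p) * complex_of_real (?w (snd p))) \<in> borel_measurable (lborel \<Otimes>\<^sub>M lborel)"
      unfolding lborel_prod
      using measurable_compose[OF ms(1) mw] measurable_compose[OF ms(2) g_meas]
      by (intro borel_measurable_times borel_measurable_of_real) auto
    show "integrable lborel (\<lambda>x. \<integral>y. norm (g (fst (x, y)) * complex_of_real (?w (snd (x, y)))) \<partial>lborel)"
      using g by (simp add: norm_mult)
    show "AE x in lborel. integrable lborel (\<lambda>y. g (fst (x, y)) * complex_of_real (?w (snd (x, y))))"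
      using integrable_gauss_density by (intro AE_I2, simp only: fst_conv snd_conv, intro
          integrable_mult_right) (simp add: complex_of_real_integrable_eq)
  qed
  then have intG: "integrable (lborel \<Otimes>\<^sub>M lborel) G"
  proof (rule Bochner_Integration.integrable_bound[OF integrable_mult_right[of "of_real B"]])
    show "G \<in> borel_measurable (lborel \<Otimes>\<^sub>M lborel)" unfolding lborel_prod using mG by simp
    have "norm (G p) \<le> norm (of_real B * (g (fst p) * complex_of_real (?w (snd p))))" for p
      using mult_right_mono[OF f(2)[of "upd (snd p) k (fst p)"], of "norm (g (fst p)
          * complex_of_real (?w (snd p)))"]
        order_trans[OF norm_ge_zero f(2)]
      by (simp add: G_def norm_mult ac_simps)
    then show "AE p in lborel \<Otimes>\<^sub>M lborel. norm (G p)
        \<le> norm (of_real B * (g (fst p) * complex_of_real (?w (snd p))))"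
      by (intro AE_I2)
  qed
  have swap: "G (swap_coord k (x, y)) = of_real (exp (- x\<^sup>2 / 2)) * (f y * (g (y $ k) * P y))" for x y
  proof -
    have "upd (upd y k x) k (y $ k) = y" by (simp add: vec_eq_iff)
    \<comment> \<open>After the exchange, the factor of the Gaussian belonging to the coordinate
      \<open>k\<close> depends on \<open>x\<close> alone.\<close>
    moreover have "of_real (?w (upd y k x)) = of_real (exp (- x\<^sup>2 / 2)) * P y"
    proof -
      have "(norm (upd y k x))\<^sup>2 = x\<^sup>2 + (\<Sum>i\<in>UNIV - {k}. (y $ i)\<^sup>2)"
        unfolding norm_vec_square by (subst sum.remove[of UNIV k]) auto
      then have "?w (upd y k x) = exp (- x\<^sup>2 / 2) * exp (- (\<Sum>i\<in>UNIV - {k}. (y $ i)\<^sup>2) / 2)"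
        by (simp add: gauss_density_def exp_add[symmetric] diff_divide_distrib)
      moreover have "P y = of_real (exp (- (\<Sum>i\<in>UNIV - {k}. (y $ i)\<^sup>2) / 2))"
        by (simp add: P_def exp_of_real[symmetric] exp_sum[symmetric] sum_negf sum_divide_distrib del:
            exp_of_real)
      ultimately show ?thesis by simp
    qed
    ultimately show ?thesis by (simp add: G_def swap_coord_def)
  qed
  have intS: "integrable (lborel \<Otimes>\<^sub>M lborel) (\<lambda>p. G (swap_coord k p))"
    using intG swap_coord_measurable[of k] mG integrable_distr_eq[of "swap_coord k" lborel borel G]
    unfolding lborel_prod by (simp add: distr_swap_coord)
  have "(\<integral>x. gauss_average k f x * g x \<partial>lborel) = (\<integral>x. (\<integral>y. G (x, y) \<partial>lborel) \<partial>lborel)"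
    by (simp add: gauss_average_def G_def)
  also have "\<dots> = integral\<^sup>L (lborel \<Otimes>\<^sub>M lborel) G"
    by (rule lborel_pair.integral_fst'[OF intG])
  also have "\<dots> = integral\<^sup>L (lborel \<Otimes>\<^sub>M lborel) (\<lambda>p. G (swap_coord k p))"
    using integral_distr[of "swap_coord k" lborel borel G] swap_coord_measurable[of k] mG
    unfolding lborel_prod by (simp add: distr_swap_coord)
  also have "\<dots> = (\<integral>x. (\<integral>y. G (swap_coord k (x, y)) \<partial>lborel) \<partial>lborel)"
    by (rule lborel_pair.integral_fst'[OF intS, symmetric])
  also have "\<dots> = of_real (\<integral>x. exp (- x\<^sup>2 / 2) \<partial>lborel) * (\<integral>y. f y * (g (y $ k) * P y) \<partial>lborel)"
    unfolding swap by (simp del: of_real_exp add: integral_complex_of_real)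
  finally show ?thesis by (simp add: P_def)
qed

section \<open>The reduced function and functional\<close>

lemma bargmann_Function_one:
  "bargmann (Function f) (vec z :: complex^1) = (\<integral>x. f x * bargmann_kernel (vec z) x \<partial>lborel)"
  and bargmann_Function_axis:
  "bargmann (Function g) (axis k z :: complex^'d::finite)
      = (\<integral>x. g x * bargmann_kernel (axis k z) x \<partial>lborel)"
  using S_half_bargmann_kernel_one[of z] S_half_bargmann_kernel_axis[of k z] GS_step_half_S_half
  by (auto simp: bargmann_def)

lemma schwartz_measurable: "f \<in> schwartz \<Longrightarrow> f \<in> borel_measurable borel"
  using borel_measurable_continuous_onI[OF smooth_fun_continuous[of f "[]"]] schwartzD(1)[of f]
  by (simp add: iter_partial_def)

lemma schwartz_bounded: "f \<in> schwartz \<Longrightarrow> norm (f x)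
    \<le> schwartz_seminorm (single_index k 0) (single_index k 0) f"
  using schwartzD(2)[of f x "single_index k 0" "single_index k 0"]
      by (simp add: multi_deriv_single_index iter_partial_def)

lemma schwartz_vec:
  fixes f :: "real^1 \<Rightarrow> complex"
  assumes "f \<in> schwartz"
  shows "bnd (\<lambda>x. f (vec x)) (\<lambda>n m. schwartz_seminorm (single_index 1 n) (single_index 1 m) f)"
  by (intro bnd_vec schwartzD assms)

lemma schwartz_nth: "bnd g N \<Longrightarrow> (\<lambda>x. g (x $ (1 :: 1))) \<in> schwartz"
  by (rule schwartzI(1)[OF smooth_fun_nth weighted_deriv_nth])

lemma schwartz_integrable:
  fixes f :: "real^1 \<Rightarrow> complex"
  assumes "f \<in> schwartz"
  shows "integrable lborel f"
  using bnd_integrable[OF schwartz_vec[OF assms]] integrable_vec[OF schwartz_measurable[OF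
      assms]] by simp

lemma schwartz_integrable_mult:
  fixes f g :: "real^1 \<Rightarrow> complex"
  assumes "f \<in> schwartz" "g \<in> schwartz"
  shows "integrable lborel (\<lambda>x. f x * g x)"
    and "norm (\<integral>x. f x * g x \<partial>lborel) \<le> schwartz_seminorm (single_index 1 0) (single_index 1 0) g
        * (\<integral>x. norm (f x) \<partial>lborel)"
proof -
  let ?C = "schwartz_seminorm (single_index 1 0) (single_index 1 0) g"
  have le: "norm (f x * g x) \<le> ?C * norm (f x)" for x
    unfolding norm_mult using mult_left_mono[OF schwartz_bounded[OF assms(2), of x 1], of "norm (f x)"]
    by (simp add: mult.commute)
  have int: "integrable lborel (\<lambda>x. ?C * norm (f x))" using schwartz_integrable[OF assms(1)] by simp
  show i: "integrable lborel (\<lambda>x. f x * g x)"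
  proof (rule Bochner_Integration.integrable_bound[OF int])
    show "(\<lambda>x. f x * g x) \<in> borel_measurable lborel"
      using schwartz_measurable[OF assms(1)] schwartz_measurable[OF assms(2)] by simp
    show "AE x in lborel. norm (f x * g x) \<le> norm (?C * norm (f x))"
      by (intro AE_I2 order_trans[OF le]) simp
  qed
  show "norm (\<integral>x. f x * g x \<partial>lborel) \<le> ?C * (\<integral>x. norm (f x) \<partial>lborel)"
    using norm_integral_le[OF i int le] by simp
qed

section \<open>Injectivity of the Bargmann transform on Schwartz functions of one variable\<close>

lemma cnj_schwartz:
  fixes f :: "real^1 \<Rightarrow> complex"
  assumes "f \<in> schwartz"
  shows "(\<lambda>x. cnj (f x)) \<in> schwartz"
proof -
  note b = schwartz_vec[OF assms]
  let ?g = "\<lambda>x. f (vec x)" and ?G = "\<lambda>n x. cnj (nderiv n (\<lambda>x. f (vec x)) x)"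
  have "bnd (?G 0) (\<lambda>n m. schwartz_seminorm (single_index 1 n) (single_index 1 m) f)"
    by (rule bndI) (use bndD[OF b] in \<open>auto intro!: has_vector_derivative_cnj smooth1D[OF
        bnd_smooth[OF b]]\<close>)
  from schwartz_nth[OF this] show ?thesis by simp
qed

text \<open>The integral only gives vanishing almost everywhere; continuity makes the zero set
  closed and hence everything.\<close>

lemma eq_0_if_integral_norm_square:
  fixes f :: "real^1 \<Rightarrow> complex"
  assumes f: "f \<in> schwartz" and 0: "(\<integral>x. f x * cnj (f x) \<partial>lborel) = 0"
  shows "f x = 0"
proof -
  have sq: "f x * cnj (f x) = of_real ((norm (f x))\<^sup>2)" for x by (rule complex_norm_square[symmetric])
  have "integrable lborel (\<lambda>x. complex_of_real ((norm (f x))\<^sup>2))"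
    using schwartz_integrable_mult(1)[OF f cnj_schwartz[OF f]] unfolding sq .
  then have "integrable lborel (\<lambda>x. (norm (f x))\<^sup>2)" by (simp only: complex_of_real_integrable_eq)
  moreover have "(\<integral>x. (norm (f x))\<^sup>2 \<partial>lborel) = 0"
    using 0 unfolding sq integral_complex_of_real by simp
  ultimately have "AE x in lborel. (norm (f x))\<^sup>2 = 0"
    by (subst (asm) integral_nonneg_eq_0_iff_AE) auto
  then have "AE x in lebesgue. x \<in> {x. f x = 0}"
    by (intro AE_completion) simp
  moreover have "closed {x. f x = 0}"
    using smooth_fun_continuous[OF schwartzD(1)[OF f], of "[]"]
    by (intro closed_Collect_eq) (auto simp: iter_partial_def)
  ultimately show ?thesis using mem_closed_if_AE_lebesgue by blast
qed

text \<open>Every \<open>c\<close> is \<open>sqrt 2\<close> times some \<open>z\<close>, so the Bargmann kernels exhaust the functions \<open>gexp c 0\<close>.\<close>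

lemma gexp_via_kernel:
  "(\<lambda>x. gexp c 0 (x $ (1 :: 1))) = (\<lambda>x. (of_real (pi powr (1 / 4))
      * exp ((c / of_real (sqrt 2))\<^sup>2 / 2)) *
     bargmann_kernel (vec (c / of_real (sqrt 2)) :: complex^1) x)"
proof -
  have p: "complex_of_real (pi powr (1 / 4)) * of_real (pi powr (- 1 / 4)) = 1"
    by (simp add: of_real_mult[symmetric] powr_add[symmetric] del: of_real_mult)
  have e: "exp ((c / of_real (sqrt 2))\<^sup>2 / 2) * exp (- (c / of_real (sqrt 2))\<^sup>2 / 2) = 1"
    by (simp add: exp_add[symmetric])
  have eq: "(a * b) * ((a' * b') * w) = w" if "a * a' = 1" "b * b' = 1" for a b a' b' w :: complex
  proof -
    have "(a * b) * ((a' * b') * w) = (a * a') * (b * b') * w" by (simp only: ac_simps)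
    then show ?thesis using that by simp
  qed
  have c: "of_real (sqrt 2) * (c / of_real (sqrt 2)) = c" by simp
  show ?thesis unfolding bargmann_kernel_one c eq[OF p e] ..
qed

text \<open>Integration against the difference is a tempered functional that annihilates the
  Gaussians, hence vanishes on the conjugate of the difference. All function spaces of the list lie
  in the Schwartz space, so the critical index 1/2 is covered as well.\<close>

lemma bargmann_Function_inj:
  fixes f g :: "real^1 \<Rightarrow> complex"
  assumes f: "f \<in> schwartz" and g: "g \<in> schwartz"
    and eq: "\<And>z. bargmann (Function f) (vec z :: complex^1) = bargmann (Function g) (vec z)"
  shows "f = g"
proof -
  have lin: "lin_closed (schwartz :: (real^1 \<Rightarrow> complex) set)"
      by (rule seminorms_lin_closed[OF seminorms_schwartz])
  define e where "e = (\<lambda>x. f x - g x)"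
  have e: "e \<in> schwartz" unfolding e_def by (rule lin_closed_diff[OF lin f g])
  define u where "u = (\<lambda>\<phi>. \<integral>x. e x * \<phi> x \<partial>lborel)"
  have K: "(bargmann_kernel (vec z) :: real^1 \<Rightarrow> complex) \<in> schwartz" for z
    by (rule GS_step_schwartz[THEN subsetD, OF _ S_half_bargmann_kernel_one]) simp
  have u_lin: "u (\<lambda>x. a * \<phi> x + b * \<psi> x) = a * u \<phi> + b * u \<psi>"
      if "\<phi> \<in> schwartz" "\<psi> \<in> schwartz" for \<phi> \<psi> a b
  proof -
    have "u (\<lambda>x. a * \<phi> x + b * \<psi> x) = (\<integral>x. a * (e x * \<phi> x) + b * (e x * \<psi> x) \<partial>lborel)"
      unfolding u_def by (rule arg_cong[of _ _ "integral\<^sup>L lborel"]) (simp add: fun_eq_iff algebra_simps)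
    then show ?thesis
      using schwartz_integrable_mult(1)[OF e that(1)] schwartz_integrable_mult(1)[OF e that(2)]
          by (simp add: u_def)
  qed
  have "u (bargmann_kernel (vec z)) = 0" for z
  proof -
    have "u (bargmann_kernel (vec z)) = (\<integral>x. f x * bargmann_kernel (vec z) x - g x
        * bargmann_kernel (vec z) x \<partial>lborel)"
      by (simp add: u_def e_def left_diff_distrib)
    also have "\<dots> = 0"
      using schwartz_integrable_mult(1)[OF f K] schwartz_integrable_mult(1)[OF g K] eq[of z]
      by (simp add: bargmann_Function_one)
    finally show ?thesis .
  qed
  then have u0: "u (\<lambda>x. gexp c 0 (x $ 1)) = 0" for c
    unfolding gexp_via_kernel using u_lin[OF K K, where b = 0] by simp
  have "u (\<lambda>x. cnj (e x)) = 0"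
  proof (rule dual_schwartz_eq_0[OF u_lin _ u0 cnj_schwartz[OF e]])
    fix \<psi> :: "nat \<Rightarrow> real^1 \<Rightarrow> complex"
    assume \<psi>: "\<And>j. \<psi> j \<in> schwartz" and lim: "\<And>\<alpha> \<beta>. (\<lambda>j. schwartz_seminorm \<alpha> \<beta> (\<psi> j)) \<longlonglongrightarrow> 0"
    show "(\<lambda>j. u (\<psi> j)) \<longlonglongrightarrow> 0"
    proof (rule Lim_null_comparison)
      show "\<forall>\<^sub>F j in sequentially. norm (u (\<psi> j))
          \<le> schwartz_seminorm (single_index 1 0) (single_index 1 0) (\<psi> j) * (\<integral>x. norm (e x) \<partial>lborel)"
        unfolding u_def by (intro always_eventually allI schwartz_integrable_mult(2) e \<psi>)
      show "(\<lambda>j. schwartz_seminorm (single_index 1 0) (single_index 1 0) (\<psi> j)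
          * (\<integral>x. norm (e x) \<partial>lborel)) \<longlonglongrightarrow> 0"
        by (rule tendsto_mult_left_zero[OF lim])
    qed
  qed
  then have "e x = 0" for x
    unfolding u_def by (rule eq_0_if_integral_norm_square[OF e])
  then show ?thesis by (simp add: e_def fun_eq_iff)
qed

definition reduced_function :: "'d::finite \<Rightarrow> (real^'d \<Rightarrow> complex) \<Rightarrow> real^1 \<Rightarrow> complex" where
  "reduced_function k f = (\<lambda>x. of_real (pi powr (- (real CARD('d) - 1) / 4) / (\<integral>x. exp (- (x::real)\<^sup>2
      / 2) \<partial>lborel))
     * gauss_average k f (x $ 1))"

lemma bnd_reduced_function:
  fixes f :: "real^'d::finite \<Rightarrow> complex"
  assumes "smooth_fun f" "\<And>n m y. weighted_deriv (single_index k n) (single_index k m) f y \<le> S n m"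
  shows "\<exists>C. bnd (\<lambda>x. reduced_function k f (vec x)) (\<lambda>n m. C * S n m)"
proof -
  let ?c = "complex_of_real (pi powr (- (real CARD('d) - 1) / 4) / (\<integral>x. exp (- (x::real)\<^sup>2 /
      2) \<partial>lborel))"
  let ?I = "integral\<^sup>L lborel (gauss_density :: real^'d \<Rightarrow> real)"
  have "bnd (gauss_average k f) (\<lambda>n m. ?I * S n m)" by (rule bnd_gauss_average[OF assms])
  from bnd_lin[OF this this, of ?c 0] have "bnd (\<lambda>x. ?c * gauss_average k f x) (\<lambda>n m. (norm ?c
      * ?I) * S n m)"
    by (simp add: mult.assoc)
  then show ?thesis unfolding reduced_function_def vec_component by blast
qed

lemma reduced_function_schwartz:
  assumes "f \<in> schwartz"
  shows "reduced_function k f \<in> schwartz"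
proof -
  obtain C where "bnd (\<lambda>x. reduced_function k f (vec x)) (\<lambda>n m. C
      * schwartz_seminorm (single_index k n) (single_index k m) f)"
    using bnd_reduced_function[OF schwartzD(1)[OF assms] schwartzD(2)[OF assms]] by blast
  from schwartz_nth[OF this] show ?thesis by simp
qed

lemma reduced_function_GS_step:
  assumes h: "0 < h" and f: "f \<in> GS_step s t h"
  shows "reduced_function k f \<in> GS_step s t h"
proof -
  have "weighted_deriv (single_index k n) (single_index k m) f y
      \<le> GS_norm s t h f * gs_weight s t h n m" for n m y
    using GS_stepD(2)[OF h f, where \<alpha> = "single_index k n" and \<beta> = "single_index k m"] by simp
  from bnd_reduced_function[OF GS_stepD(1)[OF h f] this]
  obtain C where "bnd (\<lambda>x. reduced_function k f (vec x)) (\<lambda>n m. (C * GS_norm s t h f)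
      * gs_weight s t h n m)"
    by (auto simp: mult.assoc)
  from GS_step_nth(1)[OF h this] show ?thesis by simp
qed

lemma bargmann_reduced_function:
  fixes f :: "real^'d::finite \<Rightarrow> complex"
  assumes f: "f \<in> schwartz"
  shows "bargmann (Function (reduced_function k f)) (vec z :: complex^1)
      = bargmann (Function f) (axis k z)"
proof -
  let ?K = "bargmann_kernel (vec z) :: real^1 \<Rightarrow> complex"
  let ?p = "pi powr (- (real CARD('d) - 1) / 4)" and ?I = "\<integral>x. exp (- (x::real)\<^sup>2 / 2) \<partial>lborel"
  have K: "?K \<in> schwartz" using S_half_bargmann_kernel_one[of z] GS_step_schwartz[of 6] by auto
  have I: "?I \<noteq> 0"
  proof -
    have "(\<lambda>x::real. exp (- x\<^sup>2 / 2)) = (\<lambda>x. sqrt (2 * pi) * std_normal_density x)"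
      by (simp add: std_normal_density_def)
    then have "?I = sqrt (2 * pi)" by simp
    then show ?thesis by simp
  qed
  have m: "(\<lambda>x. reduced_function k f x * ?K x) \<in> borel_measurable borel"
    using schwartz_measurable[OF reduced_function_schwartz[OF f]] schwartz_measurable[OF K] by measurable
  have "bargmann (Function (reduced_function k f)) (vec z :: complex^1)
      = (\<integral>x. reduced_function k f (vec x) * ?K (vec x) \<partial>lborel)"
    unfolding bargmann_Function_one by (rule integral_vec[OF m])
  also have "\<dots> = of_real (?p / ?I) * (\<integral>x. gauss_average k f x * ?K (vec x) \<partial>lborel)"
    by (simp add: reduced_function_def mult.assoc del: of_real_divide)
  also have "(\<integral>x. gauss_average k f x * ?K (vec x) \<partial>lborel)
      = of_real ?I * (\<integral>y. f y * gauss_lift k ?K y \<partial>lborel)"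
    unfolding gauss_lift_eq
    by (rule integral_gauss_average[OF schwartz_measurable[OF f] schwartz_bounded[OF f, of _ k]
        bnd_integrable[OF schwartz_vec[OF K]]])
  also have "of_real (?p / ?I) * (of_real ?I * (\<integral>y. f y * gauss_lift k ?K y \<partial>lborel))
      = of_real ?p * (\<integral>y. f y * gauss_lift k ?K y \<partial>lborel)"
    using I by simp
  also have "\<dots> = (\<integral>y. f y * bargmann_kernel (axis k z) y \<partial>lborel)"
    unfolding bargmann_kernel_axis by (simp only: integral_mult_right_zero[symmetric] mult.left_commute)
  finally show ?thesis by (simp only: bargmann_Function_axis)
qed

lemma bilin_axis_axis: "bilin (axis k z) (axis k z) = z\<^sup>2"
  unfolding bilin_axis by (simp add: axis_def power2_eq_square)

lemma function_case:
  fixes f :: "real^'d::finite \<Rightarrow> complex" and B :: "(real^1 \<Rightarrow> complex) set"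
  assumes f: "f \<in> schwartz" and B: "reduced_function k f \<in> B" "B \<subseteq> schwartz"
    and F0: "\<forall>z. bargmann (Function f) z = F0 (bilin z z)"
  shows "\<exists>!f0. f0 \<in> Function ` B \<and> (\<forall>z. bargmann f0 (vec z) = F0 (z\<^sup>2))"
proof (rule ex1I)
  have *: "bargmann (Function (reduced_function k f)) (vec z) = F0 (z\<^sup>2)" for z
    using F0[rule_format, of "axis k z"] by (simp add: bargmann_reduced_function[OF f] bilin_axis_axis)
  then show "Function (reduced_function k f) \<in> Function ` B \<and>
      (\<forall>z. bargmann (Function (reduced_function k f)) (vec z) = F0 (z\<^sup>2))"
    using B by blast
  fix f0 assume f0: "f0 \<in> Function ` B \<and> (\<forall>z. bargmann f0 (vec z) = F0 (z\<^sup>2))"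
  then obtain g where g: "f0 = Function g" "g \<in> B" by blast
  then have "g = reduced_function k f"
    using bargmann_Function_inj[of g "reduced_function k f"] f0 * B by auto
  then show "f0 = Function (reduced_function k f)" using g by simp
qed

lemma dual_space_diff:
  assumes "u \<in> dual_space X T" "v \<in> dual_space X T"
  shows "(\<lambda>f. u f - v f) \<in> dual_space X T"
  using assms unfolding dual_space_def by (auto simp: algebra_simps intro: continuous_map_diff)

lemma functional_case:
  fixes u :: "(real^'d::finite \<Rightarrow> complex) \<Rightarrow> complex" and X :: "(real^1 \<Rightarrow> complex) set"
  assumes u: "u \<in> dual_space Y (seminorm_topology Y Q)"
    and X: "seminorms X P" and Y: "seminorms Y Q"
    and L: "\<And>f. f \<in> X \<Longrightarrow> gauss_lift k f \<in> Y"
    and cont: "continuous_map (seminorm_topology X P) (seminorm_topology Y Q) (gauss_lift k)"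
    and gexp: "\<And>c. (\<lambda>x. gexp c 0 (x $ 1)) \<in> X"
    and uniq: "\<And>v \<phi>. v \<in> dual_space X (seminorm_topology X P) \<Longrightarrow> (\<And>c. v (\<lambda>x. gexp c 0 (x $ 1)) = 0)
        \<Longrightarrow> \<phi> \<in> X \<Longrightarrow> v \<phi> = 0"
    and F0: "\<forall>z. bargmann (Functional u) z = F0 (bilin z z)"
  shows "\<exists>!f0. f0 \<in> Functional ` dual_space X (seminorm_topology X P)
      \<and> (\<forall>z. bargmann f0 (vec z) = F0 (z\<^sup>2))"
proof (rule ex1I)
  let ?D = "dual_space X (seminorm_topology X P)"
  define v where "v = (\<lambda>f. if f \<in> X then of_real (pi powr (- (real CARD('d) - 1) / 4))
      * u (gauss_lift k f) else 0)"
  have v: "v \<in> ?D" unfolding v_def by (rule dual_space_lift[OF u X Y L cont])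
  have lX: "lin_closed X" and lY: "lin_closed Y" using X Y by (auto intro: seminorms_lin_closed)
  have K: "bargmann_kernel (vec z) \<in> X" for z by (rule bargmann_kernel_one_mem[OF lX gexp])
  have *: "bargmann (Functional v) (vec z) = F0 (z\<^sup>2)" for z
  proof -
    have "v (bargmann_kernel (vec z)) = u (bargmann_kernel (axis k z))"
      using K[of z] dual_space_linear[OF u lY L[OF K] L[OF K], of _ z 0 z]
      by (simp add: v_def bargmann_kernel_axis)
    then show ?thesis
      using F0[rule_format, of "axis k z"] by (simp add: bargmann_Functional_one
          bargmann_Functional_axis bilin_axis_axis)
  qed
  then show "Functional v \<in> Functional ` ?D \<and> (\<forall>z. bargmann (Functional v) (vec z) = F0 (z\<^sup>2))"
    using v by blast
  fix f0 assume f0: "f0 \<in> Functional ` ?D \<and> (\<forall>z. bargmann f0 (vec z) = F0 (z\<^sup>2))"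
  then obtain w where w: "f0 = Functional w" "w \<in> ?D" by blast
  let ?e = "\<lambda>f. w f - v f"
  have e: "?e \<in> ?D" by (rule dual_space_diff[OF w(2) v])
  have eK: "?e (bargmann_kernel (vec z)) = 0" for z
    using f0 * w(1) by (simp add: bargmann_Functional_one)
  have "?e (\<lambda>x. gexp c 0 (x $ 1)) = 0" for c
    unfolding gexp_via_kernel using dual_space_linear[OF e lX K K, where b = 0] eK by simp
  from uniq[OF e this] have "w f = v f" if "f \<in> X" for f using that by simp
  \<comment> \<open>Off \<open>X\<close> both functionals are 0 by their normalisation, so agreement
    on \<open>X\<close> is equality.\<close>
  moreover have "w f = v f" if "f \<notin> X" for f using that w(2) v by (simp add: dual_space_def)
  ultimately have "w = v" by blast
  then show "f0 = Functional v" using w by simp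
qed

section \<open>Continuity of the Gaussian lift\<close>

lemma gauss_lift_schwartz:
  fixes \<phi> :: "real^1 \<Rightarrow> complex" and k :: "'d::finite"
  assumes "bnd (gexp 0 0) M" and \<phi>: "\<phi> \<in> schwartz"
  shows "gauss_lift k \<phi> \<in> schwartz"
    and "schwartz_seminorm \<alpha> \<beta> (gauss_lift k \<phi>) \<le>
      (\<Prod>i\<in>UNIV - {k}. M (\<alpha> i) (\<beta> i)) * schwartz_seminorm (single_index 1 (\<alpha> k)) (single_index 1 (\<beta> k)) \<phi>"
proof -
  note b = schwartz_vec[OF \<phi>]
  have w: "weighted_deriv \<alpha> \<beta> (gauss_lift k \<phi>) x \<le>
      (\<Prod>i\<in>UNIV - {k}. M (\<alpha> i) (\<beta> i)) * schwartz_seminorm (single_index 1 (\<alpha> k)) (single_index 1 (\<beta> k))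
          \<phi>" for \<alpha> \<beta> x
    using weighted_deriv_gauss_lift[OF b assms(1), where \<alpha> = \<alpha> and \<beta> = \<beta> and k = k and x = x]
    by (simp add: mult.commute)
  show "gauss_lift k \<phi> \<in> schwartz" by (rule schwartzI(1)[OF smooth_fun_gauss_lift[OF b assms(1)] w])
  show "schwartz_seminorm \<alpha> \<beta> (gauss_lift k \<phi>) \<le>
      (\<Prod>i\<in>UNIV - {k}. M (\<alpha> i) (\<beta> i)) * schwartz_seminorm (single_index 1 (\<alpha> k)) (single_index 1 (\<beta> k)) \<phi>"
    by (rule schwartzI(2)[OF smooth_fun_gauss_lift[OF b assms(1)] w])
qed

lemma continuous_gauss_lift_schwartz:
  fixes k :: "'d::finite"
  shows "continuous_map (schwartz_topology :: (real^1 \<Rightarrow> complex) topology) schwartz_topology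
      (gauss_lift k)"
proof -
  interpret weight_class "\<lambda>_. True" by (rule weight_class_all)
  obtain M where M: "bnd (gexp 0 0) M" using bnd_gexp by blast
  show ?thesis
    unfolding schwartz_topology_def
  proof (rule continuous_map_seminorm_topology[where L
      = "gauss_lift k", OF seminorms_schwartz seminorms_schwartz gauss_lift_schwartz(1)[OF M]
      gauss_lift_diff])
    fix q :: "(real^'d \<Rightarrow> complex) \<Rightarrow> real" assume "q \<in> {schwartz_seminorm \<alpha> \<beta> |\<alpha> \<beta>. True}"
    then obtain \<alpha> \<beta> where q: "q = schwartz_seminorm \<alpha> \<beta>" by blast
    show "\<exists>p\<in>{schwartz_seminorm \<alpha> \<beta> |\<alpha> \<beta>. True}. \<exists>C\<ge>0. \<forall>f\<in>schwartz. q (gauss_lift k f) \<le> C * p f"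
      unfolding q using gauss_lift_schwartz(2)[OF M, of _ \<alpha> \<beta> k] bnd_nonneg[OF M]
      by (intro bexI[of _ "schwartz_seminorm (single_index 1 (\<alpha> k)) (single_index 1 (\<beta> k))"] exI[of _
          "\<Prod>i\<in>UNIV - {k}. M (\<alpha> i) (\<beta> i)"])
        (auto intro!: prod_nonneg)
  qed
qed

lemma continuous_gauss_lift_GS_step:
  fixes k :: "'d::finite"
  assumes st: "1/2 < s" "1/2 < t" and h: "0 < h"
  shows "continuous_map (GS_step_topology s t h) (GS_step_topology s t h) (gauss_lift k)"
proof -
  obtain D where D: "0 \<le> D" "bnd (gexp 0 0) (\<lambda>n m. D * gs_weight s t h n m)"
      using gexp_bnd_GS[OF st h] by blast
  show ?thesis
    unfolding GS_step_topology_def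
    by (rule continuous_map_seminorm_topology[where L
        = "gauss_lift k", OF seminorms_GS_step[OF h] seminorms_GS_step[OF h] gauss_lift_GS_step(1)[OF
        h D(2)] gauss_lift_diff])
      (use gauss_lift_GS_step(2)[OF h D(2)] D(1) in \<open>auto intro!: exI[of _ "D ^ (CARD('d) - 1)"]\<close>)
qed

lemma gauss_lift_GS_step_mem:
  assumes "1/2 < s" "1/2 < t" "0 < h" "\<phi> \<in> GS_step s t h"
  shows "gauss_lift k \<phi> \<in> GS_step s t h"
  using gexp_bnd_GS[OF assms(1-3)] gauss_lift_GS_step(1)[OF assms(3) _ assms(4)] by blast

lemma gauss_lift_GS_Sigma:
  assumes "1/2 < s" "1/2 < t" "\<phi> \<in> GS_Sigma s t"
  shows "gauss_lift k \<phi> \<in> GS_Sigma s t"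
  using gauss_lift_GS_step_mem[OF assms(1,2)] assms(3) unfolding GS_Sigma_def by blast

lemma gauss_lift_GS:
  assumes "1/2 < s" "1/2 < t" "\<phi> \<in> GS s t"
  shows "gauss_lift k \<phi> \<in> GS s t"
  using gauss_lift_GS_step_mem[OF assms(1,2)] assms(3) unfolding GS_def by blast

lemma continuous_gauss_lift_GS_Sigma:
  fixes k :: "'d::finite"
  assumes st: "1/2 < s" "1/2 < t"
  shows "continuous_map (GS_Sigma_topology s t) (GS_Sigma_topology s t) (gauss_lift k)"
  unfolding GS_Sigma_topology_def
proof (rule continuous_map_seminorm_topology[where L
    = "gauss_lift k", OF seminorms_GS_Sigma seminorms_GS_Sigma gauss_lift_GS_Sigma[OF st]
    gauss_lift_diff])
  fix q :: "(real^'d \<Rightarrow> complex) \<Rightarrow> real" assume "q \<in> GS_norm s t ` {0<..}"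
  then obtain h where h: "0 < h" "q = GS_norm s t h" by auto
  obtain D where D: "0 \<le> D" "bnd (gexp 0 0) (\<lambda>n m. D * gs_weight s t h n m)"
      using gexp_bnd_GS[OF st h(1)] by blast
  show "\<exists>p\<in>GS_norm s t ` {0<..}. \<exists>C\<ge>0. \<forall>f\<in>GS_Sigma s t. q (gauss_lift k f) \<le> C * p f"
    unfolding h(2) using gauss_lift_GS_step(2)[OF h(1) D(2)] D(1) h(1)
    by (intro bexI[of _ "GS_norm s t h"] exI[of _ "D ^ (CARD('d) - 1)"]) (auto simp: GS_Sigma_def)
qed

text \<open>The family of defining seminorms is closed under composition with the lift, because the
  lift is linear and continuous on each step. The required bound then holds trivially with constant
  1.\<close>

lemma continuous_gauss_lift_GS:
  fixes k :: "'d::finite"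
  assumes st: "1/2 < s" "1/2 < t"
  shows "continuous_map (GS_topology s t) (GS_topology s t) (gauss_lift k)"
  unfolding GS_topology_def
proof (rule continuous_map_seminorm_topology[where L
    = "gauss_lift k", OF seminorms_GS seminorms_GS gauss_lift_GS[OF st] gauss_lift_diff])
  fix q :: "(real^'d \<Rightarrow> complex) \<Rightarrow> real"
  assume "q \<in> {p. seminorm_on (GS s t) p \<and> (\<forall>h>0. continuous_map (GS_step_topology s t h)
      euclideanreal p)}"
  then have q: "seminorm_on (GS s t) q" "\<And>h. 0 < h
      \<Longrightarrow> continuous_map (GS_step_topology s t h) euclideanreal q" by auto
  have "seminorm_on (GS s t) (q \<circ> gauss_lift k)"
    unfolding seminorm_on_def o_def
  proof (intro conjI ballI allI)
    fix f :: "real^1 \<Rightarrow> complex" assume f: "f \<in> GS s t"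
    note Lf = gauss_lift_GS[OF st f, of k]
    show "0 \<le> q (gauss_lift k f)" using q(1) Lf by (simp add: seminorm_on_def)
    have "gauss_lift k (\<lambda>x. c * f x) = (\<lambda>x. c * gauss_lift k f x)" for c
      using gauss_lift_lin[of k c f 0 f] by simp
    then show "q (gauss_lift k (\<lambda>x. c * f x)) = norm c * q (gauss_lift k f)" for c
      using q(1) Lf by (simp add: seminorm_on_def)
    fix g :: "real^1 \<Rightarrow> complex" assume g: "g \<in> GS s t"
    have "gauss_lift k (\<lambda>x. f x + g x) = (\<lambda>x. gauss_lift k f x + gauss_lift k g x)"
      using gauss_lift_lin[of k 1 f 1 g] by simp
    then show "q (gauss_lift k (\<lambda>x. f x + g x)) \<le> q (gauss_lift k f) + q (gauss_lift k g)"
      using q(1) Lf gauss_lift_GS[OF st g, of k] by (simp add: seminorm_on_def)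
  qed
  moreover have "continuous_map (GS_step_topology s t h) euclideanreal (q \<circ> gauss_lift k)"
      if "0 < h" for h
    by (rule continuous_map_compose[OF continuous_gauss_lift_GS_step[OF st that] q(2)[OF that]])
  ultimately show "\<exists>p\<in>{p. seminorm_on (GS s t) p
      \<and> (\<forall>h>0. continuous_map (GS_step_topology s t h) euclideanreal p)}.
      \<exists>C\<ge>0. \<forall>f\<in>GS s t. q (gauss_lift k f) \<le> C * p f"
    by (intro bexI[of _ "q \<circ> gauss_lift k"] exI[of _ 1]) auto
qed

lemma reduced_function_GS: "f \<in> GS s t \<Longrightarrow> reduced_function k f \<in> GS s t"
  and reduced_function_GS_Sigma: "f \<in> GS_Sigma s t \<Longrightarrow> reduced_function k f \<in> GS_Sigma s t"
  unfolding GS_def GS_Sigma_def using reduced_function_GS_step by blast+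

text \<open>On an axis the bilinear square is \<open>z\<^sup>2\<close>, so existence asks for an
  object whose one-dimensional transform is the restriction to that axis. Every choice of space then
  follows \<open>function_case\<close> or \<open>functional_case\<close>.\<close>

theorem proposition3p2:
  fixes s t :: real
    and V :: space_choice
    and f :: "('d::finite) gen_fun"
    and F0 :: "complex \<Rightarrow> complex"
  assumes "s > 1/2" and "t > 1/2"
    and "f \<in> V_space V s t"
    and "radial_symmetric f"
    and "F0 holomorphic_on UNIV"
    and "\<forall>z :: complex^'d. bargmann f z = F0 (bilin z z)"
  shows "\<exists>!f0 :: 1 gen_fun. f0 \<in> V_space V s t \<and>
           (\<forall>z :: complex. bargmann f0 (vec z) = F0 (z\<^sup>2))"
proof -
  \<comment> \<open>Any axis will do; index types are nonempty, so one exists.\<close>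
  fix k :: 'd
  note st = assms(1,2)
  note F = assms(6)
  \<comment> \<open>The same set equation is assumed at both dimensions, because the source and the
    target spaces have different types. The exponents \<open>s'\<close>, \<open>t'\<close> range
    over the given ones and the critical value 1/2.\<close>
  have GS: ?thesis if V0: "V_space V s t = Function ` (GS s' t' :: (real^'d \<Rightarrow> complex) set)"
      and V1: "V_space V s t = Function ` (GS s' t' :: (real^1 \<Rightarrow> complex) set)" for s' t'
  proof -
    obtain g where g: "f = Function g" "g \<in> GS s' t'" using assms(3) unfolding V0 by auto
    show ?thesis
      unfolding V1
      by (rule function_case[OF _ reduced_function_GS[OF g(2), of k] GS_subset_schwartz
          F[unfolded g(1)]])
        (use g(2) GS_subset_schwartz in blast)
  qed
  have gexp_Sigma: "(\<lambda>x. gexp c 0 (x $ (1 :: 1))) \<in> GS_Sigma s t" for c by (rule gexp_GS_Sigma[OF st])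
  then have gexp_GS: "(\<lambda>x. gexp c 0 (x $ (1 :: 1))) \<in> GS s t" for c using GS_Sigma_subset by blast
  then have gexp_schwartz: "(\<lambda>x. gexp c 0 (x $ (1 :: 1))) \<in> schwartz" for c
      using GS_subset_schwartz by blast
  show ?thesis
  proof (cases V)
    case S_half_half then show ?thesis by (intro GS) auto
  next
    case S_half_t then show ?thesis by (intro GS) auto
  next
    case S_s_half then show ?thesis by (intro GS) auto
  next
    case S_s_t then show ?thesis by (intro GS) auto
  next
    case Sigma_s_t
    then obtain g where g: "f = Function g" "g \<in> GS_Sigma s t" using assms(3) by auto
    show ?thesis
      unfolding Sigma_s_t V_space.simps
      by (rule function_case[OF _ reduced_function_GS_Sigma[OF g(2), of k] _ F[unfolded g(1)]])
        (use g(2) GS_Sigma_subset GS_subset_schwartz in blast)+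
  next
    case Schwartz
    then obtain g where g: "f = Function g" "g \<in> schwartz" using assms(3) by auto
    show ?thesis
      unfolding Schwartz V_space.simps
      by (rule function_case[OF g(2) reduced_function_schwartz[OF g(2), of k] order_refl
          F[unfolded g(1)]])
  next
    case Tempered
    then obtain u where u: "f = Functional u" "u \<in> dual_space schwartz schwartz_topology"
        using assms(3) by auto
    show ?thesis
      unfolding Tempered V_space.simps schwartz_topology_def
    proof (rule functional_case[OF u(2)[unfolded schwartz_topology_def] seminorms_schwartz
        seminorms_schwartz _ _ gexp_schwartz _ F[unfolded u(1)]])
      show "gauss_lift k \<phi> \<in> schwartz" if "\<phi> \<in> schwartz" for \<phi>
        using gexp_bnd_half[of 0] gauss_lift_schwartz(1)[OF _ that] by blast
      show "continuous_map (seminorm_topology schwartz {schwartz_seminorm \<alpha> \<beta> |\<alpha> \<beta>. True})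
          (seminorm_topology schwartz {schwartz_seminorm \<alpha> \<beta> |\<alpha> \<beta>. True}) (gauss_lift k)"
        using continuous_gauss_lift_schwartz[of k] unfolding schwartz_topology_def .
      fix v and \<phi> :: "real^1 \<Rightarrow> complex"
      assume v: "v \<in> dual_space schwartz (seminorm_topology schwartz {schwartz_seminorm \<alpha> \<beta> |\<alpha> \<beta>. True})"
        and v0: "\<And>c. v (\<lambda>x. gexp c 0 (x $ (1 :: 1))) = 0" and \<phi>: "\<phi> \<in> schwartz"
      show "v \<phi> = 0"
      proof (rule dual_schwartz_eq_0[where u = v, OF _ _ v0 \<phi>])
        show "v (\<lambda>x. a * f x + b * g x) = a * v f + b * v g" if "f \<in> schwartz" "g \<in> schwartz" for f g a b
          by (rule dual_space_linear[OF v seminorms_lin_closed[OF seminorms_schwartz] that])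
        show "(\<lambda>j. v (\<psi> j)) \<longlonglongrightarrow> 0"
          if "\<And>j. \<psi> j \<in> schwartz" "\<And>\<alpha> \<beta>. (\<lambda>j. schwartz_seminorm \<alpha> \<beta> (\<psi> j)) \<longlonglongrightarrow> 0" for \<psi>
          using that by (intro dual_space_null[OF v seminorms_schwartz]) auto
      qed
    qed
  next
    case S_s_t_dual
    then obtain u where u: "f = Functional u" "u \<in> dual_space (GS s t) (GS_topology s t)"
        using assms(3) by auto
    show ?thesis
      unfolding S_s_t_dual V_space.simps GS_topology_def
    proof (rule functional_case[where k = k, OF u(2)[unfolded GS_topology_def] seminorms_GS
        seminorms_GS _
          continuous_gauss_lift_GS[OF st, unfolded GS_topology_def] gexp_GS _ F[unfolded u(1)]])
      show "gauss_lift k \<phi> \<in> GS s t" if "\<phi> \<in> GS s t" for \<phi> by (rule gauss_lift_GS[OF st that])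
    qed (rule dual_GS_eq_0[OF st, unfolded GS_topology_def])
  next
    case Sigma_s_t_dual
    then obtain u where u: "f = Functional u" "u \<in> dual_space (GS_Sigma s t) (GS_Sigma_topology s t)"
        using assms(3) by auto
    show ?thesis
      unfolding Sigma_s_t_dual V_space.simps GS_Sigma_topology_def
    proof (rule functional_case[where k = k, OF u(2)[unfolded GS_Sigma_topology_def]
        seminorms_GS_Sigma seminorms_GS_Sigma _
          continuous_gauss_lift_GS_Sigma[OF st, unfolded GS_Sigma_topology_def] gexp_Sigma _
              F[unfolded u(1)]])
      show "gauss_lift k \<phi> \<in> GS_Sigma s t" if "\<phi> \<in> GS_Sigma s t" for \<phi>
          by (rule gauss_lift_GS_Sigma[OF st that])
    qed (rule dual_GS_Sigma_eq_0[OF st, unfolded GS_Sigma_topology_def])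
  qed
qed

end
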